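(* Let $k$ be an algebraically closed field, $m\ge1$, $d\in\{0,1,2,\dots\}\cup\{\infty\}$ and $\delta_0,\dots,\delta_{m-1}\in k$. Suppose that there exists some $j$ with $\delta_j\ne0$. Then for all $n\ge0$ $$\Lambda(X_{n,m}^d)=\Lambda(X_{n-2,m}^d)\sqcup(\Lambda(kC_m))^{\min(n,d)}=\coprod_{i=n,n-2,\dots,1/0}(\Lambda(kC_m))^{\min(i,d)},$$ where the last disjoint union is over all integers $i$ with $0\le i\le n$ and $n-i$ even, and equality means that the sets on the right may be taken as index sets for the simple $X_{n,m}^d$-modules.
   Context: For a finite-dimensional $k$-algebra $A$, $\Lambda(A)$ denotes an index set for the isomorphism classes of simple $A$-modules. $kC_m$ is the group algebra of the cyclic group of order $m$; $(\Lambda(kC_m))^{r}$ is the $r$-fold Cartesian power (a one-element set for $r=0$). By convention $\Lambda(X_{n-2,m}^d)=\emptyset$ for $n=0,1$. An arrow diagram is a rectangular box (the frame) containing pairwise non-intersecting line segments (lines), as in Temperley--Lieb diagrams; each line either joins two distinct endpoints (nodes) lying on the northern or southern edge of the frame, or is a closed loop; each node is the endpoint of exactly one line; and each line may carry finitely many arrows, each arrow assigning an orientation to its line. Diagrams are identified if they differ by an (edgewise) frame-preserving ambient isotopy. The product $AB$ is the concatenation of $A$ above $B$ (southern nodes of $A$ identified in order with the northern nodes of $B$, the middle edge ignored). A line is of depth $1$ if the diagram can be deformed ambient isotopically so that the line touches the eastern edge of the frame; inductively a line is of depth $d$ if it is not of depth less than $d$ but can be deformed ambient isotopically to touch a line of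 depth $d-1$. A diagram is decorated to depth $d$ if all lines carrying arrows are of depth at most $d$ (no condition if $d=\infty$). $D_n[d]$ is the set of arrow diagrams with $n$ northern and $n$ southern nodes decorated to depth $d$; it is closed under concatenation. The contour algebra $X_{n,m}^d=X_{n,m}^d(\delta_0,\dots,\delta_{m-1})$ is the algebra obtained from the free module $kD_n[d]$ with concatenation product by imposing the relations: (i) a diagram with two opposing arrows (arrows assigning opposite orientations) on the same line is identified with the same diagram with these two arrows omitted; (ii) a diagram with $m$ non-opposing arrows on the same line is identified with the same diagram with these arrows omitted; (iii) a diagram with an excess (modulo $m$) of $t$ anti-clockwise over clockwise arrows on a given closed loop ($0\le t\le m-1$) is identified with $\delta_t$ times the same diagram with the loop omitted. The same parameters $\delta_0,\dots,\delta_{m-1}$ are used for all $n$.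
   Formalization: For d=0 it is additionally assumed that δ_0≠0: no line then carries an arrow, the algebra depends only on δ_0, and for δ_0=0 the claim for all n≥0 fails at n=2 (k[U]/(U²) has one simple module, not two). For d≥1 nothing is changed. *)

theory Defs
  imports
    "HOL-Computational_Algebra.Polynomial"
    "HOL-Library.Multiset"
    "HOL-Library.Extended_Nat"
    "HOL-Library.Equipollence"
    "HOL-Algebra.Algebra"
begin

section \<open>Arrow diagrams\<close>

text \<open>
  Every line of a diagram separates the frame into the side containing the eastern edge and
  the far side.  An arrow is recorded by the sense in which it runs around the far side.  For a
  closed loop the far side is its interior, so this is the usual meaning of (anti-)clockwise.
\<close>

datatype arrow = Clockwise | Anticlockwise

primrec flip :: "arrow \<Rightarrow> arrow" where
  "flip Clockwise = Anticlockwise"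
| "flip Anticlockwise = Clockwise"

text \<open>The arrows met when a line is traversed in the other direction.\<close>

definition reversed :: "arrow list \<Rightarrow> arrow list" where
  "reversed w = rev (map flip w)"

text \<open>The arrows on a closed loop form a word up to rotation.\<close>

lemma equivp_rotate: "equivp (\<lambda>u v :: 'a list. \<exists>k. v = rotate k u)"
proof (rule equivpI)
  show "reflp (\<lambda>u v :: 'a list. \<exists>k. v = rotate k u)"
    by (rule reflpI) (metis rotate0 id_apply)
  show "symp (\<lambda>u v :: 'a list. \<exists>k. v = rotate k u)"
  proof (rule sympI, elim exE)
    fix u v :: "'a list" and k
    assume v: "v = rotate k u"
    show "\<exists>l. u = rotate l v"
    proof (cases "u = []")
      case False
      have "(length u - k mod length u + k) mod length u =
          (length u - k mod length u + k mod length u) mod length u"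
        by (simp add: mod_add_right_eq)
      also have "length u - k mod length u + k mod length u = length u"
        using False by (simp add: less_imp_le)
      finally have "(length u - k mod length u + k) mod length u = 0" by simp
      then have "rotate (length u - k mod length u) v = u"
        by (simp add: v rotate_rotate rotate_id)
      then show ?thesis by metis
    qed (use v in simp)
  qed
  show "transp (\<lambda>u v :: 'a list. \<exists>k. v = rotate k u)"
    by (rule transpI) (metis rotate_rotate)
qed

quotient_type cyclic_word = "arrow list" / "\<lambda>u v. \<exists>k. v = rotate k u"
  by (rule equivp_rotate)

lift_definition cyc :: "arrow list \<Rightarrow> cyclic_word" is "\<lambda>w. w" .

lift_definition excess :: "cyclic_word \<Rightarrow> int" is
  "\<lambda>w. int (count_list w Anticlockwise) - int (count_list w Clockwise)"
proof -
  fix u v :: "arrow list"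
  assume "\<exists>k. v = rotate k u"
  then obtain k where "v = rotate k u" ..
  then have "mset v = mset (take (k mod length u) u @ drop (k mod length u) u)"
    unfolding rotate_drop_take mset_append by (simp add: add.commute)
  then have "mset v = mset u" by simp
  then show "int (count_list u Anticlockwise) - int (count_list u Clockwise) =
      int (count_list v Anticlockwise) - int (count_list v Clockwise)"
    by (metis count_mset)
qed

text \<open>
  Isotopy classes of arrow diagrams are encoded by the plane trees dual to them.  The lines cut the
  frame into regions; the dual graph is a tree, rooted at the region that meets the eastern edge.

  A closed loop is given by its arrows and the loops lying directly inside it.  Loops in a common
  region can be permuted by isotopies, hence the multisets.

  A line with two endpoints is called an arc here.  Go around the frame anti-clockwise from the
  north-eastern corner, that is, along the northern edge from east to west and then along
  the southern edge from west to east.  A value \<open>Region L as\<close> describes a region together with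
  everything beyond it, as seen from the eastern edge: \<open>L\<close> are the loops directly in the region and
  \<open>as\<close> the arcs separating it from a farther region, in the order of their first endpoints.  Each
  arc comes with its arrows, read from its first to its second endpoint (in which
  direction it runs clockwise around its far side), and with the region beyond it.  The nodes
  belonging to an entry \<open>(w, R)\<close> of \<open>as\<close> are the first endpoint, the nodes of \<open>R\<close>, and the second
  endpoint, in this order.

  A whole diagram is the region meeting the eastern edge.  If it has \<open>n\<close> arcs, then its \<open>2 * n\<close>
  nodes are numbered \<open>0, \<dots>, 2 * n - 1\<close> in the above order; the nodes below \<open>n\<close> are the northern
  ones (from east to west), the others the southern ones (from west to east).
\<close>

datatype loop = Loop cyclic_word "loop multiset"

datatype region = Region "loop multiset" "(arrow list \<times> region) list"

fun num_arcs :: "region \<Rightarrow> nat" where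
  "num_arcs (Region L []) = 0"
| "num_arcs (Region L ((w, R) # as)) = Suc (num_arcs R + num_arcs (Region L as))"

subsection \<open>Depth\<close>

text \<open>
  A line can be deformed to touch another line (or the eastern edge) iff both bound a common
  region.  The lines bounding a region are the line that separates it from the eastern edge, if
  any, and those listed directly in it.  So the lines directly in the region at the eastern edge
  have depth \<open>1\<close>, and the depth grows by one whenever a line is crossed.

  \<open>arrow_at R k\<close>: some line of depth \<open>k\<close> in the diagram \<open>R\<close> carries an arrow.
\<close>

inductive loop_arrow_at :: "loop multiset \<Rightarrow> nat \<Rightarrow> bool" where
  here: "Loop c M \<in># L \<Longrightarrow> c \<noteq> cyc [] \<Longrightarrow> loop_arrow_at L 1"
| inside: "Loop c M \<in># L \<Longrightarrow> loop_arrow_at M k \<Longrightarrow> loop_arrow_at L (Suc k)"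

inductive arrow_at :: "region \<Rightarrow> nat \<Rightarrow> bool" where
  on_loop: "loop_arrow_at L k \<Longrightarrow> arrow_at (Region L as) k"
| on_arc: "(w, R) \<in> set as \<Longrightarrow> w \<noteq> [] \<Longrightarrow> arrow_at (Region L as) 1"
| beyond_arc: "(w, R) \<in> set as \<Longrightarrow> arrow_at R k \<Longrightarrow> arrow_at (Region L as) (Suc k)"

definition decorated_to_depth :: "enat \<Rightarrow> region \<Rightarrow> bool" where
  "decorated_to_depth d R \<longleftrightarrow> (\<forall>k. arrow_at R k \<longrightarrow> enat k \<le> d)"

definition diagrams :: "nat \<Rightarrow> enat \<Rightarrow> region set" where
  "diagrams n d = {R. num_arcs R = n \<and> decorated_to_depth d R}"

subsection \<open>Concatenation\<close>

text \<open>
  \<open>connect i R\<close> joins the consecutive nodes \<open>i\<close> and \<open>i + 1\<close> by an arc without arrows outside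
  the frame; these two nodes disappear.  With \<open>s\<close> the number of nodes beyond the first arc (which
  has the endpoints \<open>0\<close> and \<open>s + 1\<close>), the cases are:
  \<^item> \<open>i = 0\<close>, \<open>s = 0\<close>: both nodes belong to the first arc, which becomes a closed loop;
  \<^item> \<open>i = 0\<close>, \<open>s > 0\<close>: first endpoints of the first arc and of the first arc beyond it;
  \<^item> \<open>0 < i < s\<close>: both nodes lie beyond the first arc;
  \<^item> \<open>i = s > 0\<close>: second endpoints of the last arc beyond the first arc and of the first arc;
  \<^item> \<open>i = s + 1\<close>: second endpoint of the first arc and first endpoint of the next arc;
  \<^item> \<open>i > s + 1\<close>: both nodes come after the first arc.
  In the second and fourth case the region beyond the inner arc merges with the region
  \<open>Region L _\<close> itself and the inner arc changes sides, so its arrows are reversed.  In the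
  fifth case the regions beyond the two arcs merge.  The clauses for empty lists are never
  reached when \<open>i + 1 < 2 * num_arcs R\<close>.
\<close>

fun connect :: "nat \<Rightarrow> region \<Rightarrow> region" where
  "connect i (Region L []) = Region L []"
| "connect i (Region L ((w, Region M as) # bs)) =
    (let s = 2 * num_arcs (Region M as) in
     if i = 0 then
       (case as of
          [] \<Rightarrow> Region (add_mset (Loop (cyc w) M) L) bs
        | (v, Region K cs) # ds \<Rightarrow> Region (K + L) (cs @ (reversed v @ w, Region M ds) # bs))
     else if i < s then Region L ((w, connect (i - 1) (Region M as)) # bs)
     else if i = s then
       (case last as of
          (v, Region K cs) \<Rightarrow>
            Region (K + L) ((w @ reversed v, Region M (butlast as)) # cs @ bs))
     else if i = s + 1 then
       (case bs of
          [] \<Rightarrow> Region L ((w, Region M as) # bs)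
        | (v, Region K cs) # ds \<Rightarrow> Region L ((w @ v, Region (M + K) (as @ cs)) # ds))
     else
       (case connect (i - (s + 2)) (Region L bs) of
          Region L' bs' \<Rightarrow> Region L' ((w, Region M as) # bs')))"

text \<open>
  To stack \<open>A\<close> above \<open>B\<close>, first join the frames along a strip at their eastern ends.  This merges
  the two eastern regions, and the nodes of \<open>A\<close> are followed by those of \<open>B\<close>.  Then connect the
  southern nodes of \<open>A\<close> to the northern nodes of \<open>B\<close> one after the other, starting in the east.
\<close>

fun juxtapose :: "region \<Rightarrow> region \<Rightarrow> region" where
  "juxtapose (Region L as) (Region M bs) = Region (L + M) (as @ bs)"

definition concatenate :: "nat \<Rightarrow> region \<Rightarrow> region \<Rightarrow> region" where
  "concatenate n A B = fold connect (rev [n..<2 * n]) (juxtapose A B)"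

primrec identity_diagram :: "nat \<Rightarrow> region" where
  "identity_diagram 0 = Region {#} []"
| "identity_diagram (Suc n) = Region {#} [([], identity_diagram n)]"

definition diagram_monoid :: "nat \<Rightarrow> enat \<Rightarrow> region monoid" where
  "diagram_monoid n d =
    \<lparr>carrier = diagrams n d, mult = concatenate n, one = identity_diagram n\<rparr>"

section \<open>Monoid algebras and the contour algebra\<close>

definition monoid_algebra :: "('a, 'b) monoid_scheme \<Rightarrow> ('a \<Rightarrow> 'k::field) ring" where
  "monoid_algebra G =
    \<lparr>carrier = {f. finite {x. f x \<noteq> 0} \<and> {x. f x \<noteq> 0} \<subseteq> carrier G},
     mult = (\<lambda>f g x. \<Sum>(a, b) \<in> {(a, b). f a \<noteq> 0 \<and> g b \<noteq> 0 \<and> a \<otimes>\<^bsub>G\<^esub> b = x}. f a * g b),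
     one = (\<lambda>x. if x = \<one>\<^bsub>G\<^esub> then 1 else 0),
     ring.zero = (\<lambda>x. 0),
     ring.add = (\<lambda>f g x. f x + g x)\<rparr>"

text \<open>
  The effect of the relations on the arrows of a single line: two opposing arrows, or \<open>m\<close> arrows
  of the same orientation, are omitted.  They need not be adjacent: \<open>w \<in> shuffles u v\<close> says that
  deleting suitable letters that form the word \<open>u\<close> leaves \<open>v\<close>.
\<close>

inductive omit_arrows :: "nat \<Rightarrow> arrow list \<Rightarrow> arrow list \<Rightarrow> bool" for m where
  opposing: "w \<in> shuffles [a, flip a] v \<Longrightarrow> omit_arrows m w v"
| non_opposing: "w \<in> shuffles (replicate m a) v \<Longrightarrow> omit_arrows m w v"

text \<open>
  \<open>identified m \<delta> D c D'\<close>: one of the defining relations identifies \<open>D\<close> with \<open>c\<close> times \<open>D'\<close>.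
  Omitting a loop releases the loops inside it into the surrounding region.
\<close>

inductive loops_identified ::
    "nat \<Rightarrow> (nat \<Rightarrow> 'k::field) \<Rightarrow> loop multiset \<Rightarrow> 'k \<Rightarrow> loop multiset \<Rightarrow> bool"
  for m \<delta> where
  arrows: "omit_arrows m w v \<Longrightarrow>
    loops_identified m \<delta> (add_mset (Loop (cyc w) M) L) 1 (add_mset (Loop (cyc v) M) L)"
| loop: "loops_identified m \<delta> (add_mset (Loop c M) L) (\<delta> (nat (excess c mod int m))) (M + L)"
| inside: "loops_identified m \<delta> M x M' \<Longrightarrow>
    loops_identified m \<delta> (add_mset (Loop c M) L) x (add_mset (Loop c M') L)"

inductive identified :: "nat \<Rightarrow> (nat \<Rightarrow> 'k::field) \<Rightarrow> region \<Rightarrow> 'k \<Rightarrow> region \<Rightarrow> bool"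
  for m \<delta> where
  arrows: "omit_arrows m w v \<Longrightarrow>
    identified m \<delta> (Region L (as @ (w, R) # bs)) 1 (Region L (as @ (v, R) # bs))"
| loops: "loops_identified m \<delta> L x L' \<Longrightarrow> identified m \<delta> (Region L as) x (Region L' as)"
| beyond: "identified m \<delta> R x R' \<Longrightarrow>
    identified m \<delta> (Region L (as @ (w, R) # bs)) x (Region L (as @ (w, R') # bs))"

text \<open>Omitting arrows or loops never increases depths, so \<open>D'\<close> below lies in \<open>diagrams n d\<close> too.\<close>

definition relators :: "nat \<Rightarrow> nat \<Rightarrow> enat \<Rightarrow> (nat \<Rightarrow> 'k::field) \<Rightarrow> (region \<Rightarrow> 'k) set" where
  "relators n m d \<delta> =
    {(\<lambda>E. (if E = D then 1 else 0) - (if E = D' then c else 0)) | D c D'.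
       D \<in> diagrams n d \<and> identified m \<delta> D c D'}"

text \<open>
  A two-sided ideal of a unital \<open>k\<close>-algebra is a \<open>k\<close>-subspace, so the quotient as a ring
  is the quotient as an algebra.
\<close>

definition contour_algebra ::
    "nat \<Rightarrow> nat \<Rightarrow> enat \<Rightarrow> (nat \<Rightarrow> 'k::field) \<Rightarrow> (region \<Rightarrow> 'k) set ring" where
  "contour_algebra n m d \<delta> =
    (let A = monoid_algebra (diagram_monoid n d) in A Quot (Idl\<^bsub>A\<^esub> (relators n m d \<delta>)))"

definition cyclic_group_algebra :: "nat \<Rightarrow> (int \<Rightarrow> 'k::field) ring" where
  "cyclic_group_algebra m = monoid_algebra (integer_mod_group m)"

section \<open>Simple modules\<close>

text \<open>The library locale \<open>module\<close> requires a commutative ring of scalars.\<close>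

locale left_module = A?: ring A + M?: abelian_group M
  for A :: "('a, 'c) ring_scheme" (structure) and M :: "('a, 'b, 'e) module_scheme" (structure) +
  assumes smult_closed: "\<lbrakk>a \<in> carrier A; x \<in> carrier M\<rbrakk> \<Longrightarrow> a \<odot>\<^bsub>M\<^esub> x \<in> carrier M"
    and smult_l_distr: "\<lbrakk>a \<in> carrier A; b \<in> carrier A; x \<in> carrier M\<rbrakk> \<Longrightarrow>
      (a \<oplus>\<^bsub>A\<^esub> b) \<odot>\<^bsub>M\<^esub> x = a \<odot>\<^bsub>M\<^esub> x \<oplus>\<^bsub>M\<^esub> b \<odot>\<^bsub>M\<^esub> x"
    and smult_r_distr: "\<lbrakk>a \<in> carrier A; x \<in> carrier M; y \<in> carrier M\<rbrakk> \<Longrightarrow>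
      a \<odot>\<^bsub>M\<^esub> (x \<oplus>\<^bsub>M\<^esub> y) = a \<odot>\<^bsub>M\<^esub> x \<oplus>\<^bsub>M\<^esub> a \<odot>\<^bsub>M\<^esub> y"
    and smult_assoc: "\<lbrakk>a \<in> carrier A; b \<in> carrier A; x \<in> carrier M\<rbrakk> \<Longrightarrow>
      (a \<otimes>\<^bsub>A\<^esub> b) \<odot>\<^bsub>M\<^esub> x = a \<odot>\<^bsub>M\<^esub> (b \<odot>\<^bsub>M\<^esub> x)"
    and smult_one: "x \<in> carrier M \<Longrightarrow> \<one>\<^bsub>A\<^esub> \<odot>\<^bsub>M\<^esub> x = x"

definition simple_module :: "('a, 'c) ring_scheme \<Rightarrow> ('a, 'b) module \<Rightarrow> bool" where
  "simple_module A M \<longleftrightarrow> left_module A M \<and> carrier M \<noteq> {\<zero>\<^bsub>M\<^esub>} \<and>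
    (\<forall>N. submodule N A M \<longrightarrow> N = {\<zero>\<^bsub>M\<^esub>} \<or> N = carrier M)"

definition module_isomorphic ::
    "('a, 'c) ring_scheme \<Rightarrow> ('a, 'b) module \<Rightarrow> ('a, 'b) module \<Rightarrow> bool" where
  "module_isomorphic A M N \<longleftrightarrow> (\<exists>f. bij_betw f (carrier M) (carrier N) \<and>
    (\<forall>x\<in>carrier M. \<forall>y\<in>carrier M. f (x \<oplus>\<^bsub>M\<^esub> y) = f x \<oplus>\<^bsub>N\<^esub> f y) \<and>
    (\<forall>a\<in>carrier A. \<forall>x\<in>carrier M. f (a \<odot>\<^bsub>M\<^esub> x) = a \<odot>\<^bsub>N\<^esub> f x))"

text \<open>
  The set of isomorphism classes of simple left \<open>A\<close>-modules.  A simple module is isomorphic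
  to a quotient of \<open>A\<close> by a left ideal, so it is enough to consider modules whose elements are
  sets of elements of \<open>A\<close>.
\<close>

definition simple_classes :: "('a, 'c) ring_scheme \<Rightarrow> ('a, 'a set) module set set" where
  "simple_classes A = {M. simple_module A M} //
    {(M, N). simple_module A M \<and> simple_module A N \<and> module_isomorphic A M N}"

definition indexes_simples :: "'i set \<Rightarrow> ('a, 'c) ring_scheme \<Rightarrow> bool" where
  "indexes_simples I A \<longleftrightarrow> I \<approx> simple_classes A"

text \<open>The \<open>r\<close>-fold Cartesian power, as a set of functions on \<open>{..<r}\<close>.\<close>

definition cartesian_power :: "'a set \<Rightarrow> nat \<Rightarrow> (nat \<Rightarrow> 'a) set" where
  "cartesian_power S r = ({..<r} \<rightarrow>\<^sub>E S)"

end

theory Submission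
  imports Defs "HOL-Library.Function_Algebras"
begin

text \<open>
  The simple modules are constructed and recognised as highest weight modules.

  Fix \<open>i \<le> n\<close> with \<open>n - i = 2 t\<close>, and \<open>j\<close> with \<open>\<delta> j \<noteq> 0\<close>. Let \<open>p\<close> be the diagram with \<open>i\<close> northern and \<open>n\<close>
  southern nodes that consists of \<open>i\<close> through lines and \<open>t\<close> caps at the eastern end of the southern edge,
  and let \<open>q\<close> be its mirror image with \<open>j\<close> anticlockwise arrows on each of the \<open>t\<close> cups. Stacking \<open>p\<close> on
  \<open>q\<close> gives \<open>t\<close> loops next to the eastern edge, so \<open>p q = (\<delta> j)\<^sup>t\<close>. Hence \<open>e\<^sub>i = (\<delta> j)\<^sup>-\<^sup>t q p\<close> is an
  idempotent of the algebra on \<open>n\<close> nodes, and \<open>x \<mapsto> p x q\<close> compresses this algebra to the one on \<open>i\<close>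
  nodes. Diagrams on \<open>i\<close> nodes with fewer than \<open>i\<close> through lines span an ideal, and modulo this ideal
  there remain the arrows, counted modulo \<open>m\<close>, on the \<open>min i d\<close> through lines of depth at most \<open>d\<close>. So
  every family \<open>\<zeta>\<close> of \<open>min i d\<close> many \<open>m\<close>-th roots of unity gives a multiplicative functional
  (\<open>through_value_stack\<close>) and, by compression, a functional \<open>\<phi>\<close> on the algebra on \<open>n\<close> nodes with
  \<open>\<phi> (x e\<^sub>i y) = \<phi> x \<phi> y\<close> and \<open>\<phi> 1 = 1\<close>.

  Such a functional determines a simple module: the elements \<open>f\<close> with \<open>\<phi> (a f) = 0\<close> for all \<open>a\<close> form a
  maximal left ideal, because \<open>e\<^sub>i a f - \<phi> (a f)\<close> lies in it (\<open>maximal_left_ideal_vanishing\<close>). In the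
  quotient, \<open>e\<^sub>i\<close> projects onto a line on which \<open>e\<^sub>i x e\<^sub>i\<close> acts by \<open>\<phi> x\<close>, so \<open>\<zeta>\<close> can be recovered from the
  module; and \<open>e\<^sub>i\<close> acts as \<open>0\<close> on the modules that belong to larger indices, so \<open>i\<close> can be recovered as
  well. Conversely, given a simple module \<open>M\<close>, let \<open>i\<close> be least with \<open>e\<^sub>i M \<noteq> 0\<close>. Diagrams with fewer than
  \<open>i\<close> through lines factor through \<open>i - 2\<close> nodes and act as \<open>0\<close> on \<open>e\<^sub>i M\<close>. The arrows on single lines act as
  commuting operators of order \<open>m\<close>, which have a common eigenvector since the field is algebraically
  closed (\<open>exists_highest_weight_vector\<close>). The general criterion behind this argument,
  \<open>simple_classes_of_functionals\<close>, also shows that the simple modules of the group algebra of the cyclic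
  group correspond to the \<open>m\<close>-th roots of unity. So the sets to be compared are finite and have the same
  numbers of elements.

  The geometric part is to see that stacking is associative and compatible with the relations.
  Everything follows from the interchange law for joining nodes at two gaps (\<open>connect_interchange\<close>),
  and this is reduced to a manageable case distinction by moving the root of the dual tree
  (\<open>connect_rot\<close>).
\<close>

section \<open>Concatenation of diagrams\<close>

text \<open>
  The loops of a region do not contribute to \<open>num_arcs\<close>, so the arcs are counted on their own.
\<close>

definition arcs_in :: "(arrow list \<times> region) list \<Rightarrow> nat" where
  "arcs_in as = (\<Sum>(w, R)\<leftarrow>as. Suc (num_arcs R))"

lemma arcs_in_simps [simp]:
  "arcs_in [] = 0" "arcs_in ((w, R) # as) = Suc (num_arcs R + arcs_in as)"
  "arcs_in (as @ bs) = arcs_in as + arcs_in bs"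
  by (simp_all add: arcs_in_def)

lemma num_arcs_Region [simp]: "num_arcs (Region L as) = arcs_in as"
  by (induction as) auto

declare num_arcs.simps [simp del]

lemma arcs_in_eq_0 [simp]: "arcs_in as = 0 \<longleftrightarrow> as = []"
  by (cases as) auto

lemma num_arcs_juxtapose [simp]: "num_arcs (juxtapose A B) = num_arcs A + num_arcs B"
  by (cases A; cases B) auto

lemma juxtapose_assoc: "juxtapose (juxtapose A B) C = juxtapose A (juxtapose B C)"
  by (cases A; cases B; cases C) (simp add: add.assoc)

lemma juxtapose_empty [simp]:
  "juxtapose (Region {#} []) A = A" "juxtapose A (Region {#} []) = A"
  by (cases A; simp)+

lemma num_arcs_identity [simp]: "num_arcs (identity_diagram n) = n"
  by (induction n) auto

lemma reversed_append: "reversed (u @ v) = reversed v @ reversed u"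
  by (simp add: reversed_def)

lemma flip_flip [simp]: "flip (flip a) = a"
  by (cases a) auto

lemma reversed_reversed [simp]: "reversed (reversed w) = w"
  by (induction w) (auto simp: reversed_def)

lemma reversed_Nil [simp]: "reversed w = [] \<longleftrightarrow> w = []" "reversed [] = []"
  by (auto simp: reversed_def)

subsection \<open>Joining two neighbouring nodes\<close>

lemma connect_loop: "connect 0 (Region L ((w, Region M []) # bs)) = Region (add_mset (Loop (cyc w) M) L) bs"
  by simp

lemma connect_firsts: "connect 0 (Region L ((w, Region M ((v, Region K cs) # ds)) # bs)) =
    Region (K + L) (cs @ (reversed v @ w, Region M ds) # bs)"
  by simp

lemma connect_beyond: "0 < i \<Longrightarrow> i < 2 * num_arcs R \<Longrightarrow>
    connect i (Region L ((w, R) # bs)) = Region L ((w, connect (i - 1) R) # bs)"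
  by (cases R) (simp add: Let_def)

lemma connect_lasts: "i = 2 * arcs_in (as @ [(v, Region K cs)]) \<Longrightarrow>
    connect i (Region L ((w, Region M (as @ [(v, Region K cs)])) # bs)) =
      Region (K + L) ((w @ reversed v, Region M as) # cs @ bs)"
  by (simp add: Let_def)

lemma connect_next: "i = Suc (2 * num_arcs R) \<Longrightarrow>
    connect i (Region L ((w, R) # (v, S) # ds)) = Region L ((w @ v, juxtapose R S) # ds)"
  by (cases R; cases S) (simp add: Let_def)

lemma connect_after: "i \<ge> 2 * num_arcs R + 2 \<Longrightarrow>
    connect i (Region L ((w, R) # bs)) =
      juxtapose (Region {#} [(w, R)]) (connect (i - (2 * num_arcs R + 2)) (Region L bs))"
  by (cases R) (simp add: Let_def split: region.split)

declare connect.simps [simp del]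

text \<open>
  The six ways in which a gap can lie relative to the first arc. Phrasing the case distinction with
  explicit shapes of the diagram lets every later case be computed by one of the rules above.
\<close>

lemma connect_cases [case_names loop firsts beyond lasts "next" after]:
  assumes "Suc i < 2 * num_arcs R"
  obtains
    L w M bs where "R = Region L ((w, Region M []) # bs)" "i = 0"
  | L w M v K cs ds bs where "R = Region L ((w, Region M ((v, Region K cs) # ds)) # bs)" "i = 0"
  | L w S bs where "R = Region L ((w, S) # bs)" "0 < i" "i < 2 * num_arcs S"
  | L w M as v K cs bs where "R = Region L ((w, Region M (as @ [(v, Region K cs)])) # bs)"
      "i = 2 * arcs_in (as @ [(v, Region K cs)])"
  | L w S v T ds where "R = Region L ((w, S) # (v, T) # ds)" "i = Suc (2 * num_arcs S)"
  | L w S bs where "R = Region L ((w, S) # bs)" "i \<ge> 2 * num_arcs S + 2"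
      "Suc (i - (2 * num_arcs S + 2)) < 2 * arcs_in bs"
proof -
  obtain L xs where R: "R = Region L xs" by (cases R)
  with assms obtain w S bs where xs: "xs = (w, S) # bs"
    by (cases xs) auto
  obtain M as where S: "S = Region M as" by (cases S)
  consider "i = 0" | "0 < i" "i < 2 * num_arcs S" | "0 < i" "i = 2 * num_arcs S"
    | "i = Suc (2 * num_arcs S)" | "i \<ge> 2 * num_arcs S + 2"
    by linarith
  then show thesis
  proof cases
    case 1
    show thesis
    proof (cases as)
      case Nil
      then show thesis using that(1) R xs S 1 by blast
    next
      case (Cons a ds)
      obtain v K cs where "a = (v, Region K cs)" by (metis surj_pair region.exhaust)
      then show thesis using that(2) R xs S 1 Cons by blast
    qed
  next
    case 2
    then show thesis using that(3) R xs by blast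
  next
    case 3
    then have "as \<noteq> []" using S by auto
    then obtain as' a where as: "as = as' @ [a]" by (metis rev_exhaust)
    obtain v K cs where "a = (v, Region K cs)" by (metis surj_pair region.exhaust)
    then show thesis using that(4) R xs S 3 as by (metis num_arcs_Region)
  next
    case 4
    then have "bs \<noteq> []" using assms R xs by auto
    then obtain v T ds where "bs = (v, T) # ds" by (metis list.exhaust surj_pair)
    then show thesis using that(5) R xs 4 by blast
  next
    case 5
    then show thesis using that(6) R xs assms by auto
  qed
qed

lemma num_arcs_connect [simp]: "Suc i < 2 * num_arcs R \<Longrightarrow> num_arcs (connect i R) = num_arcs R - 1"
proof (induction "num_arcs R" arbitrary: i R rule: less_induct)
  case less
  from less.prems show ?case
  proof (cases rule: connect_cases)
    case (beyond L w S bs)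
    then have "num_arcs (connect (i - 1) S) = num_arcs S - 1"
      by (intro less.hyps) auto
    then show ?thesis using beyond by (simp add: connect_beyond)
  next
    case (after L w S bs)
    then have "num_arcs (connect (i - (2 * num_arcs S + 2)) (Region L bs)) = arcs_in bs - 1"
      using less.hyps[of "Region L bs"] by simp
    then show ?thesis using after by (simp add: connect_after)
  qed (auto simp: connect_loop connect_firsts connect_lasts connect_next)
qed

lemma connect_add_loops:
  "connect i (juxtapose (Region U []) R) = juxtapose (Region U []) (connect i R)"
proof (induction "num_arcs R" arbitrary: i R rule: less_induct)
  case less
  obtain L xs where R: "R = Region L xs" by (cases R)
  show ?case
  proof (cases "Suc i < 2 * num_arcs R")
    case True
    then show ?thesis
    proof (cases rule: connect_cases)
      case (after L w S bs)
      have "connect j (Region (U + L) bs) = juxtapose (Region U []) (connect j (Region L bs))" for j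
        using less.hyps[of "Region L bs"] after by auto
      then show ?thesis using after
        by (cases "connect (i - (2 * num_arcs S + 2)) (Region L bs)") (simp add: connect_after)
    qed (auto simp: connect_loop connect_firsts connect_lasts connect_next connect_beyond add_ac)
  next
    case False
    show ?thesis
    proof (cases xs)
      case Nil then show ?thesis by (simp add: R connect.simps)
    next
      case (Cons a bs)
      obtain w M as where a: "a = (w, Region M as)" by (metis surj_pair region.exhaust)
      have IH: "connect j (Region (U + L) bs) = juxtapose (Region U []) (connect j (Region L bs))" for j
        using less.hyps[of "Region L bs"] by (auto simp: R Cons a)
      have "bs = [] \<and> i = Suc (2 * arcs_in as) \<or> i \<ge> 2 * arcs_in as + 2"
        using False by (cases bs) (auto simp: R Cons a)
      then consider "bs = []" "i = Suc (2 * arcs_in as)" | "i \<ge> 2 * arcs_in as + 2"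
        by blast
      then show ?thesis
        by cases (use IH in \<open>auto simp: R Cons a connect.simps Let_def split: region.split\<close>)
    qed
  qed
qed

text \<open>\<open>connect\<close> is local: it does not see arcs beside the one or two that it joins.\<close>

lemma connect_juxtapose_right:
  "connect (2 * num_arcs A + i) (juxtapose A B) = juxtapose A (connect i B)"
proof -
  obtain L as where A: "A = Region L as" by (cases A)
  obtain M bs where B: "B = Region M bs" by (cases B)
  have "connect (2 * arcs_in as + i) (juxtapose (Region L as) B) = juxtapose (Region L as) (connect i B)"
  proof (induction as)
    case Nil
    then show ?case by (simp add: connect_add_loops)
  next
    case (Cons a as)
    then show ?case
      by (cases a; cases "connect i B") (simp add: B connect_after algebra_simps)
  qed
  then show ?thesis by (simp add: A)
qed

lemma connect_juxtapose_left:
  assumes "Suc i < 2 * num_arcs A"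
  shows "connect i (juxtapose A B) = juxtapose (connect i A) B"
  using assms
proof (induction "num_arcs A" arbitrary: i A rule: less_induct)
  case less
  obtain N es where B: "B = Region N es" by (cases B)
  from less.prems show ?case
  proof (cases rule: connect_cases)
    case (after L w S bs)
    then have "connect (i - (2 * num_arcs S + 2)) (juxtapose (Region L bs) B) =
        juxtapose (connect (i - (2 * num_arcs S + 2)) (Region L bs)) B"
      by (intro less.hyps) auto
    then show ?thesis using after
      by (cases "connect (i - (2 * num_arcs S + 2)) (Region L bs)")
        (simp add: B connect_after)
  qed (auto simp: B connect_loop connect_firsts connect_lasts connect_next connect_beyond add_ac)
qed

subsection \<open>Moving the root\<close>

text \<open>
  The dual tree is rooted at the eastern region only by convention. \<open>rot\<close> moves the root across the
  first arc, so that node \<open>0\<close> becomes the last node and all other numbers drop by one. In this way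
  any gap between two nodes can be moved to the front, which replaces most inductions on trees.
\<close>

fun rot :: "region \<Rightarrow> region" where
  "rot (Region L []) = Region L []"
| "rot (Region L ((w, Region M as) # bs)) = Region M (as @ [(reversed w, Region L bs)])"

fun unrot :: "region \<Rightarrow> region" where
  "unrot (Region L xs) = (if xs = [] then Region L [] else
     (case last xs of (w, Region M bs) \<Rightarrow> Region M ((reversed w, Region L (butlast xs)) # bs)))"

lemma unrot_snoc: "unrot (Region L (as @ [(w, Region M bs)])) = Region M ((reversed w, Region L as) # bs)"
  by simp

lemma unrot_rot [simp]: "unrot (rot R) = R"
  by (cases R rule: rot.cases) auto

lemma rot_unrot [simp]: "rot (unrot R) = R"
proof (cases R)
  case (Region L xs)
  show ?thesis
  proof (cases xs rule: rev_cases)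
    case Nil then show ?thesis by (simp add: Region)
  next
    case (snoc ys y)
    obtain w M bs where "y = (w, Region M bs)" by (metis surj_pair region.exhaust)
    then show ?thesis using Region snoc by simp
  qed
qed

declare unrot.simps [simp del]

lemma rot_inject: "rot A = rot B \<Longrightarrow> A = B"
  by (metis unrot_rot)

lemma unrot_inject: "unrot A = unrot B \<Longrightarrow> A = B"
  by (metis rot_unrot)

lemma num_arcs_rot [simp]: "num_arcs (rot R) = num_arcs R"
  by (cases R rule: rot.cases) auto

lemma num_arcs_unrot [simp]: "num_arcs (unrot R) = num_arcs R"
  by (metis num_arcs_rot rot_unrot)

text \<open>
  Joining two nodes is an operation near the boundary of the frame and does not depend on the root.
  Only the two gaps next to node \<open>0\<close>, which \<open>rot\<close> moves, have to be excluded.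
\<close>

lemma connect_rot:
  assumes "i + 2 < 2 * num_arcs R"
  shows "connect i (rot R) = rot (connect (Suc i) R)"
proof -
  have "Suc (Suc i) < 2 * num_arcs R" using assms by simp
  then show ?thesis
  proof (cases rule: connect_cases)
    case (beyond L w S bs)
    obtain M as where S: "S = Region M as" by (cases S)
    have "connect i (juxtapose (Region M as) (Region {#} [(reversed w, Region L bs)])) =
        juxtapose (connect i (Region M as)) (Region {#} [(reversed w, Region L bs)])"
      using beyond S by (intro connect_juxtapose_left) auto
    then show ?thesis using beyond S by (cases "connect i (Region M as)") (simp add: connect_beyond)
  next
    case (lasts L w M as v K cs bs)
    have "connect (2 * num_arcs (Region M as) + Suc (2 * arcs_in cs))
        (juxtapose (Region M as) (Region {#} [(v, Region K cs), (reversed w, Region L bs)])) =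
      juxtapose (Region M as)
        (connect (Suc (2 * arcs_in cs)) (Region {#} [(v, Region K cs), (reversed w, Region L bs)]))"
      by (rule connect_juxtapose_right)
    then show ?thesis using lasts
      by (simp add: connect_lasts connect_next reversed_append algebra_simps)
  next
    case ("next" L w S v T ds)
    obtain M as where S: "S = Region M as" by (cases S)
    obtain K cs where T: "T = Region K cs" by (cases T)
    have "connect (2 * num_arcs (Region M as) + 0)
        (juxtapose (Region M as) (Region {#} [(reversed w, Region L ((v, Region K cs) # ds))])) =
      juxtapose (Region M as) (connect 0 (Region {#} [(reversed w, Region L ((v, Region K cs) # ds))]))"
      by (rule connect_juxtapose_right)
    then show ?thesis using "next" S T
      by (simp add: connect_firsts connect_next reversed_append)
  next
    case (after L w S bs)
    obtain M as where S: "S = Region M as" by (cases S)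
    define t where "t = i - (2 * num_arcs S + 1)"
    have i: "i = 2 * arcs_in as + Suc t" using after S by (simp add: t_def)
    have "connect (2 * num_arcs (Region M as) + Suc t)
        (juxtapose (Region M as) (Region {#} [(reversed w, Region L bs)])) =
      juxtapose (Region M as) (connect (Suc t) (Region {#} [(reversed w, Region L bs)]))"
      by (rule connect_juxtapose_right)
    moreover have "Suc t < 2 * num_arcs (Region L bs)" using after S by (simp add: i)
    ultimately show ?thesis using after S i
      by (cases "connect t (Region L bs)") (simp add: connect_after connect_beyond)
  qed auto
qed

text \<open>
  If two arcs are closed up to a loop at their two pairs of ends, the order of the two steps decides
  at which point the word of the loop is cut open.
\<close>

lemma cyc_append_commute: "cyc (u @ v) = cyc (v @ u)"
proof -
  have "v @ u = rotate (length u) (u @ v)" by (simp add: rotate_append)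
  then show ?thesis by (metis cyclic_word.abs_eq_iff cyc.abs_eq)
qed

text \<open>
  The only place where the interchange law depends on the shape of the diagram: the second gap may
  touch the arcs that the first step joins, or lie beyond or beside them.
\<close>

lemma connect_0_interchange:
  assumes "2 \<le> j" "Suc j < 2 * num_arcs R"
  shows "connect 0 (connect j R) = connect (j - 2) (connect 0 R)"
proof -
  obtain L xs where R: "R = Region L xs" by (cases R)
  with assms obtain w S bs where xs: "xs = (w, S) # bs" by (cases xs) auto
  obtain M as where S: "S = Region M as" by (cases S)
  show ?thesis
  proof (cases as)
    case Nil
    define t where "t = j - 2"
    have j: "j = t + 2" using assms by (simp add: t_def)
    have "connect t (juxtapose (Region {#Loop (cyc w) M#} []) (Region L bs)) =
        juxtapose (Region {#Loop (cyc w) M#} []) (connect t (Region L bs))"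
      by (rule connect_add_loops)
    then show ?thesis using R xs S Nil j
      by (cases "connect t (Region L bs)") (simp add: connect_after connect_loop)
  next
    case (Cons a ds)
    obtain v K cs where a: "a = (v, Region K cs)" by (metis surj_pair region.exhaust)
    have R': "R = Region L ((w, Region M ((v, Region K cs) # ds)) # bs)"
      using R xs S Cons a by simp
    let ?Q = "Region L ((reversed v @ w, Region M ds) # bs)"
    have right: "connect (2 * arcs_in cs + t) (connect 0 R) = juxtapose (Region K cs) (connect t ?Q)" for t
      using connect_juxtapose_right[of "Region K cs" t ?Q] by (simp add: R' connect_firsts)
    from assms(2) show ?thesis
    proof (cases rule: connect_cases)
      case loop then show ?thesis using R' by simp
    next
      case firsts then show ?thesis using assms by simp
    next
      case (beyond L1 w1 S1 bs1)
      then have eqs: "L1 = L" "w1 = w" "S1 = Region M ((v, Region K cs) # ds)" "bs1 = bs"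
        using R' by auto
      have j: "connect j R = Region L ((w, connect (j - 1) S1) # bs)"
        using beyond eqs by (simp add: connect_beyond)
      have "Suc (j - 1) < 2 * num_arcs S1" using beyond assms by simp
      then show ?thesis
      proof (cases rule: connect_cases)
        case loop then show ?thesis using assms by simp
      next
        case firsts then show ?thesis using assms by simp
      next
        case b2: (beyond L2 w2 S2 bs2)
        then have e2: "L2 = M" "w2 = v" "S2 = Region K cs" "bs2 = ds" using eqs by auto
        have "connect (j - 2) (juxtapose (Region K cs) ?Q) = juxtapose (connect (j - 2) (Region K cs)) ?Q"
          using b2 e2 assms by (intro connect_juxtapose_left) auto
        moreover have "j - Suc (Suc 0) = j - 2" by simp
        ultimately show ?thesis using b2 e2 j R'
          by (cases "connect (j - 2) (Region K cs)") (simp add: connect_beyond connect_firsts)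
      next
        case l2: (lasts L2 w2 M2 as2 u P ps bs2)
        then have e2: "L2 = M" "w2 = v" "M2 = K" "cs = as2 @ [(u, Region P ps)]" "bs2 = ds"
          using eqs by auto
        have "connect (2 * num_arcs (Region K as2) + Suc (2 * arcs_in ps))
              (juxtapose (Region K as2) (Region L ((u, Region P ps) # (reversed v @ w, Region M ds) # bs))) =
            juxtapose (Region K as2)
              (connect (Suc (2 * arcs_in ps)) (Region L ((u, Region P ps) # (reversed v @ w, Region M ds) # bs)))"
          by (rule connect_juxtapose_right)
        moreover have "j - 2 = 2 * arcs_in as2 + Suc (2 * arcs_in ps)" using l2 by simp
        ultimately show ?thesis using l2 e2 j R'
          by (simp add: connect_lasts connect_next connect_firsts reversed_append add_ac)
      next
        case n2: ("next" L2 w2 S2 u T ds2)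
        obtain P ps where T: "T = Region P ps" by (cases T)
        have e2: "L2 = M" "w2 = v" "S2 = Region K cs" "ds = (u, Region P ps) # ds2"
          using eqs n2 T by auto
        have "j - 2 = 2 * arcs_in cs + 0" using n2 e2 by simp
        then have "connect (j - 2) (connect 0 R) = juxtapose (Region K cs) (connect 0 ?Q)"
          using right by metis
        then show ?thesis using n2 e2 T j R'
          by (simp add: connect_next connect_firsts reversed_append add_ac)
      next
        case a2: (after L2 w2 S2 bs2)
        then have e2: "L2 = M" "w2 = v" "S2 = Region K cs" "bs2 = ds" using eqs by auto
        define t where "t = j - 1 - (2 * arcs_in cs + 2)"
        have "j - 2 = 2 * arcs_in cs + Suc t" "Suc t < 2 * arcs_in ds"
          using a2 e2 by (simp_all add: t_def)
        then have "connect (j - 2) (connect 0 R) = juxtapose (Region K cs) (connect (Suc t) ?Q)"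
          "Suc t < 2 * arcs_in ds"
          using right by metis+
        then show ?thesis using a2 e2 j R' unfolding t_def
          by (cases "connect t (Region M ds)") (simp add: connect_beyond connect_firsts connect_after t_def)
      qed
    next
      case (lasts L1 w1 M1 as1 u P ps bs1)
      then have e: "L1 = L" "w1 = w" "M1 = M" "bs1 = bs"
        and as: "(v, Region K cs) # ds = as1 @ [(u, Region P ps)]" using R' by auto
      show ?thesis
      proof (cases as1)
        case Nil
        then have "ds = []" "u = v" "P = K" "ps = cs" using as by auto
        moreover have "j - 2 = 2 * arcs_in cs + 0" using lasts Nil calculation by simp
        then have "connect (j - 2) (connect 0 R) = juxtapose (Region K cs) (connect 0 ?Q)"
          using right by metis
        moreover have "connect j R = Region (K + L) ((w @ reversed v, Region M []) # cs @ bs)"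
          using lasts e Nil calculation connect_lasts[of j "[]"] by simp
        ultimately show ?thesis
          by (simp add: connect_loop cyc_append_commute[of w])
      next
        case (Cons a2 ds2)
        then have ds: "a2 = (v, Region K cs)" "ds = ds2 @ [(u, Region P ps)]" using as by auto
        have "j - 2 = 2 * arcs_in cs + 2 * arcs_in ds" using lasts ds Cons by simp
        then have "connect (j - 2) (connect 0 R) = juxtapose (Region K cs) (connect (2 * arcs_in ds) ?Q)"
          using right by metis
        moreover have "connect (2 * arcs_in ds) ?Q =
            Region (P + L) (((reversed v @ w) @ reversed u, Region M ds2) # ps @ bs)"
          unfolding ds by (rule connect_lasts) simp
        moreover have "connect j R = Region (P + L) ((w @ reversed u, Region M as1) # ps @ bs)"
          unfolding lasts(1) e using lasts(2) by (rule connect_lasts)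
        ultimately show ?thesis by (simp add: Cons ds connect_firsts add_ac)
      qed
    next
      case ("next" L1 w1 S1 u T bs1)
      obtain P ps where T: "T = Region P ps" by (cases T)
      have e: "L1 = L" "w1 = w" "S1 = Region M ((v, Region K cs) # ds)" "bs = (u, Region P ps) # bs1"
        using R' "next" T by auto
      have "j - 2 = 2 * arcs_in cs + Suc (2 * arcs_in ds)" using "next" e by simp
      then have "connect (j - 2) (connect 0 R) = juxtapose (Region K cs) (connect (Suc (2 * arcs_in ds)) ?Q)"
        using right by metis
      then show ?thesis using "next" e T by (simp add: connect_next connect_firsts add_ac)
    next
      case (after L1 w1 S1 bs1)
      then have e: "L1 = L" "w1 = w" "S1 = Region M ((v, Region K cs) # ds)" "bs1 = bs"
        using R' by auto
      define t where "t = j - (2 * num_arcs S1 + 2)"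
      have "j - 2 = 2 * arcs_in cs + (2 * arcs_in ds + 2 + t)" using after e by (simp add: t_def)
      then have "connect (j - 2) (connect 0 R) = juxtapose (Region K cs) (connect (2 * arcs_in ds + 2 + t) ?Q)"
        using right by metis
      moreover have "connect j R = juxtapose (Region {#} [(w, S1)]) (connect t (Region L bs))"
        using after e by (simp add: connect_after t_def)
      ultimately show ?thesis using e
        by (cases "connect t (Region L bs)") (simp add: connect_after connect_firsts)
    qed
  qed
qed

text \<open>
  Two gaps without a common node can be closed in either order. Moving the root brings the smaller
  gap to the front.
\<close>

lemma connect_interchange:
  assumes "i + 2 \<le> j" "Suc j < 2 * num_arcs R"
  shows "connect i (connect j R) = connect (j - 2) (connect i R)"
  using assms
proof (induction i arbitrary: j R)
  case 0
  then show ?case by (simp add: connect_0_interchange)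
next
  case (Suc i)
  then obtain k where j: "j = Suc k" "i + 2 \<le> k" by (cases j) auto
  have "rot (connect (Suc i) (connect (Suc k) R)) = connect i (rot (connect (Suc k) R))"
    using Suc.prems j by (intro connect_rot[symmetric]) simp
  also have "\<dots> = connect i (connect k (rot R))"
    using Suc.prems j by (subst connect_rot) auto
  also have "\<dots> = connect (k - 2) (connect i (rot R))"
    using Suc.prems j by (intro Suc.IH) auto
  also have "\<dots> = connect (k - 2) (rot (connect (Suc i) R))"
    using Suc.prems j by (subst connect_rot) auto
  also have "\<dots> = rot (connect (Suc (k - 2)) (connect (Suc i) R))"
    using Suc.prems j by (intro connect_rot) simp
  finally have "connect (Suc i) (connect (Suc k) R) = connect (Suc (k - 2)) (connect (Suc i) R)"
    by (rule rot_inject)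
  moreover have "Suc (k - 2) = Suc k - 2" using j by simp
  ultimately show ?case using j by metis
qed

subsection \<open>Diagrams with different numbers of northern and southern nodes\<close>

text \<open>
  \<open>joins a l\<close> closes the gaps \<open>a - 1, \<dots>, a - l\<close> in this order, that is, it connects \<open>l\<close> nested pairs
  of nodes around the boundary between nodes \<open>a - 1\<close> and \<open>a\<close>.
\<close>

primrec joins :: "nat \<Rightarrow> nat \<Rightarrow> region \<Rightarrow> region" where
  "joins a 0 R = R"
| "joins a (Suc l) R = connect (a - Suc l) (joins a l R)"

text \<open>
  The concatenation of a diagram with \<open>a\<close> northern and \<open>l\<close> southern nodes and one with \<open>l\<close> northern
  and \<open>c\<close> southern nodes. A tree does not record how its nodes are divided into northern and
  southern ones, so only \<open>l\<close> has to be given.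
\<close>

definition stack :: "nat \<Rightarrow> region \<Rightarrow> region \<Rightarrow> region" where
  "stack l A B = joins (2 * num_arcs A) l (juxtapose A B)"

lemma fold_connect: "l \<le> a \<Longrightarrow> fold connect (rev [a - l..<a]) R = joins a l R"
proof (induction l)
  case (Suc l)
  then have "[a - Suc l..<a] = (a - Suc l) # [a - l..<a]"
    by (subst upt_conv_Cons) (auto simp: Suc_diff_Suc)
  then show ?case using Suc by simp
qed simp

lemma concatenate_eq_stack: "num_arcs A = n \<Longrightarrow> concatenate n A B = stack n A B"
  using fold_connect[of n "2 * n"] by (simp add: concatenate_def stack_def mult_2)

lemma joins_Suc_first: "joins a (Suc l) R = joins (a - 1) l (connect (a - 1) R)"
  by (induction l) auto

lemma num_arcs_joins [simp]:
  "l \<le> a \<Longrightarrow> a + l \<le> 2 * num_arcs R \<Longrightarrow> num_arcs (joins a l R) = num_arcs R - l"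
  by (induction l) auto

lemma connect_joins:
  assumes "i + 2 + l \<le> a" "a + l \<le> 2 * num_arcs R"
  shows "connect i (joins a l R) = joins (a - 2) l (connect i R)"
  using assms
proof (induction l)
  case (Suc l)
  then have "connect i (connect (a - Suc l) (joins a l R)) =
      connect (a - Suc l - 2) (connect i (joins a l R))"
    by (intro connect_interchange) auto
  then show ?case using Suc by (simp add: diff_commute)
qed simp

lemma joins_joins:
  assumes "l \<le> a" "a + l + k \<le> b" "b + k \<le> 2 * num_arcs R"
  shows "joins a l (joins b k R) = joins (b - 2 * l) k (joins a l R)"
  using assms
proof (induction l)
  case (Suc l)
  then have "joins a (Suc l) (joins b k R) = connect (a - Suc l) (joins (b - 2 * l) k (joins a l R))"
    by simp
  also have "\<dots> = joins (b - 2 * l - 2) k (connect (a - Suc l) (joins a l R))"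
    using Suc.prems by (intro connect_joins) auto
  finally show ?case by simp
qed simp

lemma joins_juxtapose_left:
  "l \<le> a \<Longrightarrow> a + l \<le> 2 * num_arcs A \<Longrightarrow> joins a l (juxtapose A B) = juxtapose (joins a l A) B"
  by (induction l) (auto simp: connect_juxtapose_left)

lemma joins_juxtapose_right:
  "l \<le> a \<Longrightarrow> joins (2 * num_arcs A + a) l (juxtapose A B) = juxtapose A (joins a l B)"
proof (induction l)
  case (Suc l)
  then have "2 * num_arcs A + a - Suc l = 2 * num_arcs A + (a - Suc l)" by simp
  then show ?case using Suc connect_juxtapose_right[of A "a - Suc l" "joins a l B"] by simp
qed simp

lemma num_arcs_stack [simp]:
  "l \<le> 2 * num_arcs A \<Longrightarrow> l \<le> 2 * num_arcs B \<Longrightarrow>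
    num_arcs (stack l A B) = num_arcs A + num_arcs B - l"
  by (simp add: stack_def)

text \<open>
  Both sides close the same gaps of \<open>A\<close>, \<open>B\<close> and \<open>C\<close> placed side by side, and no gap between \<open>A\<close> and
  \<open>B\<close> shares a node with one between \<open>B\<close> and \<open>C\<close>.
\<close>

lemma stack_assoc:
  assumes "l \<le> 2 * num_arcs A" "l + k \<le> 2 * num_arcs B" "k \<le> 2 * num_arcs C"
  shows "stack k (stack l A B) C = stack l A (stack k B C)"
proof -
  let ?a = "2 * num_arcs A" and ?b = "2 * num_arcs B"
  have "stack k (stack l A B) C =
      joins (?a + ?b - 2 * l) k (juxtapose (joins ?a l (juxtapose A B)) C)"
    using assms by (simp add: stack_def algebra_simps)
  also have "\<dots> = joins (?a + ?b - 2 * l) k (joins ?a l (juxtapose A (juxtapose B C)))"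
    using assms by (simp add: joins_juxtapose_left[symmetric] juxtapose_assoc)
  also have "\<dots> = joins ?a l (joins (?a + ?b) k (juxtapose A (juxtapose B C)))"
    using assms by (intro joins_joins[symmetric]) auto
  also have "\<dots> = joins ?a l (juxtapose A (joins ?b k (juxtapose B C)))"
    using assms by (subst joins_juxtapose_right) auto
  finally show ?thesis by (simp add: stack_def)
qed

lemma rot_joins:
  assumes "l \<le> a" "a + l < 2 * num_arcs R"
  shows "rot (joins (Suc a) l R) = joins a l (rot R)"
  using assms
proof (induction l)
  case (Suc l)
  then have "rot (joins (Suc a) (Suc l) R) = rot (connect (Suc (a - Suc l)) (joins (Suc a) l R))"
    by (simp add: Suc_diff_Suc)
  also have "\<dots> = connect (a - Suc l) (rot (joins (Suc a) l R))"
    using Suc.prems by (intro connect_rot[symmetric]) auto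
  finally show ?case using Suc by simp
qed simp

text \<open>
  Joining the outermost line of the identity to node \<open>0\<close> of \<open>B\<close> prolongs the line of \<open>B\<close> and leaves
  the remaining lines of the identity just behind this node, where they face the other nodes of \<open>B\<close>.
  Moving the root behind the node restores the original situation with one line fewer.
\<close>

lemma stack_identity_left:
  assumes "j \<le> 2 * num_arcs B"
  shows "stack j (identity_diagram j) B = B"
proof -
  have "joins (2 * j) j (juxtapose (identity_diagram j) B) = B"
    using assms
  proof (induction j arbitrary: B)
    case (Suc j)
    then obtain L v S ds where B: "B = Region L ((v, S) # ds)"
      by (cases B rule: rot.cases) auto
    obtain K cs where S: "S = Region K cs" by (cases S)
    obtain M as where I: "identity_diagram j = Region M as" by (cases "identity_diagram j")
    let ?Y = "Region L ((v, juxtapose (identity_diagram j) S) # ds)"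
    have conn: "connect (Suc (2 * j)) (juxtapose (identity_diagram (Suc j)) B) = ?Y"
      by (simp add: B connect_next)
    have "rot ?Y = juxtapose (identity_diagram j) (rot B)"
      by (simp add: B S I)
    moreover have "rot (joins (Suc (2 * j)) j ?Y) = joins (2 * j) j (rot ?Y)"
      using Suc.prems by (intro rot_joins) (auto simp: B)
    moreover have "joins (2 * j) j (juxtapose (identity_diagram j) (rot B)) = rot B"
      using Suc.prems by (intro Suc.IH) auto
    ultimately have "joins (Suc (2 * j)) j ?Y = B"
      by (metis rot_inject)
    then show ?case
      using conn joins_Suc_first[of "2 * Suc j" j "juxtapose (identity_diagram (Suc j)) B"] by simp
  qed simp
  then show ?thesis by (simp add: stack_def)
qed

text \<open>
  The mirror image of the previous argument: the root moves backwards, across the last arc.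
\<close>

lemma stack_identity_right:
  assumes "b \<le> 2 * num_arcs A"
  shows "stack b A (identity_diagram b) = A"
  using assms
proof (induction b arbitrary: A)
  case (Suc b)
  obtain L xs where A: "A = Region L xs" by (cases A)
  with Suc.prems obtain as a where "xs = as @ [a]" by (cases xs rule: rev_cases) auto
  then obtain w M cs where xs: "xs = as @ [(w, Region M cs)]" by (metis surj_pair region.exhaust)
  obtain N es where I: "identity_diagram b = Region N es" by (cases "identity_diagram b")
  define k where "k = 2 * num_arcs A - 1"
  have k: "2 * num_arcs A = Suc k" using Suc.prems by (simp add: k_def)
  let ?Y = "Region L (as @ [(w, juxtapose (Region M cs) (identity_diagram b))])"
  have "connect (2 * num_arcs (Region L as) + Suc (2 * num_arcs (Region M cs)))
      (juxtapose (Region L as) (Region {#} [(w, Region M cs), ([], identity_diagram b)])) =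
    juxtapose (Region L as) (connect (Suc (2 * num_arcs (Region M cs)))
      (Region {#} [(w, Region M cs), ([], identity_diagram b)]))"
    by (rule connect_juxtapose_right)
  then have "connect k (juxtapose A (identity_diagram (Suc b))) = ?Y"
    by (simp add: connect_next A xs k_def)
  then have eq: "stack (Suc b) A (identity_diagram (Suc b)) = joins k b ?Y"
    using joins_Suc_first[of "2 * num_arcs A" b] by (simp add: stack_def k)
  have "unrot ?Y = juxtapose (unrot A) (identity_diagram b)"
    by (simp add: A xs I unrot_snoc)
  moreover have "rot (joins (Suc k) b (unrot ?Y)) = joins k b (rot (unrot ?Y))"
    using Suc.prems k by (intro rot_joins) (auto simp: A xs)
  ultimately have "unrot (joins k b ?Y) = stack b (unrot A) (identity_diagram b)"
    by (metis stack_def k num_arcs_unrot rot_unrot unrot_rot)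
  also have "\<dots> = unrot A" using Suc by simp
  finally show ?case using eq unrot_inject by metis
qed (simp add: stack_def)

subsection \<open>Depth\<close>

definition loops_decorated :: "enat \<Rightarrow> loop multiset \<Rightarrow> bool" where
  "loops_decorated d L \<longleftrightarrow> (\<forall>k. loop_arrow_at L k \<longrightarrow> enat k \<le> d)"

lemma loop_arrow_at_pos: "loop_arrow_at L k \<Longrightarrow> k \<ge> 1"
  by (induction rule: loop_arrow_at.induct) auto

lemma arrow_at_pos: "arrow_at R k \<Longrightarrow> k \<ge> 1"
  by (induction rule: arrow_at.induct) (auto dest: loop_arrow_at_pos)

lemma Suc_le_enat_iff: "1 \<le> k \<Longrightarrow> enat (Suc k) \<le> d \<longleftrightarrow> enat k \<le> d - 1"
  by (cases d) (auto simp: one_enat_def)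

lemma loops_decorated_add_mset [simp]:
  "loops_decorated d (add_mset (Loop c M) L) \<longleftrightarrow>
    loops_decorated d L \<and> (c = cyc [] \<or> 1 \<le> d) \<and> loops_decorated (d - 1) M"
proof -
  have eq: "loop_arrow_at (add_mset (Loop c M) L) k \<longleftrightarrow>
      loop_arrow_at L k \<or> (k = 1 \<and> c \<noteq> cyc []) \<or> (\<exists>j. k = Suc j \<and> loop_arrow_at M j)" for k
    by (subst (1 2) loop_arrow_at.simps) auto
  have "loops_decorated d (add_mset (Loop c M) L) \<longleftrightarrow> (\<forall>k. loop_arrow_at L k \<longrightarrow> enat k \<le> d) \<and>
      (c \<noteq> cyc [] \<longrightarrow> enat 1 \<le> d) \<and> (\<forall>j. loop_arrow_at M j \<longrightarrow> enat (Suc j) \<le> d)"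
    unfolding loops_decorated_def eq by blast
  moreover have "(\<forall>j. loop_arrow_at M j \<longrightarrow> enat (Suc j) \<le> d) \<longleftrightarrow> loops_decorated (d - 1) M"
    unfolding loops_decorated_def using Suc_le_enat_iff loop_arrow_at_pos by blast
  ultimately show ?thesis by (auto simp: loops_decorated_def one_enat_def)
qed

lemma loops_decorated_empty [simp]: "loops_decorated d {#}"
  unfolding loops_decorated_def by (subst loop_arrow_at.simps) simp

lemma loops_decorated_union [simp]:
  "loops_decorated d (L + M) \<longleftrightarrow> loops_decorated d L \<and> loops_decorated d M"
proof (induction L)
  case (add l L)
  then show ?case by (cases l) auto
qed simp

lemma loops_decorated_mono: "loops_decorated d L \<Longrightarrow> d \<le> e \<Longrightarrow> loops_decorated e L"
  unfolding loops_decorated_def by (meson order_trans)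

lemma decorated_mono: "decorated_to_depth d R \<Longrightarrow> d \<le> e \<Longrightarrow> decorated_to_depth e R"
  unfolding decorated_to_depth_def by (meson order_trans)

lemma decorated_Region:
  "decorated_to_depth d (Region L as) \<longleftrightarrow>
    loops_decorated d L \<and> (\<forall>(w, R)\<in>set as. (w = [] \<or> 1 \<le> d) \<and> decorated_to_depth (d - 1) R)"
proof -
  have eq: "arrow_at (Region L as) k \<longleftrightarrow> loop_arrow_at L k \<or> (k = 1 \<and> (\<exists>w R. (w, R) \<in> set as \<and> w \<noteq> [])) \<or>
      (\<exists>j. k = Suc j \<and> (\<exists>w R. (w, R) \<in> set as \<and> arrow_at R j))" for k
    by (subst arrow_at.simps) auto
  have "decorated_to_depth d (Region L as) \<longleftrightarrow> (\<forall>k. loop_arrow_at L k \<longrightarrow> enat k \<le> d) \<and>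
      (\<forall>w R. (w, R) \<in> set as \<longrightarrow> w \<noteq> [] \<longrightarrow> enat 1 \<le> d) \<and>
      (\<forall>w R. (w, R) \<in> set as \<longrightarrow> (\<forall>j. arrow_at R j \<longrightarrow> enat (Suc j) \<le> d))"
    unfolding decorated_to_depth_def eq by blast
  moreover have "(\<forall>j. arrow_at R j \<longrightarrow> enat (Suc j) \<le> d) \<longleftrightarrow> decorated_to_depth (d - 1) R" for R
    unfolding decorated_to_depth_def using Suc_le_enat_iff arrow_at_pos by blast
  ultimately show ?thesis by (auto simp: loops_decorated_def one_enat_def)
qed

lemma decorated_simps [simp]:
  "decorated_to_depth d (Region L []) \<longleftrightarrow> loops_decorated d L"
  "decorated_to_depth d (Region L ((w, R) # as)) \<longleftrightarrow>
    (w = [] \<or> 1 \<le> d) \<and> decorated_to_depth (d - 1) R \<and> decorated_to_depth d (Region L as)"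
  by (auto simp: decorated_Region)

lemma decorated_append [simp]:
  "decorated_to_depth d (Region (K + L) (as @ bs)) \<longleftrightarrow>
    decorated_to_depth d (Region K as) \<and> decorated_to_depth d (Region L bs)"
  by (auto simp: decorated_Region)

lemma decorated_juxtapose [simp]:
  "decorated_to_depth d (juxtapose A B) \<longleftrightarrow> decorated_to_depth d A \<and> decorated_to_depth d B"
  by (cases A; cases B) simp

lemma enat_pred_le: "d - 1 \<le> (d :: enat)"
  by (cases d) (auto simp: one_enat_def)

lemma enat_le_pred: "1 \<le> d - 1 \<Longrightarrow> 1 \<le> (d :: enat)"
  using enat_pred_le order_trans by blast

text \<open>
  Joining lines only brings them closer to the eastern edge.
\<close>

lemma decorated_connect:
  assumes "Suc i < 2 * num_arcs R" "decorated_to_depth d R"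
  shows "decorated_to_depth d (connect i R)"
  using assms
proof (induction "num_arcs R" arbitrary: i R d rule: less_induct)
  case less
  have up: "decorated_to_depth (d - 1) S \<Longrightarrow> decorated_to_depth d S"
    and up2: "decorated_to_depth (d - 1 - 1) S \<Longrightarrow> decorated_to_depth d S" for S
    using decorated_mono enat_pred_le by blast+
  from less.prems(1) show ?case
  proof (cases rule: connect_cases)
    case loop
    then show ?thesis using less.prems(2) by (auto simp: connect_loop decorated_Region)
  next
    case (firsts L w M v K cs ds bs)
    then show ?thesis using less.prems(2) up2[of "Region K cs"]
      by (auto simp: connect_firsts decorated_Region dest: enat_le_pred)
  next
    case (beyond L w S bs)
    then have "decorated_to_depth (d - 1) (connect (i - 1) S)"
      using less.prems by (intro less.hyps) auto
    then show ?thesis using beyond less.prems(2) by (auto simp: connect_beyond)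
  next
    case (lasts L w M as v K cs bs)
    then show ?thesis using less.prems(2) up2[of "Region K cs"]
      by (auto simp: connect_lasts decorated_Region dest: enat_le_pred)
  next
    case (after L w S bs)
    then have "decorated_to_depth d (connect (i - (2 * num_arcs S + 2)) (Region L bs))"
      using less.prems by (intro less.hyps) auto
    then show ?thesis using after less.prems(2) by (auto simp: connect_after)
  qed (use less.prems(2) in \<open>auto simp: connect_next\<close>)
qed

lemma decorated_joins:
  "l \<le> a \<Longrightarrow> a + l \<le> 2 * num_arcs R \<Longrightarrow> decorated_to_depth d R \<Longrightarrow> decorated_to_depth d (joins a l R)"
  by (induction l) (auto intro: decorated_connect)

lemma decorated_stack:
  "l \<le> 2 * num_arcs A \<Longrightarrow> l \<le> 2 * num_arcs B \<Longrightarrow> decorated_to_depth d A \<Longrightarrow> decorated_to_depth d B \<Longrightarrow>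
    decorated_to_depth d (stack l A B)"
  unfolding stack_def by (intro decorated_joins) auto

lemma decorated_identity [simp]: "decorated_to_depth d (identity_diagram n)"
  by (induction n arbitrary: d) auto

text \<open>
  This is what makes \<open>monoid_algebra (diagram_monoid n d)\<close> an associative algebra, so that it has
  modules at all.
\<close>

theorem diagram_monoid: "Group.monoid (diagram_monoid n d)"
proof
  fix A B C
  assume "A \<in> carrier (diagram_monoid n d)" "B \<in> carrier (diagram_monoid n d)"
    "C \<in> carrier (diagram_monoid n d)"
  then show "A \<otimes>\<^bsub>diagram_monoid n d\<^esub> B \<otimes>\<^bsub>diagram_monoid n d\<^esub> C =
      A \<otimes>\<^bsub>diagram_monoid n d\<^esub> (B \<otimes>\<^bsub>diagram_monoid n d\<^esub> C)"
    by (simp add: diagram_monoid_def diagrams_def concatenate_eq_stack stack_assoc)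
qed (auto simp: diagram_monoid_def diagrams_def concatenate_eq_stack decorated_stack
    stack_identity_left stack_identity_right)

section \<open>The defining relations\<close>

lemma shuffles_append_left: "w \<in> shuffles x v \<Longrightarrow> u @ w \<in> shuffles x (u @ v)"
  by (induction u) (auto intro: Cons_in_shuffles_rightI)

lemma shuffles_append_right: "w \<in> shuffles x v \<Longrightarrow> w @ u \<in> shuffles x (v @ u)"
proof (induction x v arbitrary: w rule: shuffles.induct)
  case (1 ys) then show ?case by simp
next
  case (2 x xs)
  have "v @ u \<in> shuffles v u" for v
    by (induction v) (auto intro: Cons_in_shuffles_leftI)
  then show ?case using 2 by (metis append_Nil shuffles.simps(2) singletonD)
next
  case (3 x xs y ys)
  then show ?case by auto
qed

lemma shuffles_map: "w \<in> shuffles x v \<Longrightarrow> map f w \<in> shuffles (map f x) (map f v)"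
  by (induction x v arbitrary: w rule: shuffles.induct) auto

lemma shuffles_rev: "w \<in> shuffles x v \<Longrightarrow> rev w \<in> shuffles (rev x) (rev v)"
proof (induction x v arbitrary: w rule: shuffles.induct)
  case (3 x xs y ys)
  from "3.prems" consider w' where "w = x # w'" "w' \<in> shuffles xs (y # ys)"
    | w' where "w = y # w'" "w' \<in> shuffles (x # xs) ys" by auto
  then show ?case
  proof cases
    case 1
    then have "rev w' @ [x] \<in> shuffles (rev (y # ys)) (rev xs @ [x])"
      using "3.IH"(1) by (intro shuffles_append_right) (simp add: shuffles_commutes)
    then show ?thesis using 1 by (simp add: shuffles_commutes)
  next
    case 2
    then have "rev w' @ [y] \<in> shuffles (rev (x # xs)) (rev ys @ [y])"
      using "3.IH"(2) by (intro shuffles_append_right) simp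
    then show ?thesis using 2 by simp
  qed
qed auto

lemma omit_arrows_append_left: "omit_arrows m w v \<Longrightarrow> omit_arrows m (u @ w) (u @ v)"
  by (auto elim!: omit_arrows.cases intro: omit_arrows.intros shuffles_append_left)

lemma omit_arrows_append_right: "omit_arrows m w v \<Longrightarrow> omit_arrows m (w @ u) (v @ u)"
  by (auto elim!: omit_arrows.cases intro: omit_arrows.intros shuffles_append_right)

lemma omit_arrows_reversed:
  assumes "omit_arrows m w v" shows "omit_arrows m (reversed w) (reversed v)"
  using assms
proof cases
  case (opposing a)
  then have "rev (map flip w) \<in> shuffles (rev (map flip [a, flip a])) (rev (map flip v))"
    by (intro shuffles_rev shuffles_map)
  then show ?thesis by (intro omit_arrows.opposing[of _ a]) (simp add: reversed_def)
next
  case (non_opposing a)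
  then have "rev (map flip w) \<in> shuffles (rev (map flip (replicate m a))) (rev (map flip v))"
    by (intro shuffles_rev shuffles_map)
  then show ?thesis by (intro omit_arrows.non_opposing[of _ _ "flip a"]) (simp add: reversed_def)
qed

lemma omit_arrows_Nil: "omit_arrows m [] v \<Longrightarrow> v = []"
  by (auto elim!: omit_arrows.cases)

lemma cyc_eq_Nil [simp]: "cyc w = cyc [] \<longleftrightarrow> w = []"
proof
  assume "cyc w = cyc []"
  then obtain k where "[] = rotate k w" by transfer auto
  then show "w = []" by (metis rotate_is_Nil_conv)
qed simp

lemma loops_identified_union:
  "loops_identified m \<delta> L x L' \<Longrightarrow> loops_identified m \<delta> (L + K) x (L' + K)"
proof (induction rule: loops_identified.induct)
  case (loop c M L)
  show ?case using loops_identified.loop[of m \<delta> c M "L + K"] by (simp add: add_ac)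
qed (auto intro: loops_identified.intros)

lemma identified_juxtapose_right:
  "identified m \<delta> A x A' \<Longrightarrow> identified m \<delta> (juxtapose A B) x (juxtapose A' B)"
  by (induction rule: identified.induct; cases B)
    (auto intro: identified.intros loops_identified_union)

lemma identified_juxtapose_left:
  assumes "identified m \<delta> A x A'" shows "identified m \<delta> (juxtapose B A) x (juxtapose B A')"
proof -
  obtain K es where B: "B = Region K es" by (cases B)
  from assms show ?thesis
  proof (induction rule: identified.induct)
    case (arrows w v L as R bs)
    then show ?case using identified.arrows[of m w v \<delta> "K + L" "es @ as"] by (simp add: B)
  next
    case (loops L x L' as)
    then have "loops_identified m \<delta> (K + L) x (K + L')"
      using loops_identified_union[of m \<delta> L x L' K] by (simp add: add.commute)
    then show ?case by (auto simp: B intro: identified.intros)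
  next
    case (beyond R x R' L as w bs)
    then show ?case using identified.beyond[of m \<delta> R x R' "K + L" "es @ as"] by (simp add: B)
  qed
qed

text \<open>
  The defining relations act at one place of a tree. The following rules follow this place
  through the first or the last arc of the root region.
\<close>

lemma identified_no_arcs:
  "identified m \<delta> (Region L []) x Y \<longleftrightarrow> (\<exists>L'. Y = Region L' [] \<and> loops_identified m \<delta> L x L')"
  by (auto elim: identified.cases intro: identified.loops)

lemma identified_Cons_cases [consumes 1, case_names arrows beyond rest]:
  assumes "identified m \<delta> (Region L ((w, R) # bs)) x Y"
  obtains v where "omit_arrows m w v" "x = 1" "Y = Region L ((v, R) # bs)"
  | R' where "identified m \<delta> R x R'" "Y = Region L ((w, R') # bs)"
  | L' bs' where "identified m \<delta> (Region L bs) x (Region L' bs')" "Y = Region L' ((w, R) # bs')"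
  using assms
proof cases
  case (arrows u v as S cs)
  then show ?thesis using that(1) that(3) by (cases as) (auto intro: identified.arrows)
next
  case (loops L')
  then show ?thesis using that(3) by (auto intro: identified.loops)
next
  case (beyond S S' as u cs)
  then show ?thesis using that(2) that(3) by (cases as) (auto intro: identified.beyond)
qed

lemma identified_snoc_cases [consumes 1, case_names arrows beyond rest]:
  assumes "identified m \<delta> (Region L (bs @ [(w, R)])) x Y"
  obtains v where "omit_arrows m w v" "x = 1" "Y = Region L (bs @ [(v, R)])"
  | R' where "identified m \<delta> R x R'" "Y = Region L (bs @ [(w, R')])"
  | L' bs' where "identified m \<delta> (Region L bs) x (Region L' bs')" "Y = Region L' (bs' @ [(w, R)])"
  using assms
proof cases
  case (arrows u v as S cs)
  then show ?thesis using that(1) that(3) by (cases cs rule: rev_cases) (auto intro: identified.arrows)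
next
  case (loops L')
  then show ?thesis using that(3) by (auto intro: identified.loops)
next
  case (beyond S S' as u cs)
  then show ?thesis using that(2) that(3) by (cases cs rule: rev_cases) (auto intro: identified.beyond)
qed

lemma identified_single_arrows:
  "omit_arrows m w v \<Longrightarrow> identified m \<delta> (Region L ((w, R) # bs)) 1 (Region L ((v, R) # bs))"
  using identified.arrows[of m w v \<delta> L "[]"] by simp

lemma identified_single_beyond:
  "identified m \<delta> R x R' \<Longrightarrow> identified m \<delta> (Region L ((w, R) # bs)) x (Region L ((w, R') # bs))"
  using identified.beyond[of m \<delta> R x R' L "[]"] by simp

lemma identified_rest:
  assumes "identified m \<delta> (Region L bs) x (Region L' bs')"
  shows "identified m \<delta> (Region L (as @ bs)) x (Region L' (as @ bs'))"
  using identified_juxtapose_left[OF assms, of "Region {#} as"] by simp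

lemma identified_front:
  assumes "identified m \<delta> (Region L bs) x (Region L' bs')"
  shows "identified m \<delta> (Region L (bs @ as)) x (Region L' (bs' @ as))"
  using identified_juxtapose_right[OF assms, of "Region {#} as"] by simp

lemma identified_rot:
  assumes "identified m \<delta> R x R'" shows "identified m \<delta> (rot R) x (rot R')"
proof (cases R rule: rot.cases)
  case (1 L)
  then show ?thesis using assms by (auto simp: identified_no_arcs)
next
  case (2 L w M as bs)
  from assms[unfolded 2] show ?thesis
  proof (cases rule: identified_Cons_cases)
    case (arrows v)
    then show ?thesis by (auto simp: 2 intro: identified.arrows omit_arrows_reversed)
  next
    case (beyond S)
    then show ?thesis by (cases S) (auto simp: 2 intro: identified_front)
  next
    case (rest L' bs')
    then show ?thesis by (auto simp: 2 intro: identified.beyond)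
  qed
qed

lemma identified_unrot:
  assumes "identified m \<delta> R x R'" shows "identified m \<delta> (unrot R) x (unrot R')"
proof (cases R)
  case (Region L xs)
  show ?thesis
  proof (cases xs rule: rev_cases)
    case Nil
    then show ?thesis using assms Region
      by (auto simp: identified_no_arcs unrot.simps)
  next
    case (snoc as a)
    obtain w M bs where a: "a = (w, Region M bs)" by (metis surj_pair region.exhaust)
    from assms[unfolded Region snoc a] show ?thesis
    proof (cases rule: identified_snoc_cases)
      case (arrows v)
      then show ?thesis by (auto simp: Region snoc a unrot_snoc intro: identified_single_arrows omit_arrows_reversed)
    next
      case (beyond S)
      then show ?thesis
        by (cases S) (auto simp: Region snoc a unrot_snoc intro: identified_rest[where as = "[_]", simplified])
    next
      case (rest L' bs')
      then show ?thesis by (auto simp: Region snoc a unrot_snoc intro: identified_single_beyond)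
    qed
  qed
qed

lemma identified_num_arcs: "identified m \<delta> R x R' \<Longrightarrow> num_arcs R' = num_arcs R"
  by (induction rule: identified.induct) auto

text \<open>
  At the front, each place where a relation can act survives the joining of two nodes: the words of
  the joined arcs are concatenated, and the regions are moved as a whole.
\<close>

lemma identified_connect_0:
  assumes "identified m \<delta> R x R'" "num_arcs R > 0"
  shows "identified m \<delta> (connect 0 R) x (connect 0 R')"
proof -
  have "Suc 0 < 2 * num_arcs R" using assms by simp
  then show ?thesis
  proof (cases rule: connect_cases)
    case (loop L w M bs)
    from assms(1)[unfolded loop(1)] show ?thesis
    proof (cases rule: identified_Cons_cases)
      case (arrows v)
      then show ?thesis
        by (auto simp: loop(1) connect_loop intro: identified.intros loops_identified.intros)
    next
      case (beyond S)
      then obtain M' where "S = Region M' []" "loops_identified m \<delta> M x M'"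
        by (auto simp: identified_no_arcs)
      then show ?thesis using beyond
        by (auto simp: loop(1) connect_loop intro: identified.intros loops_identified.intros)
    next
      case (rest L' bs')
      then show ?thesis
        using identified_juxtapose_right[OF rest(1), of "Region {#Loop (cyc w) M#} []"]
        by (simp add: loop(1) connect_loop)
    qed
  next
    case (firsts L w M v K cs ds bs)
    let ?Q = "Region L ((reversed v @ w, Region M ds) # bs)"
    have R: "connect 0 R = juxtapose (Region K cs) ?Q"
      by (simp add: firsts(1) connect_firsts)
    from assms(1)[unfolded firsts(1)] show ?thesis
    proof (cases rule: identified_Cons_cases)
      case (arrows u)
      then have H: "identified m \<delta> ?Q 1 (Region L ((reversed v @ u, Region M ds) # bs))"
        by (intro identified_single_arrows omit_arrows_append_left)
      then show ?thesis using arrows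
        using identified_juxtapose_left[OF H, of "Region K cs"] by (simp add: firsts(1) connect_firsts)
    next
      case (rest L' bs')
      then have H: "identified m \<delta> ?Q x (Region L' ((reversed v @ w, Region M ds) # bs'))"
        using identified_rest[where as = "[_]", simplified] by blast
      then show ?thesis using rest
        using identified_juxtapose_left[OF H, of "Region K cs"] by (simp add: firsts(1) connect_firsts)
    next
      case (beyond S)
      from beyond(1) show ?thesis
      proof (cases rule: identified_Cons_cases)
        case (arrows u)
        then have H: "identified m \<delta> ?Q 1 (Region L ((reversed u @ w, Region M ds) # bs))"
          by (intro identified_single_arrows omit_arrows_append_right omit_arrows_reversed)
        then show ?thesis using arrows beyond
          using identified_juxtapose_left[OF H, of "Region K cs"] by (simp add: firsts(1) connect_firsts)
      next
        case b2: (beyond S')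
        then show ?thesis using beyond
          using identified_juxtapose_right[of m \<delta> "Region K cs" x S' ?Q]
          by (cases S') (simp add: firsts(1) connect_firsts)
      next
        case (rest M' ds')
        then have H: "identified m \<delta> ?Q x (Region L ((reversed v @ w, Region M' ds') # bs))"
          by (intro identified_single_beyond)
        then show ?thesis using rest beyond
          using identified_juxtapose_left[OF H, of "Region K cs"] by (simp add: firsts(1) connect_firsts)
      qed
    qed
  qed auto
qed

text \<open>
  The root is moved until the gap comes first, and back again after the gap has been closed.
\<close>

lemma identified_connect:
  "identified m \<delta> R x R' \<Longrightarrow> Suc i < 2 * num_arcs R \<Longrightarrow> identified m \<delta> (connect i R) x (connect i R')"
proof (induction i arbitrary: R R')
  case 0
  then show ?case by (intro identified_connect_0) auto
next
  case (Suc i)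
  then have "identified m \<delta> (connect i (rot R)) x (connect i (rot R'))"
    by (intro Suc.IH identified_rot) auto
  then have "identified m \<delta> (rot (connect (Suc i) R)) x (rot (connect (Suc i) R'))"
    using Suc.prems identified_num_arcs[OF Suc.prems(1)] by (simp add: connect_rot)
  then show ?case using identified_unrot by fastforce
qed

lemma identified_joins:
  "l \<le> a \<Longrightarrow> a + l \<le> 2 * num_arcs R \<Longrightarrow> identified m \<delta> R x R' \<Longrightarrow>
    identified m \<delta> (joins a l R) x (joins a l R')"
  by (induction l) (auto intro: identified_connect)

lemma identified_stack_left:
  "l \<le> 2 * num_arcs A \<Longrightarrow> l \<le> 2 * num_arcs B \<Longrightarrow> identified m \<delta> A x A' \<Longrightarrow>
    identified m \<delta> (stack l A B) x (stack l A' B)"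
  unfolding stack_def
  by (metis (no_types, lifting) identified_joins identified_juxtapose_right identified_num_arcs
      num_arcs_juxtapose add_mult_distrib2 add_le_cancel_left)

lemma identified_stack_right:
  "l \<le> 2 * num_arcs A \<Longrightarrow> l \<le> 2 * num_arcs B \<Longrightarrow> identified m \<delta> B x B' \<Longrightarrow>
    identified m \<delta> (stack l A B) x (stack l A B')"
  unfolding stack_def
  by (intro identified_joins identified_juxtapose_left) auto

lemma loops_identified_decorated:
  "loops_identified m \<delta> L x L' \<Longrightarrow> loops_decorated d L \<Longrightarrow> loops_decorated d L'"
proof (induction arbitrary: d rule: loops_identified.induct)
  case (arrows w v M L)
  then show ?case using omit_arrows_Nil by auto
next
  case (loop c M L)
  then show ?case using loops_decorated_mono enat_pred_le by auto
qed auto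

lemma identified_decorated:
  "identified m \<delta> R x R' \<Longrightarrow> decorated_to_depth d R \<Longrightarrow> decorated_to_depth d R'"
proof (induction arbitrary: d rule: identified.induct)
  case (arrows w v L as R bs)
  then show ?case using omit_arrows_Nil by (auto simp: decorated_Region)
next
  case (loops L x L' as)
  then show ?case using loops_identified_decorated by (auto simp: decorated_Region)
next
  case (beyond R x R' L as w bs)
  then show ?case by (auto simp: decorated_Region)
qed

text \<open>
  \<open>reduces m \<delta> R x S\<close> says that \<open>R = x S\<close> follows from the relations, read from left to right.
\<close>

inductive reduces :: "nat \<Rightarrow> (nat \<Rightarrow> 'k::field) \<Rightarrow> region \<Rightarrow> 'k \<Rightarrow> region \<Rightarrow> bool" for m \<delta> where
  refl: "reduces m \<delta> R 1 R"
| step: "identified m \<delta> R x R' \<Longrightarrow> reduces m \<delta> R' y R'' \<Longrightarrow> reduces m \<delta> R (x * y) R''"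

lemma reduces_identified: "identified m \<delta> R x R' \<Longrightarrow> reduces m \<delta> R x R'"
  using reduces.step[OF _ reduces.refl] by fastforce

lemma reduces_trans: "reduces m \<delta> R x R' \<Longrightarrow> reduces m \<delta> R' y R'' \<Longrightarrow> reduces m \<delta> R (x * y) R''"
  by (induction rule: reduces.induct) (auto simp: mult.assoc intro: reduces.step)

lemma reduces_num_arcs: "reduces m \<delta> R x R' \<Longrightarrow> num_arcs R' = num_arcs R"
  by (induction rule: reduces.induct) (auto dest: identified_num_arcs)

lemma reduces_decorated: "reduces m \<delta> R x R' \<Longrightarrow> decorated_to_depth d R \<Longrightarrow> decorated_to_depth d R'"
  by (induction rule: reduces.induct) (auto dest: identified_decorated)

lemma reduces_stack_left:
  "reduces m \<delta> A x A' \<Longrightarrow> l \<le> 2 * num_arcs A \<Longrightarrow> l \<le> 2 * num_arcs B \<Longrightarrow>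
    reduces m \<delta> (stack l A B) x (stack l A' B)"
proof (induction rule: reduces.induct)
  case (step R x R' y R'')
  then show ?case using identified_num_arcs[OF step.hyps(1)]
    by (auto intro: reduces.step identified_stack_left)
qed (rule reduces.refl)

lemma reduces_stack_right:
  "reduces m \<delta> B x B' \<Longrightarrow> l \<le> 2 * num_arcs A \<Longrightarrow> l \<le> 2 * num_arcs B \<Longrightarrow>
    reduces m \<delta> (stack l A B) x (stack l A B')"
proof (induction rule: reduces.induct)
  case (step R x R' y R'')
  then show ?case using identified_num_arcs[OF step.hyps(1)]
    by (auto intro: reduces.step identified_stack_right)
qed (rule reduces.refl)

lemma reduces_beyond:
  "reduces m \<delta> R x R' \<Longrightarrow> reduces m \<delta> (Region L [(w, R)]) x (Region L [(w, R')])"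
  by (induction rule: reduces.induct) (auto intro: reduces.intros identified_single_beyond)

section \<open>Through lines\<close>

text \<open>
  The scalar that remains when a loop and all loops inside it are omitted.
\<close>

primrec loop_value :: "nat \<Rightarrow> (nat \<Rightarrow> 'k::field) \<Rightarrow> loop \<Rightarrow> 'k" where
  "loop_value m \<delta> (Loop c M) =
    \<delta> (nat (excess c mod int m)) * prod_mset (image_mset (loop_value m \<delta>) M)"

definition loops_value :: "nat \<Rightarrow> (nat \<Rightarrow> 'k::field) \<Rightarrow> loop multiset \<Rightarrow> 'k" where
  "loops_value m \<delta> L = prod_mset (image_mset (loop_value m \<delta>) L)"

lemma loops_value_simps [simp]:
  "loops_value m \<delta> {#} = 1"
  "loops_value m \<delta> (add_mset (Loop c M) L) =
    \<delta> (nat (excess c mod int m)) * loops_value m \<delta> M * loops_value m \<delta> L"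
  "loops_value m \<delta> (L + K) = loops_value m \<delta> L * loops_value m \<delta> K"
  by (simp_all add: loops_value_def)

fun arrow_value :: "'k::field \<Rightarrow> arrow \<Rightarrow> 'k" where
  "arrow_value z Anticlockwise = z"
| "arrow_value z Clockwise = inverse z"

text \<open>
  The action of the arrows on one line, where an anticlockwise arrow acts as \<open>z\<close>.
\<close>

definition word_value :: "'k::field \<Rightarrow> arrow list \<Rightarrow> 'k" where
  "word_value z w = prod_list (map (arrow_value z) w)"

lemma word_value_simps [simp]:
  "word_value z [] = 1" "word_value z (a # w) = arrow_value z a * word_value z w"
  "word_value z (u @ v) = word_value z u * word_value z v"
  by (simp_all add: word_value_def)

lemma word_value_shuffles:
  "w \<in> shuffles u v \<Longrightarrow> word_value z w = word_value z u * word_value z v"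
  by (induction u v arbitrary: w rule: shuffles.induct) (auto simp: algebra_simps)

lemma word_value_replicate: "word_value z (replicate n a) = arrow_value z a ^ n"
  by (induction n) auto

lemma word_value_omit_arrows:
  assumes "omit_arrows m w v" "z ^ m = 1" "m \<ge> 1"
  shows "word_value z w = word_value z v"
proof -
  have z: "z \<noteq> 0" using assms by (metis power_0_left zero_neq_one not_one_le_zero)
  have inv: "inverse z ^ m = 1" using assms by (simp add: power_inverse)
  from assms(1) show ?thesis
  proof cases
    case (opposing a)
    then show ?thesis using z by (cases a) (auto simp: word_value_shuffles)
  next
    case (non_opposing a)
    then show ?thesis using assms inv
      by (cases a) (auto simp: word_value_shuffles word_value_replicate)
  qed
qed

lemma excess_cyc: "excess (cyc w) = int (count_list w Anticlockwise) - int (count_list w Clockwise)"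
  by transfer simp

lemma count_list_shuffles: "w \<in> shuffles u v \<Longrightarrow> count_list w a = count_list u a + count_list v a"
  by (induction u v arbitrary: w rule: shuffles.induct) auto

lemma count_list_replicate: "count_list (replicate n a) b = (if a = b then n else 0)"
  by (induction n) auto

lemma excess_omit_arrows:
  assumes "omit_arrows m w v" shows "excess (cyc w) mod int m = excess (cyc v) mod int m"
  using assms
proof cases
  case (opposing a)
  then show ?thesis by (cases a) (auto simp: excess_cyc count_list_shuffles)
next
  case (non_opposing a)
  then have "excess (cyc w) = excess (cyc v) + (if a = Anticlockwise then 1 else - 1) * int m"
    by (cases a) (auto simp: excess_cyc count_list_shuffles count_list_replicate)
  then show ?thesis by simp
qed

lemma loops_value_identified:
  "loops_identified m \<delta> L x L' \<Longrightarrow> loops_value m \<delta> L = x * loops_value m \<delta> L'"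
  by (induction rule: loops_identified.induct) (auto simp: excess_omit_arrows algebra_simps)

text \<open>
  If a diagram has \<open>n\<close> northern and \<open>n\<close> southern nodes, joined by \<open>n\<close> through lines, then its regions
  form a chain. The arrows on the line of depth \<open>l + 1\<close> contribute powers of \<open>z l\<close>, the loops their
  values, and all other diagrams are sent to \<open>0\<close>. If the scalars are \<open>m\<close>-th roots of unity, this is a
  one-dimensional representation of the group \<open>(C\<^sub>m)\<^sup>n\<close>, inflated to diagrams.
\<close>

fun through_value :: "nat \<Rightarrow> (nat \<Rightarrow> 'k::field) \<Rightarrow> (nat \<Rightarrow> 'k) \<Rightarrow> region \<Rightarrow> 'k" where
  "through_value m \<delta> z (Region L []) = loops_value m \<delta> L"
| "through_value m \<delta> z (Region L [(w, R)]) =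
    loops_value m \<delta> L * word_value (z 0) w * through_value m \<delta> (\<lambda>l. z (Suc l)) R"
| "through_value m \<delta> z (Region L (a # b # as)) = 0"

lemma through_value_two: "length as \<ge> 2 \<Longrightarrow> through_value m \<delta> z (Region L as) = 0"
  by (cases as rule: remdups_adj.cases) auto

lemma through_value_identified:
  assumes "identified m \<delta> R x R'" "\<And>l. z l ^ m = 1" "m \<ge> 1"
  shows "through_value m \<delta> z R = x * through_value m \<delta> z R'"
  using assms
proof (induction arbitrary: z rule: identified.induct)
  case (arrows w v L as R bs)
  then have "word_value (z 0) w = word_value (z 0) v"
    using word_value_omit_arrows by blast
  then show ?case
    by (cases "as = [] \<and> bs = []") (auto simp: through_value_two neq_Nil_conv)
next
  case (loops L x L' as)
  then show ?case
    by (cases as rule: remdups_adj.cases) (auto simp: loops_value_identified algebra_simps)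
next
  case (beyond R x R' L as w bs)
  then have "through_value m \<delta> (\<lambda>l. z (Suc l)) R = x * through_value m \<delta> (\<lambda>l. z (Suc l)) R'"
    by (intro beyond.IH beyond.prems)
  then show ?case
    by (cases "as = [] \<and> bs = []") (auto simp: through_value_two neq_Nil_conv algebra_simps)
qed

lemma through_value_reduces:
  assumes "reduces m \<delta> R x R'" "\<And>l. z l ^ m = 1" "m \<ge> 1"
  shows "through_value m \<delta> z R = x * through_value m \<delta> z R'"
  using assms by (induction rule: reduces.induct) (auto simp: through_value_identified[where z = z])

subsection \<open>Counting through lines\<close>

text \<open>
  The number of nodes before the first one that is a second endpoint. So the first arc that has no
  node beyond it joins the nodes \<open>lead R - 1\<close> and \<open>lead R\<close>. If half of the nodes are northern, then
  all arcs are through lines iff \<open>lead R = num_arcs R\<close>.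
\<close>

fun lead :: "region \<Rightarrow> nat" where
  "lead (Region L []) = 0"
| "lead (Region L ((w, R) # as)) = Suc (lead R)"

lemma lead_le_num_arcs: "lead R \<le> num_arcs R"
  by (induction R rule: lead.induct) auto

lemma lead_append [simp]: "as \<noteq> [] \<Longrightarrow> lead (Region L (as @ bs)) = lead (Region K as)"
  by (cases as) auto

lemma lead_juxtapose: "num_arcs A > 0 \<Longrightarrow> lead (juxtapose A B) = lead A"
  by (cases A; cases B; cases "case A of Region L as \<Rightarrow> as") auto

lemma lead_eq_0 [simp]: "lead R = 0 \<longleftrightarrow> num_arcs R = 0"
  by (cases R rule: lead.cases) auto

text \<open>
  The arc between the nodes \<open>lead R - 1\<close> and \<open>lead R\<close> is untouched by joins further on. The inequality
  can be strict: two lines that start before this arc may be joined at their other ends and then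
  form an arc that ends earlier.
\<close>

lemma lead_connect:
  assumes "Suc i < 2 * num_arcs R" "Suc (lead R) \<le> i"
  shows "lead (connect i R) \<le> lead R"
  using assms
proof (induction "num_arcs R" arbitrary: i R rule: less_induct)
  case less
  from less.prems(1) show ?case
  proof (cases rule: connect_cases)
    case (beyond L w S bs)
    then have "lead (connect (i - 1) S) \<le> lead S"
      using less.prems by (intro less.hyps) auto
    then show ?thesis using beyond by (simp add: connect_beyond)
  next
    case (lasts L w M as v K cs bs)
    then have "connect i R = Region (K + L) ((w @ reversed v, Region M as) # cs @ bs)"
      using connect_lasts by blast
    then show ?thesis using lasts(1) by (cases as) auto
  next
    case ("next" L w S v T ds)
    then show ?thesis using less.prems
      by (cases "num_arcs S = 0") (auto simp: connect_next lead_juxtapose)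
  next
    case (after L w S bs)
    then show ?thesis
      by (cases "connect (i - (2 * num_arcs S + 2)) (Region L bs)") (simp add: connect_after)
  qed (use less.prems in auto)
qed

lemma lead_joins:
  "l \<le> a \<Longrightarrow> a + l \<le> 2 * num_arcs R \<Longrightarrow> Suc (lead R) + l \<le> a \<Longrightarrow> lead (joins a l R) \<le> lead R"
proof (induction l)
  case (Suc l)
  then have "lead (connect (a - Suc l) (joins a l R)) \<le> lead (joins a l R)"
    by (intro lead_connect) auto
  then show ?case using Suc by simp
qed simp

lemma lead_stack:
  assumes "Suc (lead A) + l \<le> 2 * num_arcs A" "l \<le> 2 * num_arcs B"
  shows "lead (stack l A B) \<le> lead A"
proof -
  have "lead (joins (2 * num_arcs A) l (juxtapose A B)) \<le> lead (juxtapose A B)"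
    using assms by (intro lead_joins) (auto simp: lead_juxtapose)
  then show ?thesis using assms by (simp add: stack_def lead_juxtapose)
qed

lemma through_value_lead: "lead R < num_arcs R \<Longrightarrow> through_value m \<delta> z R = 0"
proof (induction R arbitrary: z rule: lead.induct)
  case (2 L w R as)
  then show ?case by (cases as) auto
qed simp

text \<open>
  If \<open>A\<close> has more northern than southern nodes, then two neighbouring northern nodes are joined in
  \<open>A\<close>, and they stay joined after stacking.
\<close>

lemma through_value_fewer:
  assumes "2 * num_arcs A = a + l" "2 * num_arcs B = l + a" "l < a"
  shows "through_value m \<delta> z (stack l A B) = 0"
proof (rule through_value_lead)
  have "lead A < a" using lead_le_num_arcs[of A] assms by simp
  moreover from this have "lead (stack l A B) \<le> lead A"
    using assms by (intro lead_stack) auto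
  moreover have "num_arcs (stack l A B) = a" using assms by simp
  ultimately show "lead (stack l A B) < num_arcs (stack l A B)" by simp
qed

subsection \<open>Cutting off a northern arc\<close>

text \<open>
  A diagram is cut into two along a line just below its first northern arc without nodes beyond it.
  \<open>cup_part j R\<close> consists of this arc, with its arrows and the loops behind it, and \<open>j\<close> undecorated
  through lines; \<open>uncup R\<close> is the rest. All lines that separate this arc from the eastern edge start
  at northern nodes before it, so the arc has the same depth in \<open>R\<close> and in \<open>cup_part j R\<close>. This is why
  the first such arc is chosen: its arrows remain admissible.
\<close>

fun uncup :: "region \<Rightarrow> region" where
  "uncup (Region L []) = Region L []"
| "uncup (Region L ((w, Region M []) # bs)) = Region L bs"
| "uncup (Region L ((w, Region M (a # as)) # bs)) = Region L ((w, uncup (Region M (a # as))) # bs)"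

fun cup_part :: "nat \<Rightarrow> region \<Rightarrow> region" where
  "cup_part j (Region L []) = Region {#} []"
| "cup_part j (Region L ((w, Region M []) # bs)) =
    juxtapose (Region {#} [(w, Region M [])]) (identity_diagram j)"
| "cup_part j (Region L ((w, Region M (a # as)) # bs)) =
    Region {#} [([], cup_part (j - 1) (Region M (a # as)))]"

lemma num_arcs_uncup [simp]: "num_arcs (uncup R) = num_arcs R - 1"
  by (induction R rule: uncup.induct) auto

lemma num_arcs_cup_part: "num_arcs R > 0 \<Longrightarrow> lead R \<le> Suc j \<Longrightarrow> num_arcs (cup_part j R) = Suc j"
  by (induction j R rule: cup_part.induct) auto

lemma decorated_uncup: "decorated_to_depth d R \<Longrightarrow> decorated_to_depth d (uncup R)"
  by (induction R arbitrary: d rule: uncup.induct) (auto simp: decorated_Region)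

lemma decorated_cup_part: "decorated_to_depth d R \<Longrightarrow> decorated_to_depth d (cup_part j R)"
proof (induction j R arbitrary: d rule: cup_part.induct)
  case (3 j L w M a as bs)
  then have "decorated_to_depth (d - 1) (Region M (a # as))" by (auto simp: decorated_Region)
  then show ?case using "3.IH" by simp
qed auto

lemma uncup_append: "as \<noteq> [] \<Longrightarrow> uncup (Region L (as @ bs)) = juxtapose (uncup (Region L as)) (Region {#} bs)"
  by (cases "Region L as" rule: uncup.cases) auto

lemma cup_part_append: "as \<noteq> [] \<Longrightarrow> cup_part j (Region L (as @ bs)) = cup_part j (Region L as)"
  by (cases "(j, Region L as)" rule: cup_part.cases) auto

text \<open>
  If the arc comes first, this is the left identity law beside the arc. Otherwise the first
  line of \<open>cup_part\<close> is joined to the first line of \<open>uncup R\<close>, and the root is moved across the result.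
\<close>

lemma stack_cup_part:
  assumes "num_arcs R > 0" "lead R \<le> Suc j" "j + 2 \<le> 2 * num_arcs R"
  shows "stack j (cup_part j R) (uncup R) = R"
  using assms
proof (induction j arbitrary: R)
  case 0
  then show ?case
    by (cases R rule: uncup.cases) (auto simp: stack_def)
next
  case (Suc j)
  show ?case
  proof (cases R rule: uncup.cases)
    case (1 L)
    then show ?thesis using Suc.prems by simp
  next
    case (2 L w M bs)
    have "joins (2 * num_arcs (Region {#} [(w, Region M [])]) + 2 * Suc j) (Suc j)
        (juxtapose (Region {#} [(w, Region M [])]) (juxtapose (identity_diagram (Suc j)) (Region L bs))) =
      juxtapose (Region {#} [(w, Region M [])])
        (joins (2 * Suc j) (Suc j) (juxtapose (identity_diagram (Suc j)) (Region L bs)))"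
      by (rule joins_juxtapose_right) simp
    also have "joins (2 * Suc j) (Suc j) (juxtapose (identity_diagram (Suc j)) (Region L bs)) = Region L bs"
      using stack_identity_left[of "Suc j" "Region L bs"] Suc.prems 2
      by (simp add: stack_def del: identity_diagram.simps)
    finally show ?thesis
      by (simp add: 2 stack_def juxtapose_assoc del: identity_diagram.simps joins.simps)
  next
    case (3 L u M a as bs)
    define S where "S = Region M (a # as)"
    have R: "R = Region L ((u, S) # bs)" using 3 S_def by simp
    have S: "num_arcs S > 0" by (cases a) (simp add: S_def)
    define C where "C = cup_part j S"
    have C: "num_arcs C = Suc j" using S Suc.prems by (simp add: C_def R num_arcs_cup_part)
    have rotR: "rot R = juxtapose S (Region {#} [(reversed u, Region L bs)])"
      by (simp add: R S_def)
    have cupR: "cup_part (Suc j) R = Region {#} [([], C)]" "uncup R = Region L ((u, uncup S) # bs)"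
      by (simp_all add: 3 S_def C_def)
    have cup_rot: "cup_part j (rot R) = C"
      "uncup (rot R) = juxtapose (uncup S) (Region {#} [(reversed u, Region L bs)])"
      using uncup_append[of "a # as" M] cup_part_append[of "a # as" j M]
      by (simp_all add: 3 S_def C_def)
    let ?Y = "Region L ((u, juxtapose C (uncup S)) # bs)"
    have N: "num_arcs ?Y = j + num_arcs R" using S C by (simp add: R)
    have "stack (Suc j) (cup_part (Suc j) R) (uncup R) =
        joins (Suc (2 * Suc j)) j (connect (Suc (2 * Suc j)) (juxtapose (Region {#} [([], C)]) (uncup R)))"
      using C by (simp add: stack_def cupR joins_Suc_first del: joins.simps)
    also have "connect (Suc (2 * Suc j)) (juxtapose (Region {#} [([], C)]) (uncup R)) = ?Y"
      using C by (simp add: cupR connect_next)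
    finally have eq: "stack (Suc j) (cup_part (Suc j) R) (uncup R) = joins (Suc (2 * Suc j)) j ?Y" .
    have "rot (joins (Suc (2 * Suc j)) j ?Y) = joins (2 * Suc j) j (rot ?Y)"
      using Suc.prems(3) N by (intro rot_joins) auto
    also have "rot ?Y = juxtapose C (uncup (rot R))"
      unfolding cup_rot by (cases C; cases "uncup S") simp
    also have "joins (2 * Suc j) j (juxtapose C (uncup (rot R))) = stack j (cup_part j (rot R)) (uncup (rot R))"
      by (simp add: stack_def C cup_rot(1))
    also have "\<dots> = rot R"
      using Suc.prems S by (intro Suc.IH) (auto simp: rotR lead_juxtapose, auto simp: R)
    finally show ?thesis using eq rot_inject by metis
  qed
qed

subsection \<open>Diagrams without cups\<close>

text \<open>
  The diagrams whose lines are all through lines, without loops.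
\<close>

primrec strand :: "arrow list list \<Rightarrow> region" where
  "strand [] = Region {#} []"
| "strand (w # ws) = Region {#} [(w, strand ws)]"

lemma identity_strand: "identity_diagram n = strand (replicate n [])"
  by (induction n) auto

lemma num_arcs_strand [simp]: "num_arcs (strand ws) = length ws"
  by (induction ws) auto

lemma joins_beyond:
  "l \<le> a \<Longrightarrow> a + l \<le> 2 * num_arcs R \<Longrightarrow>
    joins (Suc a) l (Region L ((w, R) # bs)) = Region L ((w, joins a l R) # bs)"
  by (induction l) (auto simp: connect_beyond)

lemma stack_through:
  assumes "num_arcs R = j" "num_arcs S = j"
  shows "stack (Suc j) (Region L [(w, R)]) (Region K [(v, S)]) = Region (L + K) [(w @ v, stack j R S)]"
  using assms
  by (simp add: stack_def joins_Suc_first connect_next joins_beyond del: joins.simps)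

text \<open>
  Stacking two chains of regions concatenates the words on lines of equal depth.
\<close>

lemma through_value_stack_through:
  "num_arcs A = n \<Longrightarrow> num_arcs B = n \<Longrightarrow> lead A = n \<Longrightarrow> lead B = n \<Longrightarrow>
    through_value m \<delta> z (stack n A B) = through_value m \<delta> z A * through_value m \<delta> z B"
proof (induction n arbitrary: A B z)
  case 0
  then show ?case by (cases A; cases B) (auto simp: stack_def)
next
  case (Suc n)
  obtain L w R as where A: "A = Region L ((w, R) # as)"
    using Suc.prems by (cases A rule: lead.cases) auto
  obtain K v S bs where B: "B = Region K ((v, S) # bs)"
    using Suc.prems by (cases B rule: lead.cases) auto
  have "num_arcs R + arcs_in as = n" "lead R = n" "num_arcs S + arcs_in bs = n" "lead S = n"
    using Suc.prems A B by auto
  moreover from this have "arcs_in as = 0" "arcs_in bs = 0"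
    using lead_le_num_arcs[of R] lead_le_num_arcs[of S] by linarith+
  ultimately have "as = []" "num_arcs R = n" "lead R = n" "bs = []" "num_arcs S = n" "lead S = n"
    by simp_all
  then show ?case using Suc.IH[of R S] by (simp add: A B stack_through)
qed

text \<open>
  If \<open>A\<close> joins two northern nodes, so does the product. If \<open>B\<close> does, then \<open>B\<close> factors through \<open>n - 2\<close>
  nodes, hence the product does as well, and a diagram that factors through fewer nodes has value \<open>0\<close>.
\<close>

theorem through_value_stack:
  assumes "num_arcs A = n" "num_arcs B = n"
  shows "through_value m \<delta> z (stack n A B) = through_value m \<delta> z A * through_value m \<delta> z B"
proof -
  have N: "num_arcs (stack n A B) = n" using assms by simp
  consider "lead A < n" | "lead B < n" | "lead A = n" "lead B = n"
    using lead_le_num_arcs[of A] lead_le_num_arcs[of B] assms by linarith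
  then show ?thesis
  proof cases
    case 1
    then have "lead (stack n A B) \<le> lead A" using assms by (intro lead_stack) auto
    then show ?thesis using 1 N assms through_value_lead by (metis le_less_trans mult_zero_left)
  next
    case 2
    show ?thesis
    proof (cases "n = 1")
      case True
      then show ?thesis using 2 assms by simp
    next
      case False
      define j where "j = n - 2"
      have "n > 0" using 2 by simp
      then have n: "n = j + 2" using False by (simp add: j_def)
      let ?B = "cup_part j B"
      have "lead B \<le> Suc j" using 2 n by simp
      then have N': "num_arcs ?B = Suc j" and B: "stack j ?B (uncup B) = B"
        using assms n by (auto intro!: num_arcs_cup_part stack_cup_part)
      have "stack n A B = stack j (stack n A ?B) (uncup B)"
        using assms N' n by (subst stack_assoc) (auto simp: B)
      also have "through_value m \<delta> z \<dots> = 0"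
        using assms N' n by (intro through_value_fewer) auto
      finally show ?thesis using through_value_lead 2 assms by (metis mult_zero_right)
    qed
  qed (use assms through_value_stack_through in blast)
qed

lemma through_value_strand:
  "through_value m \<delta> z (strand ws) = (\<Prod>l<length ws. word_value (z l) (ws ! l))"
proof (induction ws arbitrary: z)
  case (Cons w ws)
  show ?case by (simp add: Cons prod.lessThan_Suc_shift del: prod.lessThan_Suc)
qed simp

lemma stack_strand:
  "length us = n \<Longrightarrow> length vs = n \<Longrightarrow> stack n (strand us) (strand vs) = strand (map2 (@) us vs)"
proof (induction n arbitrary: us vs)
  case (Suc n)
  then show ?case by (cases us; cases vs) (auto simp: stack_through)
qed (simp add: stack_def)

lemma decorated_strand:
  "decorated_to_depth d (strand ws) \<longleftrightarrow> (\<forall>l<length ws. ws ! l \<noteq> [] \<longrightarrow> enat l < d)"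
proof (induction ws arbitrary: d)
  case (Cons w ws)
  have "enat (Suc l) < d \<longleftrightarrow> enat l < d - 1" "1 \<le> d \<longleftrightarrow> enat 0 < d" for l
    by (cases d; auto simp: one_enat_def)+
  then show ?case by (simp add: Cons All_less_Suc2) blast
qed simp

text \<open>
  Omitting a loop releases the loops inside it, which are then omitted one after the other.
\<close>

lemma reduces_remove_loop:
  "reduces m \<delta> (Region (add_mset l K) as) (loop_value m \<delta> l) (Region K as)"
proof (induction l arbitrary: K)
  case (Loop c M)
  have "reduces m \<delta> (Region (M' + K) as) (loops_value m \<delta> M') (Region K as)" if "M' \<subseteq># M" for M'
    using that
  proof (induction M')
    case empty
    then show ?case by (simp add: reduces.refl)
  next
    case (add l M')
    then have "l \<in># M" "M' \<subseteq># M" by (auto dest: mset_subset_eq_insertD subset_mset.less_imp_le)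
    then show ?case using reduces_trans[OF Loop add.IH] by (simp add: loops_value_def)
  qed
  then have "reduces m \<delta> (Region (M + K) as) (loops_value m \<delta> M) (Region K as)" by simp
  with reduces.step[OF identified.loops[OF loops_identified.loop]]
  show ?case by (fastforce simp: loops_value_def)
qed

lemma reduces_remove_loops:
  "reduces m \<delta> (Region (L + K) as) (loops_value m \<delta> L) (Region K as)"
proof (induction L)
  case (add l L)
  then show ?case using reduces_trans[OF reduces_remove_loop add] by (simp add: loops_value_def)
qed (simp add: reduces.refl)

lemma reduces_strand:
  "lead R = num_arcs R \<Longrightarrow> \<exists>x ws. length ws = num_arcs R \<and> reduces m \<delta> R x (strand ws)"
proof (induction R rule: lead.induct)
  case (1 L)
  then show ?case using reduces_remove_loops[of m \<delta> L "{#}" "[]"] by (auto intro!: exI[of _ "[]"])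
next
  case (2 L w R as)
  then have "as = []" "lead R = num_arcs R" using lead_le_num_arcs[of R] by auto
  then obtain x ws where "length ws = num_arcs R" "reduces m \<delta> R x (strand ws)" using 2 by blast
  then have "reduces m \<delta> (Region L [(w, R)]) (loops_value m \<delta> L * x) (strand (w # ws))"
    using reduces_trans[OF reduces_remove_loops[of m \<delta> L "{#}"] reduces_beyond[of m \<delta> R x "strand ws"]]
    by simp
  then show ?case using \<open>as = []\<close> \<open>length ws = _\<close> by (auto intro!: exI[of _ "w # ws"])
qed

subsection \<open>Caps and cups at the eastern edge\<close>

text \<open>
  Side by side arcs, each next to the eastern region. So the loops that arise when caps meet cups have
  depth \<open>1\<close>, and the arrows on them are admissible as soon as \<open>d \<ge> 1\<close>.
\<close>

definition cups :: "nat \<Rightarrow> arrow list \<Rightarrow> region" where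
  "cups t u = Region {#} (replicate t (u, Region {#} []))"

definition cap_diagram :: "nat \<Rightarrow> nat \<Rightarrow> region" where
  "cap_diagram i t = juxtapose (identity_diagram i) (cups t [])"

definition cup_diagram :: "nat \<Rightarrow> nat \<Rightarrow> arrow list \<Rightarrow> region" where
  "cup_diagram i t u = juxtapose (cups t u) (identity_diagram i)"

lemma num_arcs_cups [simp]: "num_arcs (cups t u) = t"
  by (induction t) (auto simp: cups_def)

lemma num_arcs_cap_diagram [simp]: "num_arcs (cap_diagram i t) = i + t"
  and num_arcs_cup_diagram [simp]: "num_arcs (cup_diagram i t u) = i + t"
  by (simp_all add: cap_diagram_def cup_diagram_def)

lemma decorated_cups: "u = [] \<or> 1 \<le> d \<Longrightarrow> decorated_to_depth d (cups t u)"
  by (auto simp: cups_def decorated_Region)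

lemma decorated_cap_diagram [simp]: "decorated_to_depth d (cap_diagram i t)"
  and decorated_cup_diagram: "u = [] \<or> 1 \<le> d \<Longrightarrow> decorated_to_depth d (cup_diagram i t u)"
  by (simp_all add: cap_diagram_def cup_diagram_def decorated_cups)

lemma joins_add_loops:
  "l \<le> a \<Longrightarrow> joins a l (juxtapose (Region U []) R) = juxtapose (Region U []) (joins a l R)"
  using joins_juxtapose_right[of l a "Region U []" R] by simp

text \<open>
  The last cap and the first cup face each other: the first step joins them to one arc, the second
  step closes this arc to a loop. Then the next pair is in the same position.
\<close>

lemma joins_cups:
  "joins (2 * t) (2 * t) (juxtapose (cups t []) (cups t u)) =
    Region (replicate_mset t (Loop (cyc u) {#})) []"
proof (induction t)
  case (Suc t)
  let ?A = "Region {#} [([], Region {#} [])]" and ?B = "Region {#} [(u, Region {#} [])]"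
  have cups: "cups (Suc t) [] = juxtapose (cups t []) ?A" "cups (Suc t) u = juxtapose ?B (cups t u)"
    by (simp_all add: cups_def replicate_append_same)
  let ?Z = "juxtapose (cups t []) (juxtapose (juxtapose ?A ?B) (cups t u))"
  have "joins (2 * Suc t) (2 * Suc t) (juxtapose (cups (Suc t) []) (cups (Suc t) u)) =
      joins (2 * t) (2 * t) (connect (2 * t + 0) (connect (2 * t + 1) ?Z))"
    by (simp add: cups juxtapose_assoc joins_Suc_first del: joins.simps juxtapose.simps)
  also have "connect (2 * t + 1) ?Z = juxtapose (cups t []) (connect 1 (juxtapose (juxtapose ?A ?B) (cups t u)))"
    using connect_juxtapose_right[of "cups t []" 1] by simp
  also have "connect (2 * t + 0) \<dots> = juxtapose (cups t []) (connect 0 (connect 1 (juxtapose (juxtapose ?A ?B) (cups t u))))"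
    using connect_juxtapose_right[of "cups t []" 0] by simp
  also have "connect 0 (connect 1 (juxtapose (juxtapose ?A ?B) (cups t u))) =
      juxtapose (Region {#Loop (cyc u) {#}#} []) (cups t u)"
    by (simp add: cups_def connect_next connect_loop)
  also have "juxtapose (cups t []) \<dots> = juxtapose (Region {#Loop (cyc u) {#}#} []) (juxtapose (cups t []) (cups t u))"
    by (simp add: cups_def)
  also have "joins (2 * t) (2 * t) \<dots> = juxtapose (Region {#Loop (cyc u) {#}#} [])
      (joins (2 * t) (2 * t) (juxtapose (cups t []) (cups t u)))"
    by (rule joins_add_loops) simp
  finally show ?case using Suc by simp
qed (simp add: cups_def)

lemma joins_add: "joins a (l + k) R = joins (a - l) k (joins a l R)"
proof (induction l arbitrary: a R)
  case (Suc l)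
  have "joins a (Suc l + k) R = joins (a - 1) (l + k) (connect (a - 1) R)"
    using joins_Suc_first[of a "l + k"] by simp
  also have "\<dots> = joins (a - 1 - l) k (joins (a - 1) l (connect (a - 1) R))" by (rule Suc)
  also have "joins (a - 1) l (connect (a - 1) R) = joins a (Suc l) R"
    by (rule joins_Suc_first[symmetric])
  finally show ?case by simp
qed simp

lemma stack_cap_cup:
  "stack (i + 2 * t) (cap_diagram i t) (cup_diagram i t u) =
    juxtapose (Region (replicate_mset t (Loop (cyc u) {#})) []) (identity_diagram i)"
proof -
  let ?I = "identity_diagram i" and ?U = "Region (replicate_mset t (Loop (cyc u) {#})) []"
  let ?C = "juxtapose (cups t []) (cups t u)"
  have "stack (i + 2 * t) (cap_diagram i t) (cup_diagram i t u) =
      joins (2 * i + 2 * t) (2 * t + i) (juxtapose ?I (juxtapose ?C ?I))"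
    by (simp add: stack_def cap_diagram_def cup_diagram_def juxtapose_assoc algebra_simps)
  also have "\<dots> = joins (2 * i) i (joins (2 * num_arcs ?I + 2 * t) (2 * t) (juxtapose ?I (juxtapose ?C ?I)))"
    by (subst joins_add) simp
  also have "joins (2 * num_arcs ?I + 2 * t) (2 * t) (juxtapose ?I (juxtapose ?C ?I)) =
      juxtapose ?I (joins (2 * t) (2 * t) (juxtapose ?C ?I))"
    by (rule joins_juxtapose_right) simp
  also have "joins (2 * t) (2 * t) (juxtapose ?C ?I) = juxtapose ?U ?I"
    by (subst joins_juxtapose_left) (auto simp: joins_cups)
  also have "juxtapose ?I (juxtapose ?U ?I) = juxtapose ?U (juxtapose ?I ?I)"
    by (cases ?I) (simp add: add_ac)
  also have "joins (2 * i) i \<dots> = juxtapose ?U (joins (2 * i) i (juxtapose ?I ?I))"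
    by (rule joins_add_loops) simp
  also have "joins (2 * i) i (juxtapose ?I ?I) = ?I"
    using stack_identity_left[of i ?I] by (simp add: stack_def)
  finally show ?thesis .
qed

lemma loops_value_replicate:
  "loops_value m \<delta> (replicate_mset t (Loop (cyc u) {#})) = \<delta> (nat (excess (cyc u) mod int m)) ^ t"
  by (induction t) auto

section \<open>Simple modules and maximal left ideals\<close>

definition left_ideal :: "('a, 'c) ring_scheme \<Rightarrow> 'a set \<Rightarrow> bool" where
  "left_ideal R J \<longleftrightarrow> J \<subseteq> carrier R \<and> \<zero>\<^bsub>R\<^esub> \<in> J \<and> (\<forall>x\<in>J. \<forall>y\<in>J. x \<oplus>\<^bsub>R\<^esub> y \<in> J) \<and>
    (\<forall>a\<in>carrier R. \<forall>x\<in>J. a \<otimes>\<^bsub>R\<^esub> x \<in> J)"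

definition maximal_left_ideal :: "('a, 'c) ring_scheme \<Rightarrow> 'a set \<Rightarrow> bool" where
  "maximal_left_ideal R J \<longleftrightarrow> left_ideal R J \<and> \<one>\<^bsub>R\<^esub> \<notin> J \<and>
    (\<forall>N. left_ideal R N \<longrightarrow> J \<subseteq> N \<longrightarrow> \<one>\<^bsub>R\<^esub> \<notin> N \<longrightarrow> N = J)"

text \<open>
  The union in the scalar multiplication is over equal cosets, so it is the coset of \<open>a x\<close> for any
  representative \<open>x\<close>.
\<close>

definition left_quotient :: "('a, 'c) ring_scheme \<Rightarrow> 'a set \<Rightarrow> ('a, 'a set) module" where
  "left_quotient R J = \<lparr>carrier = a_rcosets\<^bsub>R\<^esub> J, mult = undefined, one = undefined, ring.zero = J,
    ring.add = set_add R, smult = \<lambda>a Y. \<Union>x\<in>Y. J +>\<^bsub>R\<^esub> (a \<otimes>\<^bsub>R\<^esub> x)\<rparr>"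

context ring
begin

lemma left_idealD:
  assumes "left_ideal R J"
  shows "J \<subseteq> carrier R" "\<zero> \<in> J" "x \<in> J \<Longrightarrow> y \<in> J \<Longrightarrow> x \<oplus> y \<in> J" "a \<in> carrier R \<Longrightarrow> x \<in> J \<Longrightarrow> a \<otimes> x \<in> J"
    "x \<in> J \<Longrightarrow> x \<in> carrier R"
  using assms by (auto simp: left_ideal_def)

lemma left_ideal_minus:
  assumes "left_ideal R J" "x \<in> J"
  shows "\<ominus> x \<in> J"
proof -
  have "\<ominus> x = (\<ominus> \<one>) \<otimes> x" using assms left_idealD(5) by (metis l_minus l_one one_closed)
  then show ?thesis using assms left_idealD(4) by (metis a_inv_closed one_closed)
qed

lemma left_ideal_abelian_subgroup:
  assumes "left_ideal R J" shows "abelian_subgroup J R"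
proof (rule abelian_subgroupI3)
  show "additive_subgroup J R"
    using assms left_idealD[OF assms] left_ideal_minus[OF assms]
    by (intro additive_subgroup.intro group.subgroupI)
      (auto simp: add.is_group a_inv_def[symmetric])
qed (rule abelian_group_axioms)

lemma left_ideal_one: "left_ideal R J \<Longrightarrow> \<one> \<in> J \<Longrightarrow> J = carrier R"
  using left_idealD(4)[of J _ \<one>] left_idealD(1)[of J] by fastforce

lemma left_coset_eq_iff:
  assumes "left_ideal R J" "x \<in> carrier R" "y \<in> carrier R"
  shows "J +> x = J +> y \<longleftrightarrow> x \<ominus> y \<in> J"
proof -
  interpret J: abelian_subgroup J R using assms(1) by (rule left_ideal_abelian_subgroup)
  show ?thesis
    using assms J.a_rcos_module_minus[OF ring_axioms] J.a_repr_independence' J.a_rcos_self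
    by metis
qed

lemma left_coset_eq_self_iff:
  assumes "left_ideal R J" "x \<in> carrier R"
  shows "J +> x = J \<longleftrightarrow> x \<in> J"
proof -
  have "J +> \<zero> = J" using left_idealD(1)[OF assms(1)] by simp
  then show ?thesis using left_coset_eq_iff[OF assms zero_closed] assms(2) by (simp add: a_minus_def)
qed

lemma carrier_left_quotient: "Y \<in> carrier (left_quotient R J) \<longleftrightarrow> (\<exists>x\<in>carrier R. Y = J +> x)"
  by (simp add: left_quotient_def A_RCOSETS_def')

lemma left_quotient_simps [simp]:
  assumes "left_ideal R J" "x \<in> carrier R"
  shows "y \<in> carrier R \<Longrightarrow> (J +> x) \<oplus>\<^bsub>left_quotient R J\<^esub> (J +> y) = J +> (x \<oplus> y)"
    and "a \<in> carrier R \<Longrightarrow> a \<odot>\<^bsub>left_quotient R J\<^esub> (J +> x) = J +> (a \<otimes> x)"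
    and "\<zero>\<^bsub>left_quotient R J\<^esub> = J"
proof -
  interpret J: abelian_subgroup J R using assms(1) by (rule left_ideal_abelian_subgroup)
  show "y \<in> carrier R \<Longrightarrow> (J +> x) \<oplus>\<^bsub>left_quotient R J\<^esub> (J +> y) = J +> (x \<oplus> y)"
    using assms J.a_rcos_sum by (simp add: left_quotient_def)
  assume a: "a \<in> carrier R"
  have const: "J +> (a \<otimes> y) = J +> (a \<otimes> x)" if y: "y \<in> J +> x" for y
  proof -
    have yc: "y \<in> carrier R" using y assms J.a_elemrcos_carrier by blast
    then have "J +> y = J +> x" using y assms J.a_repr_independence' by metis
    then have "y \<ominus> x \<in> J" using assms yc left_coset_eq_iff by simp
    then have "a \<otimes> (y \<ominus> x) \<in> J" using a assms left_idealD(4) by blast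
    then have "a \<otimes> y \<ominus> a \<otimes> x \<in> J" using a assms yc by (simp add: a_minus_def r_distr r_minus)
    then show ?thesis using a assms yc by (subst left_coset_eq_iff) auto
  qed
  have self: "x \<in> J +> x" using assms J.a_rcos_self by simp
  have "(\<Union>y\<in>J +> x. J +> (a \<otimes> y)) = J +> (a \<otimes> x)"
    by (rule UN_constant_eq[OF self]) (intro ballI const)
  then show "a \<odot>\<^bsub>left_quotient R J\<^esub> (J +> x) = J +> (a \<otimes> x)"
    by (simp add: left_quotient_def)
next
  show "\<zero>\<^bsub>left_quotient R J\<^esub> = J" by (simp add: left_quotient_def)
qed

lemma left_module_left_quotient:
  assumes J: "left_ideal R J" shows "left_module R (left_quotient R J)"
proof -
  have J0: "J = J +> \<zero>" using left_idealD(1)[OF J] by simp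
  have "abelian_group (left_quotient R J)"
  proof (rule abelian_groupI)
    show "\<zero>\<^bsub>left_quotient R J\<^esub> \<in> carrier (left_quotient R J)"
      using J0 J by (auto simp: carrier_left_quotient)
    fix Y assume "Y \<in> carrier (left_quotient R J)"
    then obtain y where y: "y \<in> carrier R" "Y = J +> y" by (auto simp: carrier_left_quotient)
    have "(J +> \<zero>) \<oplus>\<^bsub>left_quotient R J\<^esub> (J +> y) = J +> y" using J y by simp
    then show "\<zero>\<^bsub>left_quotient R J\<^esub> \<oplus>\<^bsub>left_quotient R J\<^esub> Y = Y" using J0 J y by simp
    have "(J +> (\<ominus> y)) \<oplus>\<^bsub>left_quotient R J\<^esub> Y = J" using J y J0 by (simp add: l_neg)
    then show "\<exists>Z\<in>carrier (left_quotient R J). Z \<oplus>\<^bsub>left_quotient R J\<^esub> Y = \<zero>\<^bsub>left_quotient R J\<^esub>"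
      using J y carrier_left_quotient by (intro bexI[of _ "J +> (\<ominus> y)"]) auto
  next
    fix Y Z assume "Y \<in> carrier (left_quotient R J)" "Z \<in> carrier (left_quotient R J)"
    then obtain y z where yz: "y \<in> carrier R" "Y = J +> y" "z \<in> carrier R" "Z = J +> z"
      unfolding carrier_left_quotient by blast
    have sum: "Y \<oplus>\<^bsub>left_quotient R J\<^esub> Z = J +> (y \<oplus> z)" using J yz by simp
    then show "Y \<oplus>\<^bsub>left_quotient R J\<^esub> Z \<in> carrier (left_quotient R J)"
      unfolding carrier_left_quotient using yz by blast
    have "Z \<oplus>\<^bsub>left_quotient R J\<^esub> Y = J +> (z \<oplus> y)" using J yz by simp
    then show "Y \<oplus>\<^bsub>left_quotient R J\<^esub> Z = Z \<oplus>\<^bsub>left_quotient R J\<^esub> Y"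
      using sum a_comm[OF yz(1,3)] by simp
    fix W assume "W \<in> carrier (left_quotient R J)"
    then obtain w where "w \<in> carrier R" "W = J +> w"
      unfolding carrier_left_quotient by blast
    then show "Y \<oplus>\<^bsub>left_quotient R J\<^esub> Z \<oplus>\<^bsub>left_quotient R J\<^esub> W =
        Y \<oplus>\<^bsub>left_quotient R J\<^esub> (Z \<oplus>\<^bsub>left_quotient R J\<^esub> W)"
      using J yz by (simp add: a_assoc)
  qed
  then show ?thesis
    using J by (intro left_module.intro left_module_axioms.intro ring_axioms)
      (auto simp: carrier_left_quotient l_distr r_distr m_assoc)
qed

end

lemma (in left_module) smult_zeros:
  shows "x \<in> carrier M \<Longrightarrow> \<zero>\<^bsub>A\<^esub> \<odot>\<^bsub>M\<^esub> x = \<zero>\<^bsub>M\<^esub>" "a \<in> carrier A \<Longrightarrow> a \<odot>\<^bsub>M\<^esub> \<zero>\<^bsub>M\<^esub> = \<zero>\<^bsub>M\<^esub>"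
proof -
  have idem: "y = \<zero>\<^bsub>M\<^esub>" if "y \<in> carrier M" "y \<oplus>\<^bsub>M\<^esub> y = y" for y
    using that by (metis M.add.l_cancel_one')
  show "\<zero>\<^bsub>A\<^esub> \<odot>\<^bsub>M\<^esub> x = \<zero>\<^bsub>M\<^esub>" if "x \<in> carrier M"
    using smult_l_distr[of "\<zero>\<^bsub>A\<^esub>" "\<zero>\<^bsub>A\<^esub>" x] that smult_closed by (intro idem) auto
  show "a \<odot>\<^bsub>M\<^esub> \<zero>\<^bsub>M\<^esub> = \<zero>\<^bsub>M\<^esub>" if "a \<in> carrier A"
    using smult_r_distr[of a "\<zero>\<^bsub>M\<^esub>" "\<zero>\<^bsub>M\<^esub>"] that smult_closed by (intro idem) auto
qed

lemma (in left_module) smult_minus: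
  assumes "a \<in> carrier A" "b \<in> carrier A" "x \<in> carrier M" "a \<odot>\<^bsub>M\<^esub> x = b \<odot>\<^bsub>M\<^esub> x"
  shows "(a \<ominus>\<^bsub>A\<^esub> b) \<odot>\<^bsub>M\<^esub> x = \<zero>\<^bsub>M\<^esub>"
proof -
  have "(a \<ominus>\<^bsub>A\<^esub> b) \<odot>\<^bsub>M\<^esub> x = a \<odot>\<^bsub>M\<^esub> x \<oplus>\<^bsub>M\<^esub> (\<ominus>\<^bsub>A\<^esub> b) \<odot>\<^bsub>M\<^esub> x"
    using assms by (simp add: a_minus_def smult_l_distr)
  also have "\<dots> = (b \<oplus>\<^bsub>A\<^esub> \<ominus>\<^bsub>A\<^esub> b) \<odot>\<^bsub>M\<^esub> x"
    using assms by (subst smult_l_distr) auto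
  finally show ?thesis using assms by (simp add: A.r_neg smult_zeros)
qed

lemma submoduleI:
  assumes "left_module A M" "N \<subseteq> carrier M" "\<zero>\<^bsub>M\<^esub> \<in> N" "\<And>x y. x \<in> N \<Longrightarrow> y \<in> N \<Longrightarrow> x \<oplus>\<^bsub>M\<^esub> y \<in> N"
    "\<And>a x. a \<in> carrier A \<Longrightarrow> x \<in> N \<Longrightarrow> a \<odot>\<^bsub>M\<^esub> x \<in> N"
  shows "submodule N A M"
proof -
  interpret left_module A M by fact
  have "\<ominus>\<^bsub>M\<^esub> x \<in> N" if x: "x \<in> N" for x
  proof -
    have xM: "x \<in> carrier M" using x assms(2) by auto
    have "(\<ominus>\<^bsub>A\<^esub> \<one>\<^bsub>A\<^esub>) \<odot>\<^bsub>M\<^esub> x \<oplus>\<^bsub>M\<^esub> x = (\<ominus>\<^bsub>A\<^esub> \<one>\<^bsub>A\<^esub> \<oplus>\<^bsub>A\<^esub> \<one>\<^bsub>A\<^esub>) \<odot>\<^bsub>M\<^esub> x"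
      using xM by (simp add: smult_l_distr smult_one)
    also have "\<dots> = \<zero>\<^bsub>M\<^esub>" using xM by (simp add: A.l_neg smult_zeros)
    finally have "(\<ominus>\<^bsub>A\<^esub> \<one>\<^bsub>A\<^esub>) \<odot>\<^bsub>M\<^esub> x = \<ominus>\<^bsub>M\<^esub> x"
      using xM by (intro M.minus_equality[symmetric]) (auto intro: smult_closed)
    then show ?thesis using assms(5)[of "\<ominus>\<^bsub>A\<^esub> \<one>\<^bsub>A\<^esub>" x] x by simp
  qed
  then show ?thesis
    using assms by (intro submodule.intro submodule_axioms.intro group.subgroupI M.add.is_group)
      (auto simp: a_inv_def[symmetric])
qed

lemma submoduleD:
  assumes "submodule N A M"
  shows "N \<subseteq> carrier M" "\<zero>\<^bsub>M\<^esub> \<in> N" "x \<in> N \<Longrightarrow> y \<in> N \<Longrightarrow> x \<oplus>\<^bsub>M\<^esub> y \<in> N"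
    "a \<in> carrier A \<Longrightarrow> x \<in> N \<Longrightarrow> a \<odot>\<^bsub>M\<^esub> x \<in> N"
proof -
  interpret submodule N A M by fact
  show "N \<subseteq> carrier M" "\<zero>\<^bsub>M\<^esub> \<in> N" "x \<in> N \<Longrightarrow> y \<in> N \<Longrightarrow> x \<oplus>\<^bsub>M\<^esub> y \<in> N"
    "a \<in> carrier A \<Longrightarrow> x \<in> N \<Longrightarrow> a \<odot>\<^bsub>M\<^esub> x \<in> N"
    using subset one_closed m_closed by auto
qed

lemma (in ring) simple_module_left_quotient:
  assumes max: "maximal_left_ideal R J" shows "simple_module R (left_quotient R J)"
proof -
  have J: "left_ideal R J" and one: "\<one> \<notin> J" using max by (auto simp: maximal_left_ideal_def)
  let ?Q = "left_quotient R J"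
  have "J +> \<one> \<in> carrier ?Q" "J +> \<one> \<noteq> J"
    using one J left_coset_eq_self_iff by (auto simp: carrier_left_quotient)
  moreover have "N = {J} \<or> N = carrier ?Q" if N: "submodule N R ?Q" for N
  proof -
    note N = submoduleD[OF N]
    let ?N = "{x \<in> carrier R. J +> x \<in> N}"
    have zero: "\<zero>\<^bsub>?Q\<^esub> = J" by (simp add: left_quotient_def)
    have JN: "J \<subseteq> ?N"
    proof
      fix x assume x: "x \<in> J"
      then have "J +> x = J" using left_coset_eq_self_iff[OF J left_idealD(5)[OF J x]] by blast
      then show "x \<in> ?N" using N(2) zero left_idealD(5)[OF J x] by simp
    qed
    have "left_ideal R ?N"
      unfolding left_ideal_def
    proof (intro conjI ballI)
      show "\<zero> \<in> ?N" using JN left_idealD(2)[OF J] by auto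
      fix x y assume "x \<in> ?N" "y \<in> ?N"
      then show "x \<oplus> y \<in> ?N" using N(3)[of "J +> x" "J +> y"] J by simp
    next
      fix a x assume "a \<in> carrier R" "x \<in> ?N"
      then show "a \<otimes> x \<in> ?N" using N(4)[of a "J +> x"] J by simp
    qed auto
    then consider "?N = J" | "?N = carrier R"
      using max JN left_ideal_one unfolding maximal_left_ideal_def by blast
    then show ?thesis
    proof cases
      case 1
      have "Y = J" if Y: "Y \<in> N" for Y
      proof -
        obtain x where x: "x \<in> carrier R" "Y = J +> x" using Y N(1) carrier_left_quotient by blast
        then have "x \<in> ?N" using Y by simp
        then have "x \<in> J" by (simp only: 1)
        then have "J +> x = J" by (rule left_coset_eq_self_iff[OF J x(1), THEN iffD2])
        with x(2) show ?thesis by (rule trans)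
      qed
      then have "N \<subseteq> {J}" by (intro subsetI singletonI) (simp only: singleton_iff)
      moreover have "J \<in> N" using N(2) unfolding zero .
      ultimately have "N = {J}" by (intro equalityI) simp_all
      then show ?thesis ..
    next
      case 2
      have "Y \<in> N" if "Y \<in> carrier ?Q" for Y
        using that 2 by (auto simp: carrier_left_quotient)
      then show ?thesis using N(1) by auto
    qed
  qed
  ultimately show ?thesis
    using left_module_left_quotient[OF J] unfolding simple_module_def
    by (auto simp: left_quotient_def)
qed

definition annihilator :: "('a, 'c) ring_scheme \<Rightarrow> ('a, 'b, 'e) module_scheme \<Rightarrow> 'b \<Rightarrow> 'a set" where
  "annihilator A M v = {a \<in> carrier A. a \<odot>\<^bsub>M\<^esub> v = \<zero>\<^bsub>M\<^esub>}"

lemma simple_module_generated: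
  assumes simple: "simple_module A M" and v: "v \<in> carrier M" "v \<noteq> \<zero>\<^bsub>M\<^esub>" and x: "x \<in> carrier M"
  shows "\<exists>a\<in>carrier A. x = a \<odot>\<^bsub>M\<^esub> v"
proof -
  interpret left_module A M using simple by (simp add: simple_module_def)
  let ?N = "{a \<odot>\<^bsub>M\<^esub> v | a. a \<in> carrier A}"
  have "submodule ?N A M"
  proof (rule submoduleI[OF left_module_axioms])
    show "?N \<subseteq> carrier M" using v smult_closed by auto
    show "\<zero>\<^bsub>M\<^esub> \<in> ?N" using smult_zeros(1)[OF v(1)] by force
  next
    fix x y assume "x \<in> ?N" "y \<in> ?N"
    then show "x \<oplus>\<^bsub>M\<^esub> y \<in> ?N" using v smult_l_distr A.a_closed by (smt (verit) mem_Collect_eq)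
  next
    fix a x assume "a \<in> carrier A" "x \<in> ?N"
    then show "a \<odot>\<^bsub>M\<^esub> x \<in> ?N" using v smult_assoc A.m_closed by (smt (verit) mem_Collect_eq)
  qed
  moreover have "v \<in> ?N" using smult_one[OF v(1)] by (metis (mono_tags) A.one_closed mem_Collect_eq)
  ultimately have "?N = carrier M" using simple v unfolding simple_module_def by blast
  then show ?thesis using x by blast
qed

text \<open>
  If \<open>b v \<noteq> 0\<close>, then \<open>b v\<close> generates the simple module, so \<open>v = a b v\<close> for some \<open>a\<close> and \<open>1 - a b\<close> annihilates
  \<open>v\<close>.
\<close>

lemma maximal_left_ideal_annihilator:
  assumes simple: "simple_module A M" and v: "v \<in> carrier M" "v \<noteq> \<zero>\<^bsub>M\<^esub>"
  shows "maximal_left_ideal A (annihilator A M v)"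
proof -
  interpret left_module A M using simple by (simp add: simple_module_def)
  let ?J = "annihilator A M v"
  have J: "left_ideal A ?J"
    using v by (auto simp: left_ideal_def annihilator_def smult_l_distr smult_assoc smult_zeros)
  moreover have "\<one>\<^bsub>A\<^esub> \<notin> ?J" using v by (simp add: annihilator_def smult_one)
  moreover have "N = ?J" if N: "left_ideal A N" "?J \<subseteq> N" "\<one>\<^bsub>A\<^esub> \<notin> N" for N
  proof (rule ccontr)
    assume "N \<noteq> ?J"
    then obtain b where b: "b \<in> N" "b \<notin> ?J" using N by auto
    have bA: "b \<in> carrier A" using b N A.left_idealD by blast
    have bv: "b \<odot>\<^bsub>M\<^esub> v \<in> carrier M" "b \<odot>\<^bsub>M\<^esub> v \<noteq> \<zero>\<^bsub>M\<^esub>"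
      using b bA v by (auto simp: annihilator_def intro: smult_closed)
    obtain a where a: "a \<in> carrier A" "v = a \<odot>\<^bsub>M\<^esub> (b \<odot>\<^bsub>M\<^esub> v)"
      using simple_module_generated[OF simple bv v(1)] by blast
    then have "\<one>\<^bsub>A\<^esub> \<odot>\<^bsub>M\<^esub> v = (a \<otimes>\<^bsub>A\<^esub> b) \<odot>\<^bsub>M\<^esub> v"
      using smult_one[OF v(1)] smult_assoc[OF a(1) bA v(1)] by metis
    then have "(\<one>\<^bsub>A\<^esub> \<ominus>\<^bsub>A\<^esub> a \<otimes>\<^bsub>A\<^esub> b) \<odot>\<^bsub>M\<^esub> v = \<zero>\<^bsub>M\<^esub>"
      using a(1) bA v(1) by (intro smult_minus) auto
    then have "\<one>\<^bsub>A\<^esub> \<ominus>\<^bsub>A\<^esub> a \<otimes>\<^bsub>A\<^esub> b \<in> N" using N(2) a(1) bA by (auto simp: annihilator_def)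
    moreover have "a \<otimes>\<^bsub>A\<^esub> b \<in> N" using N(1) a(1) b(1) A.left_idealD(4) by blast
    ultimately have "(\<one>\<^bsub>A\<^esub> \<ominus>\<^bsub>A\<^esub> a \<otimes>\<^bsub>A\<^esub> b) \<oplus>\<^bsub>A\<^esub> a \<otimes>\<^bsub>A\<^esub> b \<in> N" using N(1) A.left_idealD(3) by blast
    then show False using N(3) a(1) bA by (simp add: a_minus_def A.a_assoc A.l_neg)
  qed
  ultimately show ?thesis by (auto simp: maximal_left_ideal_def)
qed

lemma left_quotient_isomorphic:
  assumes simple: "simple_module A M" and v: "v \<in> carrier M" "v \<noteq> \<zero>\<^bsub>M\<^esub>"
  shows "module_isomorphic A (left_quotient A (annihilator A M v)) M"
proof -
  interpret left_module A M using simple by (simp add: simple_module_def)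
  define J where "J = annihilator A M v"
  have J: "left_ideal A J"
    using maximal_left_ideal_annihilator[OF assms] by (simp add: maximal_left_ideal_def J_def)
  interpret J: abelian_subgroup J A using J by (rule A.left_ideal_abelian_subgroup)
  define f where "f Y = (SOME a. a \<in> Y) \<odot>\<^bsub>M\<^esub> v" for Y
  have eq_iff: "a \<odot>\<^bsub>M\<^esub> v = b \<odot>\<^bsub>M\<^esub> v \<longleftrightarrow> J +>\<^bsub>A\<^esub> a = J +>\<^bsub>A\<^esub> b"
    if a: "a \<in> carrier A" and b: "b \<in> carrier A" for a b
  proof
    assume "a \<odot>\<^bsub>M\<^esub> v = b \<odot>\<^bsub>M\<^esub> v"
    then have "(a \<ominus>\<^bsub>A\<^esub> b) \<odot>\<^bsub>M\<^esub> v = \<zero>\<^bsub>M\<^esub>" by (rule smult_minus[OF a b v(1)])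
    then have "a \<ominus>\<^bsub>A\<^esub> b \<in> J"
      unfolding J_def annihilator_def using A.minus_closed[OF a b] by blast
    then show "J +>\<^bsub>A\<^esub> a = J +>\<^bsub>A\<^esub> b" by (rule A.left_coset_eq_iff[OF J a b, THEN iffD2])
  next
    assume "J +>\<^bsub>A\<^esub> a = J +>\<^bsub>A\<^esub> b"
    then have "a \<ominus>\<^bsub>A\<^esub> b \<in> J" using A.left_coset_eq_iff[OF J a b] by simp
    then have "(a \<ominus>\<^bsub>A\<^esub> b) \<odot>\<^bsub>M\<^esub> v = \<zero>\<^bsub>M\<^esub>"
      unfolding J_def annihilator_def by blast
    then have "((a \<ominus>\<^bsub>A\<^esub> b) \<oplus>\<^bsub>A\<^esub> b) \<odot>\<^bsub>M\<^esub> v = b \<odot>\<^bsub>M\<^esub> v"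
      using smult_l_distr[OF A.minus_closed[OF a b] b v(1)] M.l_zero[OF smult_closed[OF b v(1)]] by simp
    then show "a \<odot>\<^bsub>M\<^esub> v = b \<odot>\<^bsub>M\<^esub> v" using a b by (simp add: a_minus_def A.a_assoc A.l_neg)
  qed
  have f: "f (J +>\<^bsub>A\<^esub> a) = a \<odot>\<^bsub>M\<^esub> v" if a: "a \<in> carrier A" for a
  proof -
    have "a \<in> J +>\<^bsub>A\<^esub> a" using a J.a_rcos_self by simp
    then have s: "(SOME b. b \<in> J +>\<^bsub>A\<^esub> a) \<in> J +>\<^bsub>A\<^esub> a" by (rule someI)
    then have "(SOME b. b \<in> J +>\<^bsub>A\<^esub> a) \<in> carrier A" using a J.a_elemrcos_carrier by blast
    moreover from s this have "J +>\<^bsub>A\<^esub> (SOME b. b \<in> J +>\<^bsub>A\<^esub> a) = J +>\<^bsub>A\<^esub> a"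
      using a J.a_repr_independence' by metis
    ultimately show ?thesis using a eq_iff unfolding f_def by blast
  qed
  have "bij_betw f (carrier (left_quotient A J)) (carrier M)"
  proof (rule bij_betw_imageI)
    show "inj_on f (carrier (left_quotient A J))"
    proof (rule inj_onI)
      fix Y Z assume "Y \<in> carrier (left_quotient A J)" "Z \<in> carrier (left_quotient A J)" and eq: "f Y = f Z"
      then obtain a b where ab: "a \<in> carrier A" "Y = J +>\<^bsub>A\<^esub> a" "b \<in> carrier A" "Z = J +>\<^bsub>A\<^esub> b"
        unfolding A.carrier_left_quotient by (elim bexE)
      then show "Y = Z" using eq eq_iff[OF ab(1,3)] f[OF ab(1)] f[OF ab(3)] by simp
    qed
    have "f ` carrier (left_quotient A J) = {a \<odot>\<^bsub>M\<^esub> v | a. a \<in> carrier A}"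
    proof (intro equalityI subsetI)
      fix y assume "y \<in> f ` carrier (left_quotient A J)"
      then obtain Y where Y: "Y \<in> carrier (left_quotient A J)" "y = f Y" by (elim imageE)
      then obtain a where a: "a \<in> carrier A" "Y = J +>\<^bsub>A\<^esub> a"
        unfolding A.carrier_left_quotient by (elim bexE)
      then have "y = a \<odot>\<^bsub>M\<^esub> v" using f[OF a(1)] Y(2) by simp
      then show "y \<in> {a \<odot>\<^bsub>M\<^esub> v | a. a \<in> carrier A}" using a(1) by blast
    next
      fix y assume "y \<in> {a \<odot>\<^bsub>M\<^esub> v | a. a \<in> carrier A}"
      then obtain a where a: "a \<in> carrier A" "y = a \<odot>\<^bsub>M\<^esub> v" by blast
      then have mem: "J +>\<^bsub>A\<^esub> a \<in> carrier (left_quotient A J)"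
        unfolding A.carrier_left_quotient by (intro bexI[of _ a]) simp
      have "y = f (J +>\<^bsub>A\<^esub> a)" unfolding f[OF a(1)] by (rule a(2))
      then show "y \<in> f ` carrier (left_quotient A J)" using mem by (rule image_eqI)
    qed
    also have "\<dots> = carrier M"
      using simple_module_generated[OF assms] smult_closed v by blast
    finally show "f ` carrier (left_quotient A J) = carrier M" .
  qed
  moreover have "f (Y \<oplus>\<^bsub>left_quotient A J\<^esub> Z) = f Y \<oplus>\<^bsub>M\<^esub> f Z"
    if "Y \<in> carrier (left_quotient A J)" "Z \<in> carrier (left_quotient A J)" for Y Z
    using that J v by (auto simp: A.carrier_left_quotient f smult_l_distr)
  moreover have "f (a \<odot>\<^bsub>left_quotient A J\<^esub> Y) = a \<odot>\<^bsub>M\<^esub> f Y"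
    if "Y \<in> carrier (left_quotient A J)" "a \<in> carrier A" for a Y
    using that J v by (auto simp: A.carrier_left_quotient f smult_assoc)
  ultimately show ?thesis unfolding module_isomorphic_def J_def[symmetric] by blast
qed

lemma module_isomorphic_refl: "module_isomorphic A M M"
  unfolding module_isomorphic_def by (rule exI[of _ id]) auto

lemma module_isomorphic_sym:
  assumes "left_module A M" "module_isomorphic A M N"
  shows "module_isomorphic A N M"
proof -
  interpret left_module A M by fact
  obtain f where f: "bij_betw f (carrier M) (carrier N)"
    "\<And>x y. x \<in> carrier M \<Longrightarrow> y \<in> carrier M \<Longrightarrow> f (x \<oplus>\<^bsub>M\<^esub> y) = f x \<oplus>\<^bsub>N\<^esub> f y"
    "\<And>a x. a \<in> carrier A \<Longrightarrow> x \<in> carrier M \<Longrightarrow> f (a \<odot>\<^bsub>M\<^esub> x) = a \<odot>\<^bsub>N\<^esub> f x"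
    using assms unfolding module_isomorphic_def by blast
  let ?g = "inv_into (carrier M) f"
  have g: "bij_betw ?g (carrier N) (carrier M)" using f(1) by (rule bij_betw_inv_into)
  have gf: "?g (f x) = x" if "x \<in> carrier M" for x using f(1) that by (simp add: bij_betw_inv_into_left)
  have surj: "\<exists>x'\<in>carrier M. x = f x'" if "x \<in> carrier N" for x using f(1) that by (auto simp: bij_betw_def)
  have "?g (x \<oplus>\<^bsub>N\<^esub> y) = ?g x \<oplus>\<^bsub>M\<^esub> ?g y" if "x \<in> carrier N" "y \<in> carrier N" for x y
    using surj[OF that(1)] surj[OF that(2)] by (auto simp: gf f(2)[symmetric])
  moreover have "?g (a \<odot>\<^bsub>N\<^esub> x) = a \<odot>\<^bsub>M\<^esub> ?g x" if "a \<in> carrier A" "x \<in> carrier N" for a x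
    using surj[OF that(2)] that(1) by (auto simp: gf f(3)[symmetric] smult_closed)
  ultimately show ?thesis using g unfolding module_isomorphic_def by blast
qed

lemma module_isomorphic_trans:
  assumes "module_isomorphic A L M" "module_isomorphic A M N"
  shows "module_isomorphic A L N"
proof -
  obtain f g where f: "bij_betw f (carrier L) (carrier M)"
      "\<forall>x\<in>carrier L. \<forall>y\<in>carrier L. f (x \<oplus>\<^bsub>L\<^esub> y) = f x \<oplus>\<^bsub>M\<^esub> f y"
      "\<forall>a\<in>carrier A. \<forall>x\<in>carrier L. f (a \<odot>\<^bsub>L\<^esub> x) = a \<odot>\<^bsub>M\<^esub> f x"
    and g: "bij_betw g (carrier M) (carrier N)"
      "\<forall>x\<in>carrier M. \<forall>y\<in>carrier M. g (x \<oplus>\<^bsub>M\<^esub> y) = g x \<oplus>\<^bsub>N\<^esub> g y"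
      "\<forall>a\<in>carrier A. \<forall>x\<in>carrier M. g (a \<odot>\<^bsub>M\<^esub> x) = a \<odot>\<^bsub>N\<^esub> g x"
    using assms unfolding module_isomorphic_def by blast
  have "f x \<in> carrier M" if "x \<in> carrier L" for x using f(1) that by (auto simp: bij_betw_def)
  then show ?thesis
    unfolding module_isomorphic_def
    using bij_betw_trans[OF f(1) g(1)] f g by (intro exI[of _ "g \<circ> f"]) auto
qed

text \<open>
  The witness \<open>a\<close> represents the image of the coset of \<open>1\<close>.
\<close>

lemma (in ring) left_quotient_isomorphic_imp:
  assumes J: "left_ideal R J" "\<one> \<notin> J" and J': "left_ideal R J'"
    and iso: "module_isomorphic R (left_quotient R J) (left_quotient R J')"
  shows "\<exists>a\<in>carrier R - J'. \<forall>x\<in>J. x \<otimes> a \<in> J'"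
proof -
  let ?Q = "left_quotient R J" and ?Q' = "left_quotient R J'"
  obtain f where f: "bij_betw f (carrier ?Q) (carrier ?Q')"
    "\<forall>x\<in>carrier ?Q. \<forall>y\<in>carrier ?Q. f (x \<oplus>\<^bsub>?Q\<^esub> y) = f x \<oplus>\<^bsub>?Q'\<^esub> f y"
    "\<forall>a\<in>carrier R. \<forall>x\<in>carrier ?Q. f (a \<odot>\<^bsub>?Q\<^esub> x) = a \<odot>\<^bsub>?Q'\<^esub> f x"
    using iso unfolding module_isomorphic_def by blast
  have zeroQ: "J +> \<zero> = J" "J' +> \<zero> = J'" using J J' left_idealD(1) by auto
  have mem: "J +> x \<in> carrier ?Q" if "x \<in> carrier R" for x using that carrier_left_quotient by blast
  have JQ: "J \<in> carrier ?Q" using mem[OF zero_closed] zeroQ by simp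
  obtain b where b: "b \<in> carrier R" "f J = J' +> b"
    using f(1) JQ carrier_left_quotient unfolding bij_betw_def by (metis imageI)
  have "f (\<zero> \<odot>\<^bsub>?Q\<^esub> (J +> \<zero>)) = \<zero> \<odot>\<^bsub>?Q'\<^esub> f (J +> \<zero>)" using f(3) mem by simp
  then have fJ: "f J = J'" using J J' b zeroQ left_quotient_simps(2)[OF J(1) zero_closed zero_closed] by simp
  obtain a where a: "a \<in> carrier R" "f (J +> \<one>) = J' +> a"
    using f(1) mem[OF one_closed] carrier_left_quotient unfolding bij_betw_def by (metis imageI)
  have "J +> \<one> \<noteq> J" using J left_coset_eq_self_iff by simp
  then have "f (J +> \<one>) \<noteq> f J" using f(1) JQ mem unfolding bij_betw_def inj_on_def by blast
  then have "a \<notin> J'" using a fJ J' left_coset_eq_self_iff by simp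
  moreover have "x \<otimes> a \<in> J'" if x: "x \<in> J" for x
  proof -
    have xR: "x \<in> carrier R" using x J left_idealD by blast
    have "f (x \<odot>\<^bsub>?Q\<^esub> (J +> \<one>)) = x \<odot>\<^bsub>?Q'\<^esub> f (J +> \<one>)" using f(3) mem xR by simp
    then have "f (J +> x) = J' +> (x \<otimes> a)" using J J' a xR by simp
    moreover have "J +> x = J" using x left_coset_eq_self_iff[OF J(1) xR] by blast
    ultimately have "J' +> (x \<otimes> a) = J'" using fJ by metis
    then show ?thesis using left_coset_eq_self_iff[OF J' m_closed[OF xR a(1)]] by blast
  qed
  ultimately show ?thesis using a by blast
qed

lemma (in ring) left_quotient_isomorphicI:
  assumes J: "maximal_left_ideal R J" and J': "maximal_left_ideal R J'"
    and a: "a \<in> carrier R" "a \<notin> J'" "\<And>x. x \<in> J \<Longrightarrow> x \<otimes> a \<in> J'"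
  shows "module_isomorphic R (left_quotient R J) (left_quotient R J')"
proof -
  have l: "left_ideal R J" "left_ideal R J'" using J J' by (auto simp: maximal_left_ideal_def)
  let ?Q = "left_quotient R J'" and ?v = "J' +> a"
  have simple: "simple_module R ?Q" using J' by (rule simple_module_left_quotient)
  have v: "?v \<in> carrier ?Q" "?v \<noteq> \<zero>\<^bsub>?Q\<^esub>"
    using a l left_coset_eq_self_iff by (auto simp: carrier_left_quotient left_quotient_def A_RCOSETS_def')
  have zero: "\<zero>\<^bsub>?Q\<^esub> = J'" by (simp add: left_quotient_def)
  have "J \<subseteq> annihilator R ?Q ?v"
  proof
    fix x assume x: "x \<in> J"
    have xR: "x \<in> carrier R" using left_idealD(5)[OF l(1) x] .
    have "J' +> (x \<otimes> a) = J'" using a(3)[OF x] left_coset_eq_self_iff[OF l(2) m_closed[OF xR a(1)]] by blast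
    then show "x \<in> annihilator R ?Q ?v" using xR a(1) l(2) by (simp add: annihilator_def)
  qed
  moreover have "maximal_left_ideal R (annihilator R ?Q ?v)"
    using maximal_left_ideal_annihilator[OF simple v] .
  ultimately have "annihilator R ?Q ?v = J" using J unfolding maximal_left_ideal_def by blast
  then show ?thesis using left_quotient_isomorphic[OF simple v] by simp
qed

text \<open>
  A classification of simple modules in terms of left ideals only. Every simple module is
  \<open>R / J'\<close> for a maximal left ideal \<open>J'\<close>, and \<open>R / J\<close> is isomorphic to it iff \<open>J\<close> is the annihilator
  of some nonzero coset of \<open>J'\<close>, that is, iff \<open>J a \<subseteq> J'\<close> for some \<open>a \<notin> J'\<close>.
\<close>

theorem (in ring) simple_classes_eqpoll:
  assumes max: "\<And>\<kappa>. \<kappa> \<in> K \<Longrightarrow> maximal_left_ideal R (J \<kappa>)"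
    and cover: "\<And>J'. maximal_left_ideal R J' \<Longrightarrow>
      \<exists>\<kappa>\<in>K. \<exists>a\<in>carrier R - J'. \<forall>x\<in>J \<kappa>. x \<otimes> a \<in> J'"
    and distinct: "\<And>\<kappa> \<kappa>' a. \<kappa> \<in> K \<Longrightarrow> \<kappa>' \<in> K \<Longrightarrow> a \<in> carrier R - J \<kappa>' \<Longrightarrow>
      \<forall>x\<in>J \<kappa>. x \<otimes> a \<in> J \<kappa>' \<Longrightarrow> \<kappa> = \<kappa>'"
  shows "K \<approx> simple_classes R"
proof -
  let ?S = "{M :: ('a, 'a set) module. simple_module R M}"
  let ?E = "{(M, N :: ('a, 'a set) module). simple_module R M \<and> simple_module R N \<and> module_isomorphic R M N}"
  have lm: "left_module R M" if "simple_module R M" for M :: "('a, 'a set) module"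
    using that by (simp add: simple_module_def)
  have equiv: "equiv ?S ?E"
  proof (rule equivI)
    show "refl_on ?S ?E" using module_isomorphic_refl by (auto simp: refl_on_def)
    show "sym ?E" using lm module_isomorphic_sym by (auto simp: sym_def)
    show "trans ?E" using module_isomorphic_trans by (fastforce simp: trans_def)
  qed auto
  let ?Q = "\<lambda>\<kappa>. left_quotient R (J \<kappa>)"
  have simple: "simple_module R (?Q \<kappa>)" if "\<kappa> \<in> K" for \<kappa>
    using max[OF that] by (rule simple_module_left_quotient)
  have "bij_betw (\<lambda>\<kappa>. ?E `` {?Q \<kappa>}) K (simple_classes R)"
  proof (rule bij_betw_imageI)
    show "inj_on (\<lambda>\<kappa>. ?E `` {?Q \<kappa>}) K"
    proof (rule inj_onI)
      fix \<kappa> \<kappa>' assume \<kappa>: "\<kappa> \<in> K" "\<kappa>' \<in> K" "?E `` {?Q \<kappa>} = ?E `` {?Q \<kappa>'}"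
      then have "(?Q \<kappa>, ?Q \<kappa>') \<in> ?E"
        using eq_equiv_class[OF _ equiv, of "?Q \<kappa>" "?Q \<kappa>'"] simple by blast
      then have "\<exists>a\<in>carrier R - J \<kappa>'. \<forall>x\<in>J \<kappa>. x \<otimes> a \<in> J \<kappa>'"
        using max \<kappa> by (intro left_quotient_isomorphic_imp) (auto simp: maximal_left_ideal_def)
      then show "\<kappa> = \<kappa>'" using distinct \<kappa> by blast
    qed
    show "(\<lambda>\<kappa>. ?E `` {?Q \<kappa>}) ` K = simple_classes R"
    proof
      show "(\<lambda>\<kappa>. ?E `` {?Q \<kappa>}) ` K \<subseteq> simple_classes R"
        unfolding simple_classes_def using simple by (intro image_subsetI quotientI) simp
      show "simple_classes R \<subseteq> (\<lambda>\<kappa>. ?E `` {?Q \<kappa>}) ` K"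
      proof
        fix c assume "c \<in> simple_classes R"
        then obtain M where M: "simple_module R M" "c = ?E `` {M}"
          unfolding simple_classes_def by (auto elim!: quotientE)
        interpret left_module R M using M lm by blast
        obtain v where v: "v \<in> carrier M" "v \<noteq> \<zero>\<^bsub>M\<^esub>"
          using M(1) M.zero_closed unfolding simple_module_def by blast
        let ?J' = "annihilator R M v"
        have max': "maximal_left_ideal R ?J'" using maximal_left_ideal_annihilator[OF M(1) v] .
        then obtain \<kappa> a where \<kappa>: "\<kappa> \<in> K" "a \<in> carrier R - ?J'" "\<forall>x\<in>J \<kappa>. x \<otimes> a \<in> ?J'"
          using cover by blast
        then have "module_isomorphic R (?Q \<kappa>) (left_quotient R ?J')"
          using max max' by (intro left_quotient_isomorphicI) auto
        then have "module_isomorphic R (?Q \<kappa>) M"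
          using left_quotient_isomorphic[OF M(1) v] module_isomorphic_trans by blast
        then have "(?Q \<kappa>, M) \<in> ?E" using M simple \<kappa> by blast
        then have "?E `` {?Q \<kappa>} = c" using equiv_class_eq[OF equiv] M by blast
        then show "c \<in> (\<lambda>\<kappa>. ?E `` {?Q \<kappa>}) ` K" using \<kappa> by blast
      qed
    qed
  qed
  then show ?thesis unfolding eqpoll_def by blast
qed

subsection \<open>Transport along surjective homomorphisms\<close>

lemma left_ideal_image:
  assumes "ring A" "ring B" "h \<in> ring_hom A B" "h ` carrier A = carrier B" "left_ideal A J"
  shows "left_ideal B (h ` J)"
proof -
  interpret A: ring A by fact
  interpret B: ring B by fact
  interpret h: ring_hom_ring A B h by (intro ring_hom_ringI2) fact+
  note J = A.left_idealD[OF assms(5)]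
  show ?thesis
    unfolding left_ideal_def
  proof (intro conjI ballI)
    show "h ` J \<subseteq> carrier B" using J(1) by auto
    show "\<zero>\<^bsub>B\<^esub> \<in> h ` J" using J(2) h.hom_zero by (metis imageI)
  next
    fix x y assume "x \<in> h ` J" "y \<in> h ` J"
    then obtain u v where uv: "u \<in> J" "v \<in> J" "x = h u" "y = h v" by blast
    then have "x \<oplus>\<^bsub>B\<^esub> y = h (u \<oplus>\<^bsub>A\<^esub> v)" using J(5) by simp
    then show "x \<oplus>\<^bsub>B\<^esub> y \<in> h ` J" using J(3) uv by blast
  next
    fix b x assume "b \<in> carrier B" "x \<in> h ` J"
    then obtain a u where au: "a \<in> carrier A" "u \<in> J" "b = h a" "x = h u" using assms(4) by blast
    then have "b \<otimes>\<^bsub>B\<^esub> x = h (a \<otimes>\<^bsub>A\<^esub> u)" using J(5) by simp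
    then show "b \<otimes>\<^bsub>B\<^esub> x \<in> h ` J" using J(4) au by blast
  qed
qed

lemma left_ideal_vimage:
  assumes "ring A" "ring B" "h \<in> ring_hom A B" "left_ideal B N"
  shows "left_ideal A {f \<in> carrier A. h f \<in> N}"
proof -
  interpret A: ring A by fact
  interpret B: ring B by fact
  interpret h: ring_hom_ring A B h by (intro ring_hom_ringI2) fact+
  show ?thesis
    using B.left_idealD[OF assms(4)] unfolding left_ideal_def by auto
qed

lemma mem_image_left_ideal:
  assumes "ring A" "ring B" "h \<in> ring_hom A B" "left_ideal A J"
    and ker: "{f \<in> carrier A. h f = \<zero>\<^bsub>B\<^esub>} \<subseteq> J" and f: "f \<in> carrier A"
  shows "h f \<in> h ` J \<longleftrightarrow> f \<in> J"
proof
  interpret A: ring A by fact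
  interpret B: ring B by fact
  interpret h: ring_hom_ring A B h by (intro ring_hom_ringI2) fact+
  note J = A.left_idealD[OF assms(4)]
  assume "h f \<in> h ` J"
  then obtain g where g: "g \<in> J" "h f = h g" by blast
  then have "h (f \<ominus>\<^bsub>A\<^esub> g) = \<zero>\<^bsub>B\<^esub>" using f J(5) by (simp add: a_minus_def B.r_neg)
  then have "f \<ominus>\<^bsub>A\<^esub> g \<in> J" using ker f J(5) g by auto
  then have "(f \<ominus>\<^bsub>A\<^esub> g) \<oplus>\<^bsub>A\<^esub> g \<in> J" using J(3) g by blast
  then show "f \<in> J" using f J(5) g by (simp add: a_minus_def A.a_assoc A.l_neg)
qed simp

lemma maximal_left_ideal_image:
  assumes "ring A" "ring B" "h \<in> ring_hom A B" "h ` carrier A = carrier B"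
    and max: "maximal_left_ideal A J" and ker: "{f \<in> carrier A. h f = \<zero>\<^bsub>B\<^esub>} \<subseteq> J"
  shows "maximal_left_ideal B (h ` J)"
proof -
  interpret A: ring A by fact
  interpret B: ring B by fact
  interpret h: ring_hom_ring A B h by (intro ring_hom_ringI2) fact+
  have J: "left_ideal A J" using max by (simp add: maximal_left_ideal_def)
  show ?thesis
    unfolding maximal_left_ideal_def
  proof (intro conjI allI impI)
    show "left_ideal B (h ` J)" using left_ideal_image assms(1-4) J by blast
    show "\<one>\<^bsub>B\<^esub> \<notin> h ` J"
      using mem_image_left_ideal[OF assms(1-3) J ker A.one_closed] max
      by (simp add: maximal_left_ideal_def)
    fix N assume N: "left_ideal B N" "h ` J \<subseteq> N" "\<one>\<^bsub>B\<^esub> \<notin> N"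
    let ?N = "{f \<in> carrier A. h f \<in> N}"
    have "left_ideal A ?N" using left_ideal_vimage assms(1-3) N by blast
    moreover have "J \<subseteq> ?N" using N A.left_idealD(5)[OF J] by blast
    moreover have "\<one>\<^bsub>A\<^esub> \<notin> ?N" using N by simp
    ultimately have eq: "?N = J" using max unfolding maximal_left_ideal_def by blast
    have "N \<subseteq> h ` J"
    proof
      fix y assume y: "y \<in> N"
      then obtain f where "f \<in> carrier A" "y = h f" using B.left_idealD(5)[OF N(1)] assms(4) by blast
      moreover from this have "f \<in> J" using y unfolding eq[symmetric] by simp
      ultimately show "y \<in> h ` J" by blast
    qed
    then show "N = h ` J" using N(2) by (intro equalityI)
  qed
qed

lemma maximal_left_ideal_vimage:
  assumes "ring A" "ring B" "h \<in> ring_hom A B" "h ` carrier A = carrier B"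
    and max: "maximal_left_ideal B J"
  shows "maximal_left_ideal A {f \<in> carrier A. h f \<in> J}"
proof -
  interpret A: ring A by fact
  interpret B: ring B by fact
  interpret h: ring_hom_ring A B h by (intro ring_hom_ringI2) fact+
  have J: "left_ideal B J" using max by (simp add: maximal_left_ideal_def)
  let ?J = "{f \<in> carrier A. h f \<in> J}"
  show ?thesis
    unfolding maximal_left_ideal_def
  proof (intro conjI allI impI)
    show "left_ideal A ?J" using left_ideal_vimage assms(1-3) J by blast
    show "\<one>\<^bsub>A\<^esub> \<notin> ?J" using max by (simp add: maximal_left_ideal_def)
    fix N assume N: "left_ideal A N" "?J \<subseteq> N" "\<one>\<^bsub>A\<^esub> \<notin> N"
    have ker: "{f \<in> carrier A. h f = \<zero>\<^bsub>B\<^esub>} \<subseteq> N" using N(2) B.left_idealD(2)[OF J] by auto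
    have "left_ideal B (h ` N)" using left_ideal_image assms(1-4) N by blast
    moreover have "J \<subseteq> h ` N"
    proof
      fix y assume y: "y \<in> J"
      then obtain f where "f \<in> carrier A" "y = h f" using B.left_idealD(5)[OF J] assms(4) by blast
      then show "y \<in> h ` N" using N(2) y by blast
    qed
    moreover have "\<one>\<^bsub>B\<^esub> \<notin> h ` N"
      using mem_image_left_ideal[OF assms(1-3) N(1) ker A.one_closed] N(3) by simp
    ultimately have eq: "h ` N = J" using max unfolding maximal_left_ideal_def by blast
    have "N \<subseteq> ?J" using A.left_idealD(5)[OF N(1)] eq by blast
    then show "N = ?J" using N(2) by (intro equalityI)
  qed
qed

section \<open>Monoid algebras\<close>

text \<open>
  The value at \<open>f\<close> of the linear extension of \<open>\<psi>\<close>. Elements of the monoid algebra are compared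
  through their pairings with all \<open>\<psi>\<close>, which turns identities between convolutions into identities
  between nested sums.
\<close>

definition pairing :: "('a \<Rightarrow> 'k::field) \<Rightarrow> ('a \<Rightarrow> 'k) \<Rightarrow> 'k" where
  "pairing f \<psi> = (\<Sum>x | f x \<noteq> 0. f x * \<psi> x)"

definition single :: "'a \<Rightarrow> 'a \<Rightarrow> 'k::field" where
  "single a = (\<lambda>x. if x = a then 1 else 0)"

definition scale :: "'k::field \<Rightarrow> ('a \<Rightarrow> 'k) \<Rightarrow> 'a \<Rightarrow> 'k" where
  "scale c f = (\<lambda>x. c * f x)"

lemma scale_simps [simp]:
  "scale c (f + g) = scale c f + scale c g" "scale c (f - g) = scale c f - scale c g"
  "scale c 0 = 0" "scale 0 f = 0" "scale 1 f = f" "scale c (scale c' f) = scale (c * c') f"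
  "scale (c + c') f = scale c f + scale c' f" "scale (c - c') f = scale c f - scale c' f"
  by (auto simp: scale_def fun_eq_iff algebra_simps)

lemma pairing_superset:
  "finite S \<Longrightarrow> {x. f x \<noteq> 0} \<subseteq> S \<Longrightarrow> pairing f \<psi> = (\<Sum>x\<in>S. f x * \<psi> x)"
  unfolding pairing_def by (rule sum.mono_neutral_left) auto

lemma pairing_single [simp]:
  fixes \<psi> :: "'a \<Rightarrow> 'k::field"
  shows "pairing (single a) \<psi> = \<psi> a"
proof -
  have "{x. single a x \<noteq> (0::'k)} = {a}" by (auto simp: single_def)
  then show ?thesis unfolding pairing_def by (simp add: single_def)
qed

lemma pairing_add:
  assumes "finite {x. f x \<noteq> 0}" "finite {x. g x \<noteq> 0}"
  shows "pairing (f + g) \<psi> = pairing f \<psi> + pairing g \<psi>"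
proof -
  let ?S = "{x. f x \<noteq> 0} \<union> {x. g x \<noteq> 0}"
  have "finite ?S" "{x. (f + g) x \<noteq> 0} \<subseteq> ?S" using assms by auto
  then show ?thesis using assms
    by (subst (1 2 3) pairing_superset[of ?S]) (auto simp: sum.distrib[symmetric] algebra_simps)
qed

lemma pairing_scale [simp]: "pairing (scale c f) \<psi> = c * pairing f \<psi>"
proof (cases "c = 0")
  case False
  then have "{x. scale c f x \<noteq> 0} = {x. f x \<noteq> 0}" by (auto simp: scale_def)
  then show ?thesis unfolding pairing_def by (simp add: scale_def sum_distrib_left mult.assoc)
qed (simp add: pairing_def scale_def)

lemma pairing_diff:
  assumes "finite {x. f x \<noteq> 0}" "finite {x. g x \<noteq> 0}"
  shows "pairing (f - g) \<psi> = pairing f \<psi> - pairing g \<psi>"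
proof -
  have "f - g = f + scale (- 1) g" by (auto simp: scale_def)
  moreover have "{x. scale (- 1) g x \<noteq> 0} = {x. g x \<noteq> 0}" by (auto simp: scale_def)
  then have "pairing (f + scale (- 1) g) \<psi> = pairing f \<psi> - pairing g \<psi>"
    using assms by (subst pairing_add) auto
  ultimately show ?thesis by metis
qed

lemma pairing_cong: "(\<And>x. f x \<noteq> 0 \<Longrightarrow> \<psi> x = \<phi> x) \<Longrightarrow> pairing f \<psi> = pairing f \<phi>"
  unfolding pairing_def by (intro sum.cong) auto

lemma pairing_mult_right: "pairing f (\<lambda>x. c * \<psi> x) = c * pairing f \<psi>"
  by (simp add: pairing_def sum_distrib_left algebra_simps)

lemma pairing_zero_right [simp]: "pairing f (\<lambda>x. 0) = 0"
  by (simp add: pairing_def)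

lemma pairing_ext:
  fixes f g :: "'a \<Rightarrow> 'k::field"
  assumes "finite {x. f x \<noteq> 0}" "finite {x. g x \<noteq> 0}" "\<And>\<psi>. pairing f \<psi> = pairing g \<psi>"
  shows "f = g"
proof
  fix y
  have "pairing f' (single y) = f' y" if "finite {x. f' x \<noteq> 0}" for f' :: "'a \<Rightarrow> 'k"
  proof -
    have "pairing f' (single y) = (\<Sum>x\<in>insert y {x. f' x \<noteq> 0}. f' x * single y x)"
      using that by (intro pairing_superset) auto
    also have "\<dots> = (\<Sum>x\<in>insert y {x. f' x \<noteq> 0}. if x = y then f' y else 0)"
      by (intro sum.cong) (auto simp: single_def)
    finally show ?thesis using that by (simp add: sum.delta)
  qed
  then show "f y = g y" using assms by metis
qed

context Group.monoid
begin

abbreviation kG :: "('a \<Rightarrow> 'k::field) ring" where "kG \<equiv> monoid_algebra G"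

abbreviation kG_mult_op :: "('a \<Rightarrow> 'k::field) \<Rightarrow> ('a \<Rightarrow> 'k) \<Rightarrow> 'a \<Rightarrow> 'k" (infixl "\<star>" 70) where
  "f \<star> g \<equiv> f \<otimes>\<^bsub>kG\<^esub> g"

lemma carrier_kG: "f \<in> carrier kG \<longleftrightarrow> finite {x. f x \<noteq> 0} \<and> {x. f x \<noteq> 0} \<subseteq> carrier G"
  by (simp add: monoid_algebra_def)

lemma kG_finite: "f \<in> carrier kG \<Longrightarrow> finite {x. f x \<noteq> 0}"
  and kG_support: "f \<in> carrier kG \<Longrightarrow> f x \<noteq> 0 \<Longrightarrow> x \<in> carrier G"
  by (auto simp: carrier_kG)

lemma kG_ops: "f \<oplus>\<^bsub>kG\<^esub> g = f + g" "\<zero>\<^bsub>kG\<^esub> = 0" "\<one>\<^bsub>kG\<^esub> = single \<one>"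
  by (auto simp: monoid_algebra_def single_def)

lemma kG_zero [simp]: "0 \<in> carrier kG"
  and kG_single [simp]: "x \<in> carrier G \<Longrightarrow> single x \<in> carrier kG"
  and kG_scale [simp]: "f \<in> carrier kG \<Longrightarrow> scale c f \<in> carrier kG"
  by (auto simp: carrier_kG single_def scale_def elim: finite_subset[rotated])

lemma kG_support_subset:
  assumes "f \<in> carrier kG" "g \<in> carrier kG" "{x. e x \<noteq> 0} \<subseteq> {x. f x \<noteq> 0} \<union> {x. g x \<noteq> 0}"
  shows "e \<in> carrier kG"
  using assms finite_subset[OF assms(3)] unfolding carrier_kG by blast

lemma kG_add [simp]:
  assumes "f \<in> carrier kG" "g \<in> carrier kG" shows "f + g \<in> carrier kG"
  by (rule kG_support_subset[OF assms]) auto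

lemma kG_diff [simp]:
  assumes "f \<in> carrier kG" "g \<in> carrier kG" shows "f - g \<in> carrier kG"
  by (rule kG_support_subset[OF assms]) auto

lemma pairing_kG_add: "f \<in> carrier kG \<Longrightarrow> g \<in> carrier kG \<Longrightarrow> pairing (f + g) \<psi> = pairing f \<psi> + pairing g \<psi>"
  and pairing_kG_diff: "f \<in> carrier kG \<Longrightarrow> g \<in> carrier kG \<Longrightarrow> pairing (f - g) \<psi> = pairing f \<psi> - pairing g \<psi>"
  by (simp_all add: kG_finite pairing_add pairing_diff)

lemma pairing_zero_left [simp]: "pairing 0 \<psi> = 0"
  by (simp add: pairing_def)

text \<open>
  The pairing of a convolution is an iterated pairing; the sum over all pairs is grouped by their
  products.
\<close>

lemma
  assumes f: "f \<in> carrier kG" and g: "g \<in> carrier kG"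
  shows kG_mult [simp]: "f \<star> g \<in> carrier kG"
    and pairing_kG_mult: "pairing (f \<star> g) \<psi> = pairing f (\<lambda>a. pairing g (\<lambda>b. \<psi> (a \<otimes> b)))"
proof -
  let ?S = "{x. f x \<noteq> 0} \<times> {x. g x \<noteq> 0}" and ?m = "\<lambda>(a, b). a \<otimes> b"
  have S: "finite ?S" using f g kG_finite by blast
  have mult: "(f \<star> g) z = (\<Sum>p\<in>{p \<in> ?S. ?m p = z}. f (fst p) * g (snd p))" for z
    unfolding monoid_algebra_def by (auto intro!: sum.cong)
  have supp: "{z. (f \<star> g) z \<noteq> 0} \<subseteq> ?m ` ?S"
  proof
    fix z assume "z \<in> {z. (f \<star> g) z \<noteq> 0}"
    then have nz: "(f \<star> g) z \<noteq> 0" by simp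
    show "z \<in> ?m ` ?S"
    proof (rule ccontr)
      assume "z \<notin> ?m ` ?S"
      then have e: "{p \<in> ?S. ?m p = z} = {}" by blast
      show False using nz unfolding mult[of z] e by simp
    qed
  qed
  have "?m ` ?S \<subseteq> carrier G" using f g by (auto intro!: m_closed dest: kG_support)
  then show "f \<star> g \<in> carrier kG"
    unfolding carrier_kG using supp S finite_subset[OF supp] by blast
  have "pairing (f \<star> g) \<psi> = (\<Sum>z\<in>?m ` ?S. (f \<star> g) z * \<psi> z)"
    using S supp by (intro pairing_superset) auto
  also have "\<dots> = (\<Sum>z\<in>?m ` ?S. \<Sum>p\<in>{p \<in> ?S. ?m p = z}. f (fst p) * g (snd p) * \<psi> (?m p))"
    unfolding mult sum_distrib_right by (intro sum.cong) auto
  also have "\<dots> = (\<Sum>p\<in>?S. f (fst p) * g (snd p) * \<psi> (?m p))"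
    using S by (intro sum.group) auto
  also have "\<dots> = (\<Sum>a | f a \<noteq> 0. \<Sum>b | g b \<noteq> 0. f a * g b * \<psi> (a \<otimes> b))"
    by (simp add: sum.cartesian_product split_beta)
  also have "\<dots> = pairing f (\<lambda>a. pairing g (\<lambda>b. \<psi> (a \<otimes> b)))"
    by (simp add: pairing_def sum_distrib_left mult.assoc)
  finally show "pairing (f \<star> g) \<psi> = pairing f (\<lambda>a. pairing g (\<lambda>b. \<psi> (a \<otimes> b)))" .
qed

lemma kG_ext:
  "f \<in> carrier kG \<Longrightarrow> g \<in> carrier kG \<Longrightarrow> (\<And>\<psi>. pairing f \<psi> = pairing g \<psi>) \<Longrightarrow> f = g"
  by (rule pairing_ext) (auto simp: kG_finite)

lemma pairing_right_add:
  "pairing f (\<lambda>x. \<psi> x + \<phi> x) = pairing f \<psi> + pairing f \<phi>"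
  by (simp add: pairing_def algebra_simps sum.distrib)

lemma kG_mult_add_left:
  "f \<in> carrier kG \<Longrightarrow> g \<in> carrier kG \<Longrightarrow> e \<in> carrier kG \<Longrightarrow> (f + g) \<star> e = f \<star> e + g \<star> e"
  by (rule kG_ext) (auto simp: pairing_kG_mult pairing_kG_add)

lemma kG_mult_add_right:
  "f \<in> carrier kG \<Longrightarrow> g \<in> carrier kG \<Longrightarrow> e \<in> carrier kG \<Longrightarrow> e \<star> (f + g) = e \<star> f + e \<star> g"
  by (rule kG_ext) (auto simp: pairing_kG_mult pairing_kG_add pairing_right_add)

lemma kG_mult_scale_left:
  "f \<in> carrier kG \<Longrightarrow> g \<in> carrier kG \<Longrightarrow> scale c f \<star> g = scale c (f \<star> g)"
  by (rule kG_ext) (auto simp: pairing_kG_mult)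

lemma kG_mult_scale_right:
  "f \<in> carrier kG \<Longrightarrow> g \<in> carrier kG \<Longrightarrow> g \<star> scale c f = scale c (g \<star> f)"
  by (rule kG_ext) (auto simp: pairing_kG_mult pairing_mult_right)

lemma kG_mult_diff_right:
  assumes "f \<in> carrier kG" "g \<in> carrier kG" "e \<in> carrier kG"
  shows "e \<star> (f - g) = e \<star> f - e \<star> g"
  using kG_mult_add_right[of "f - g" g e] assms by simp

lemma kG_mult_diff_left:
  assumes "f \<in> carrier kG" "g \<in> carrier kG" "e \<in> carrier kG"
  shows "(f - g) \<star> e = f \<star> e - g \<star> e"
  using kG_mult_add_left[of "f - g" g e] assms by simp

lemma kG_mult_assoc:
  assumes "f \<in> carrier kG" "g \<in> carrier kG" "e \<in> carrier kG"
  shows "(f \<star> g) \<star> e = f \<star> (g \<star> e)"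
proof (rule kG_ext)
  fix \<psi>
  have "pairing f (\<lambda>a. pairing g (\<lambda>b. pairing e (\<lambda>c. \<psi> (a \<otimes> b \<otimes> c)))) =
      pairing f (\<lambda>a. pairing g (\<lambda>b. pairing e (\<lambda>c. \<psi> (a \<otimes> (b \<otimes> c)))))"
    using assms by (intro pairing_cong) (simp add: m_assoc kG_support)
  then show "pairing ((f \<star> g) \<star> e) \<psi> = pairing (f \<star> (g \<star> e)) \<psi>"
    using assms by (simp add: pairing_kG_mult)
qed (use assms in auto)

lemma kG_mult_one:
  fixes f :: "'a \<Rightarrow> 'k::field"
  assumes "f \<in> carrier kG" shows "single \<one> \<star> f = f" "f \<star> single \<one> = f"
proof -
  have "pairing f (\<lambda>x. \<psi> (\<one> \<otimes> x)) = pairing f \<psi>" "pairing f (\<lambda>x. \<psi> (x \<otimes> \<one>)) = pairing f \<psi>" for \<psi> :: "'a \<Rightarrow> 'k"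
    using assms by (auto intro!: pairing_cong simp: kG_support)
  then show "single \<one> \<star> f = f" "f \<star> single \<one> = f"
    using assms by (auto intro!: kG_ext simp: pairing_kG_mult)
qed

lemma kG_mult_single: "x \<in> carrier G \<Longrightarrow> y \<in> carrier G \<Longrightarrow> single x \<star> single y = single (x \<otimes> y)"
  by (rule kG_ext) (auto simp: pairing_kG_mult)

text \<open>
  Associativity and distributivity hold after pairing with an arbitrary function.
\<close>

theorem ring_kG: "ring (kG :: ('a \<Rightarrow> 'k::field) ring)"
proof (rule ringI)
  show "abelian_group (kG :: ('a \<Rightarrow> 'k) ring)"
  proof (rule abelian_groupI)
    fix f :: "'a \<Rightarrow> 'k" assume "f \<in> carrier kG"
    then show "\<exists>g\<in>carrier kG. g \<oplus>\<^bsub>kG\<^esub> f = \<zero>\<^bsub>kG\<^esub>"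
      using kG_diff[of 0 f] by (intro bexI[of _ "0 - f"]) (auto simp: kG_ops)
  qed (auto simp: kG_ops add_ac)
  show "Group.monoid (kG :: ('a \<Rightarrow> 'k) ring)"
    by (rule monoidI) (auto simp: kG_ops kG_mult_assoc kG_mult_one)
qed (auto simp: kG_ops kG_mult_add_left kG_mult_add_right)

lemma kG_induct [consumes 1, case_names zero add]:
  fixes f :: "'a \<Rightarrow> 'k::field"
  assumes "f \<in> carrier kG" "P 0"
    and step: "\<And>f c x. f \<in> carrier kG \<Longrightarrow> x \<in> carrier G \<Longrightarrow> P f \<Longrightarrow> P (f + scale c (single x))"
  shows "P f"
proof -
  have "P f" if "finite S" "{x. f x \<noteq> 0} \<subseteq> S" "S \<subseteq> carrier G" for S and f :: "'a \<Rightarrow> 'k"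
    using that
  proof (induction S arbitrary: f rule: finite_induct)
    case empty
    then have "f = 0" by auto
    then show ?case using assms(2) by metis
  next
    case (insert x S)
    let ?g = "f - scale (f x) (single x)"
    have supp: "{y. ?g y \<noteq> 0} \<subseteq> S"
      using insert by (auto simp: scale_def single_def split: if_splits)
    then have "P ?g" using insert by auto
    moreover have "?g \<in> carrier kG" using supp insert finite_subset by (fastforce simp: carrier_kG)
    ultimately have "P (?g + scale (f x) (single x))" using insert by (intro step) auto
    then show ?case by simp
  qed
  then show ?thesis using assms(1) carrier_kG by blast
qed

lemma left_ideal_kG:
  assumes "left_ideal (kG :: ('a \<Rightarrow> 'k::field) ring) J"
  shows "0 \<in> J" "f \<in> J \<Longrightarrow> g \<in> J \<Longrightarrow> f + g \<in> J" "f \<in> J \<Longrightarrow> scale c f \<in> J"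
    "f \<in> J \<Longrightarrow> g \<in> J \<Longrightarrow> f - g \<in> J" "f \<in> J \<Longrightarrow> f \<in> carrier kG"
    "x \<in> carrier G \<Longrightarrow> f \<in> J \<Longrightarrow> single x \<star> f \<in> J"
    "g \<in> carrier kG \<Longrightarrow> f \<in> J \<Longrightarrow> g \<star> f \<in> J"
proof -
  interpret kG: ring "kG :: ('a \<Rightarrow> 'k) ring" by (rule ring_kG)
  note J = kG.left_idealD[OF assms]
  show "0 \<in> J" using J(2) by (simp add: kG_ops)
  show add: "f \<in> J \<Longrightarrow> g \<in> J \<Longrightarrow> f + g \<in> J" for f g using J(3) by (simp add: kG_ops)
  show f: "f \<in> J \<Longrightarrow> f \<in> carrier kG" for f using J(5) .
  show scale: "f \<in> J \<Longrightarrow> scale c f \<in> J" for f c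
    using J(4)[of "scale c (single \<one>)" f] f[of f] by (simp add: kG_mult_scale_left kG_mult_one)
  show "f \<in> J \<Longrightarrow> g \<in> J \<Longrightarrow> f - g \<in> J"
  proof -
    assume "f \<in> J" "g \<in> J"
    then have "f + scale (- 1) g \<in> J" using add scale by blast
    moreover have "f + scale (- 1) g = f - g" by (auto simp: scale_def)
    ultimately show "f - g \<in> J" by simp
  qed
  show "x \<in> carrier G \<Longrightarrow> f \<in> J \<Longrightarrow> single x \<star> f \<in> J" using J(4) by simp
  show "g \<in> carrier kG \<Longrightarrow> f \<in> J \<Longrightarrow> g \<star> f \<in> J" using J(4) by simp
qed

lemma left_ideal_kGI:
  assumes "J \<subseteq> carrier kG" "0 \<in> J" "\<And>f g. f \<in> J \<Longrightarrow> g \<in> J \<Longrightarrow> f + g \<in> J"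
    "\<And>c f. f \<in> J \<Longrightarrow> scale c f \<in> J" "\<And>x f. x \<in> carrier G \<Longrightarrow> f \<in> J \<Longrightarrow> single x \<star> f \<in> J"
  shows "left_ideal (kG :: ('a \<Rightarrow> 'k::field) ring) J"
  unfolding left_ideal_def
proof (intro conjI ballI)
  fix g f :: "'a \<Rightarrow> 'k" assume "g \<in> carrier kG" and f: "f \<in> J"
  have fk: "f \<in> carrier kG" using f assms(1) by blast
  show "g \<star> f \<in> J"
  proof (rule kG_induct[OF \<open>g \<in> carrier kG\<close>])
    have "0 \<star> f = 0"
      using fk by (intro kG_ext) (auto simp: pairing_kG_mult)
    then show "0 \<star> f \<in> J" using assms(2) by metis
  next
    fix g c x assume *: "g \<in> carrier kG" "x \<in> carrier G" "g \<star> f \<in> J"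
    then have "(g + scale c (single x)) \<star> f = g \<star> f + scale c (single x \<star> f)"
      using fk by (simp add: kG_mult_add_left kG_mult_scale_left)
    moreover have "g \<star> f + scale c (single x \<star> f) \<in> J"
      using * f assms(3-5) by blast
    ultimately show "(g + scale c (single x)) \<star> f \<in> J" by metis
  qed
qed (use assms in \<open>auto simp: kG_ops\<close>)

text \<open>
  If each \<open>a x\<close> with \<open>x\<close> in the monoid acts on \<open>v\<close> by a scalar modulo \<open>J\<close>, then so does \<open>a f\<close>, by the linear
  extension of these scalars.
\<close>

lemma eigenvector_linear:
  assumes J: "left_ideal (kG :: ('a \<Rightarrow> 'k::field) ring) J" and v: "v \<in> carrier kG" and a: "a \<in> carrier G"
    and eig: "\<And>x. x \<in> carrier G \<Longrightarrow> single (a \<otimes> x) \<star> v - scale (\<psi> x) v \<in> J"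
    and f: "f \<in> carrier kG"
  shows "single a \<star> (f \<star> v) - scale (pairing f \<psi>) v \<in> J"
proof (rule kG_induct[OF f])
  have "(0 :: 'a \<Rightarrow> 'k) \<star> v = 0" "single a \<star> (0 :: 'a \<Rightarrow> 'k) = 0"
    using v a by (auto intro!: kG_ext simp: pairing_kG_mult)
  then have "single a \<star> (0 \<star> v) - scale (pairing 0 \<psi>) v = 0" by simp
  then show "single a \<star> (0 \<star> v) - scale (pairing 0 \<psi>) v \<in> J"
    using left_ideal_kG(1)[OF J] by metis
next
  fix f c x
  assume *: "f \<in> carrier kG" "x \<in> carrier G"
    "single a \<star> (f \<star> v) - scale (pairing f \<psi>) v \<in> J"
  have "single a \<star> ((f + scale c (single x)) \<star> v) =
      single a \<star> (f \<star> v) + scale c (single (a \<otimes> x) \<star> v)"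
    using * v a
    by (simp add: kG_mult_add_left kG_mult_scale_left kG_mult_add_right kG_mult_scale_right
        kG_mult_assoc[symmetric] kG_mult_single)
  moreover have "pairing (f + scale c (single x)) \<psi> = pairing f \<psi> + c * \<psi> x"
    using * by (simp add: pairing_kG_add)
  ultimately have eq: "single a \<star> ((f + scale c (single x)) \<star> v) - scale (pairing (f + scale c (single x)) \<psi>) v =
      (single a \<star> (f \<star> v) - scale (pairing f \<psi>) v) +
      scale c (single (a \<otimes> x) \<star> v - scale (\<psi> x) v)"
    by (simp add: algebra_simps)
  show "single a \<star> ((f + scale c (single x)) \<star> v) - scale (pairing (f + scale c (single x)) \<psi>) v \<in> J"
    unfolding eq by (intro left_ideal_kG(2,3)[OF J] *(3) eig *(2))
qed

end

section \<open>Simple modules from multiplicative functionals\<close>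

context Group.monoid
begin

text \<open>
  The largest left ideal on which the linear extension of \<open>\<phi>\<close> vanishes.
\<close>

definition vanishing :: "('a \<Rightarrow> 'k::field) \<Rightarrow> ('a \<Rightarrow> 'k) set" where
  "vanishing \<phi> = {f \<in> carrier kG. \<forall>x\<in>carrier G. pairing f (\<lambda>y. \<phi> (x \<otimes> y)) = 0}"

lemma left_ideal_vanishing: "left_ideal (kG :: ('a \<Rightarrow> 'k::field) ring) (vanishing \<phi>)"
proof (rule left_ideal_kGI)
  fix x f assume x: "x \<in> carrier G" and f: "f \<in> vanishing \<phi>"
  then have fk: "f \<in> carrier kG" by (simp add: vanishing_def)
  have "pairing (single x \<star> f) (\<lambda>y. \<phi> (z \<otimes> y)) = 0" if z: "z \<in> carrier G" for z
  proof -
    have "pairing (single x \<star> f) (\<lambda>y. \<phi> (z \<otimes> y)) = pairing f (\<lambda>y. \<phi> (z \<otimes> (x \<otimes> y)))"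
      using x fk by (simp add: pairing_kG_mult)
    also have "\<dots> = pairing f (\<lambda>y. \<phi> (z \<otimes> x \<otimes> y))"
      using x z fk by (intro pairing_cong) (simp add: m_assoc kG_support)
    finally show ?thesis using f x z by (simp add: vanishing_def)
  qed
  then show "single x \<star> f \<in> vanishing \<phi>" using x fk by (simp add: vanishing_def)
qed (auto simp: vanishing_def pairing_kG_add)

lemma one_notin_vanishing: "\<phi> \<one> \<noteq> 0 \<Longrightarrow> single \<one> \<notin> vanishing \<phi>"
  by (auto simp: vanishing_def intro!: bexI[of _ \<one>])

text \<open>
  For \<open>f\<close> outside the ideal choose \<open>a\<close> such that \<open>\<phi> (a f) = k \<noteq> 0\<close>. Multiplicativity gives
  \<open>\<phi> (x e a f) = c \<phi> x k\<close> for all \<open>x\<close>, so \<open>e a f\<close> is congruent to the nonzero scalar \<open>c k\<close>.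
\<close>

lemma maximal_left_ideal_vanishing:
  fixes \<phi> :: "'a \<Rightarrow> 'k::field"
  assumes e: "e \<in> carrier G" and c: "c \<noteq> 0" and one: "\<phi> \<one> = 1"
    and mult: "\<And>x y. x \<in> carrier G \<Longrightarrow> y \<in> carrier G \<Longrightarrow> \<phi> (x \<otimes> e \<otimes> y) = c * \<phi> x * \<phi> y"
  shows "maximal_left_ideal kG (vanishing \<phi>)"
  unfolding maximal_left_ideal_def
proof (intro conjI allI impI)
  show "left_ideal kG (vanishing \<phi>)" by (rule left_ideal_vanishing)
  show "\<one>\<^bsub>kG\<^esub> \<notin> vanishing \<phi>" using one one_notin_vanishing[of \<phi>] by (simp add: kG_ops)
  fix N assume N: "left_ideal kG N" "vanishing \<phi> \<subseteq> N" "\<one>\<^bsub>kG\<^esub> \<notin> N"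
  note N' = left_ideal_kG[OF N(1)]
  have "N \<subseteq> vanishing \<phi>"
  proof
    fix f assume f: "f \<in> N"
    then have fk: "f \<in> carrier kG" by (rule N'(5))
    show "f \<in> vanishing \<phi>"
    proof (rule ccontr)
      assume "f \<notin> vanishing \<phi>"
      then obtain a where a: "a \<in> carrier G" "pairing f (\<lambda>y. \<phi> (a \<otimes> y)) \<noteq> 0"
        using fk by (auto simp: vanishing_def)
      define k where "k = pairing f (\<lambda>y. \<phi> (a \<otimes> y))"
      let ?h = "single (e \<otimes> a) \<star> f"
      have hk: "?h \<in> carrier kG" using e a fk by simp
      have "pairing (?h - scale (c * k) (single \<one>)) (\<lambda>y. \<phi> (x \<otimes> y)) = 0" if x: "x \<in> carrier G" for x
      proof -
        have "pairing ?h (\<lambda>y. \<phi> (x \<otimes> y)) = pairing f (\<lambda>y. \<phi> (x \<otimes> (e \<otimes> a \<otimes> y)))"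
          using e a fk by (simp add: pairing_kG_mult)
        also have "\<dots> = pairing f (\<lambda>y. (c * \<phi> x) * \<phi> (a \<otimes> y))"
          using e a fk x mult[of x "a \<otimes> y" for y]
          by (intro pairing_cong) (simp add: m_assoc kG_support)
        also have "\<dots> = c * \<phi> x * k" by (simp add: pairing_mult_right k_def)
        finally show ?thesis using hk x by (simp add: pairing_kG_diff algebra_simps)
      qed
      then have "?h - scale (c * k) (single \<one>) \<in> N" using hk N(2) by (auto simp: vanishing_def)
      then have "?h - (?h - scale (c * k) (single \<one>)) \<in> N"
        using N'(4) N'(6)[of "e \<otimes> a" f] e a f by blast
      then have "scale (c * k) (single \<one>) \<in> N" by simp
      then have "scale (inverse (c * k)) (scale (c * k) (single \<one>)) \<in> N" by (rule N'(3))
      moreover have "inverse (c * k) * (c * k) = 1" using c a by (intro left_inverse) (simp add: k_def)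
      ultimately have "single \<one> \<in> N" by (simp del: inverse_mult_distrib)
      then show False using N(3) by (simp add: kG_ops)
    qed
  qed
  then show "N = vanishing \<phi>" using N(2) by (intro equalityI)
qed

text \<open>
  Thus the coset of \<open>1\<close> is an eigenvector of every \<open>e x\<close>, with eigenvalue \<open>c \<phi> x\<close>. This property
  characterises the module up to isomorphism.
\<close>

lemma single_eigen_vanishing:
  fixes \<phi> :: "'a \<Rightarrow> 'k::field"
  assumes e: "e \<in> carrier G" and x: "x \<in> carrier G"
    and mult: "\<And>x y. x \<in> carrier G \<Longrightarrow> y \<in> carrier G \<Longrightarrow> \<phi> (x \<otimes> e \<otimes> y) = c * \<phi> x * \<phi> y"
  shows "single (e \<otimes> x) - scale (c * \<phi> x) (single \<one>) \<in> vanishing \<phi>"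
  using assms m_assoc[OF _ e x] unfolding vanishing_def
  by (auto simp: pairing_kG_diff m_assoc[symmetric])

text \<open>
  The elements \<open>g\<close> such that \<open>e\<close> annihilates the submodule generated by the coset of \<open>g\<close>.
\<close>

definition killed_by :: "'a \<Rightarrow> ('a \<Rightarrow> 'k::field) set \<Rightarrow> ('a \<Rightarrow> 'k) set" where
  "killed_by e J = {g \<in> carrier kG. \<forall>x\<in>carrier G. single (e \<otimes> x) \<star> g \<in> J}"

lemma left_ideal_killed_by:
  fixes J :: "('a \<Rightarrow> 'k::field) set"
  assumes J: "left_ideal kG J" and e: "e \<in> carrier G"
  shows "left_ideal kG (killed_by e J)" "J \<subseteq> killed_by e J"
proof -
  note l = left_ideal_kG[OF J]
  show "left_ideal kG (killed_by e J)"
  proof (rule left_ideal_kGI)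
    have "single y \<star> 0 = (0 :: 'a \<Rightarrow> 'k)" if "y \<in> carrier G" for y
      using that by (intro kG_ext) (auto simp: pairing_kG_mult)
    then show "0 \<in> killed_by e J" unfolding killed_by_def
      using l(1) e by (auto simp only: mem_Collect_eq kG_zero m_closed)
  next
    fix f g assume "f \<in> killed_by e J" "g \<in> killed_by e J"
    then show "f + g \<in> killed_by e J" using l(2) e by (simp add: killed_by_def kG_mult_add_right)
  next
    fix k f assume "f \<in> killed_by e J"
    then show "scale k f \<in> killed_by e J" using l(3) e by (simp add: killed_by_def kG_mult_scale_right)
  next
    fix x f assume x: "x \<in> carrier G" and f: "f \<in> killed_by e J"
    have "single (e \<otimes> y) \<star> (single x \<star> f) = single (e \<otimes> (y \<otimes> x)) \<star> f"
      if "y \<in> carrier G" for y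
      using that x f e by (simp add: killed_by_def kG_mult_assoc[symmetric] kG_mult_single m_assoc)
    then show "single x \<star> f \<in> killed_by e J" using x f by (simp add: killed_by_def)
  qed (auto simp: killed_by_def)
  show "J \<subseteq> killed_by e J" unfolding killed_by_def using l(5,6) e by blast
qed

text \<open>
  Each \<open>\<phi> \<kappa>\<close> that is multiplicative across \<open>e \<kappa>\<close> gives a simple module, namely the quotient by
  \<open>vanishing (\<phi> \<kappa>)\<close>. The hypothesis on left ideals \<open>J\<close> says that every nonzero cyclic module contains
  an eigenvector \<open>v\<close> as in \<open>single_eigen_vanishing\<close>. In a simple module this forces \<open>vanishing (\<phi> \<kappa>)\<close> to
  annihilate \<open>v\<close>: for \<open>f\<close> in this ideal \<open>e \<kappa>\<close> kills the submodule generated by \<open>f v\<close>, but it does not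
  kill \<open>v\<close>, so \<open>f v = 0\<close>.

  The last hypothesis separates the modules. In the first case \<open>e \<kappa>\<close> maps the module onto a line, so
  the eigenvalues are determined by the module. In the other two cases one of \<open>e \<kappa>\<close>, \<open>e \<kappa>'\<close> acts as
  zero on the module that belongs to the other one, but not on its own.
\<close>

theorem simple_classes_of_functionals:
  fixes B :: "('r, 's) ring_scheme" and \<phi> :: "'i \<Rightarrow> 'a \<Rightarrow> 'k::field"
  assumes B: "ring B" and h: "h \<in> ring_hom kG B" "h ` carrier kG = carrier B"
    and e: "\<And>\<kappa>. \<kappa> \<in> K \<Longrightarrow> e \<kappa> \<in> carrier G" and c: "\<And>\<kappa>. \<kappa> \<in> K \<Longrightarrow> c \<kappa> \<noteq> 0"
    and one: "\<And>\<kappa>. \<kappa> \<in> K \<Longrightarrow> \<phi> \<kappa> \<one> = 1"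
    and mult: "\<And>\<kappa> x y. \<kappa> \<in> K \<Longrightarrow> x \<in> carrier G \<Longrightarrow> y \<in> carrier G \<Longrightarrow>
      \<phi> \<kappa> (x \<otimes> e \<kappa> \<otimes> y) = c \<kappa> * \<phi> \<kappa> x * \<phi> \<kappa> y"
    and ker: "\<And>\<kappa>. \<kappa> \<in> K \<Longrightarrow> {f \<in> carrier kG. h f = \<zero>\<^bsub>B\<^esub>} \<subseteq> vanishing (\<phi> \<kappa>)"
    and cover: "\<And>J. left_ideal kG J \<Longrightarrow> single \<one> \<notin> J \<Longrightarrow> {f \<in> carrier kG. h f = \<zero>\<^bsub>B\<^esub>} \<subseteq> J \<Longrightarrow>
      \<exists>\<kappa>\<in>K. \<exists>v\<in>carrier kG - J. \<forall>x\<in>carrier G.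
        single (e \<kappa> \<otimes> x) \<star> v - scale (c \<kappa> * \<phi> \<kappa> x) v \<in> J"
    and distinct: "\<And>\<kappa> \<kappa>'. \<kappa> \<in> K \<Longrightarrow> \<kappa>' \<in> K \<Longrightarrow> \<kappa> \<noteq> \<kappa>' \<Longrightarrow>
      (e \<kappa> = e \<kappa>' \<and> (\<exists>x\<in>carrier G. c \<kappa> * \<phi> \<kappa> x \<noteq> c \<kappa>' * \<phi> \<kappa>' x)) \<or>
      (\<forall>x\<in>carrier G. \<forall>y\<in>carrier G. \<phi> \<kappa>' (x \<otimes> e \<kappa> \<otimes> y) = 0) \<or>
      (\<forall>x\<in>carrier G. \<forall>y\<in>carrier G. \<phi> \<kappa> (x \<otimes> e \<kappa>' \<otimes> y) = 0)"
  shows "K \<approx> simple_classes B"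
proof (rule ring.simple_classes_eqpoll[OF B, where J = "\<lambda>\<kappa>. h ` vanishing (\<phi> \<kappa>)"])
  interpret A: ring "kG :: ('a \<Rightarrow> 'k) ring" by (rule ring_kG)
  interpret B: ring B by (rule B)
  interpret h: ring_hom_ring kG B h by (intro ring_hom_ringI2 ring_kG B h(1))
  note maxA = maximal_left_ideal_vanishing[OF e c one mult]
  show "maximal_left_ideal B (h ` vanishing (\<phi> \<kappa>))" if "\<kappa> \<in> K" for \<kappa>
    by (intro maximal_left_ideal_image[OF ring_kG B h] maxA ker that)
  have vk: "f \<in> vanishing (\<phi> \<kappa>) \<Longrightarrow> f \<in> carrier kG" for f \<kappa> by (simp add: vanishing_def)

  fix J' assume J': "maximal_left_ideal B J'"
  let ?J = "{f \<in> carrier kG. h f \<in> J'}"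
  have maxJ: "maximal_left_ideal kG ?J" by (rule maximal_left_ideal_vimage[OF ring_kG B h J'])
  then have J: "left_ideal kG ?J" "single \<one> \<notin> ?J"
    unfolding maximal_left_ideal_def kG_ops by blast+
  have "\<zero>\<^bsub>B\<^esub> \<in> J'" using J' B.left_idealD(2) by (simp add: maximal_left_ideal_def)
  then have kerJ: "{f \<in> carrier kG. h f = \<zero>\<^bsub>B\<^esub>} \<subseteq> ?J" by auto
  note lJ = left_ideal_kG[OF J(1)]
  obtain \<kappa> v where \<kappa>: "\<kappa> \<in> K" and v: "v \<in> carrier kG" "v \<notin> ?J"
    and eig: "\<And>x. x \<in> carrier G \<Longrightarrow> single (e \<kappa> \<otimes> x) \<star> v - scale (c \<kappa> * \<phi> \<kappa> x) v \<in> ?J"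
    using cover[OF J kerJ] by blast
  note e\<kappa> = e[OF \<kappa>]
  \<comment> \<open>A proper left ideal containing the maximal one, as \<open>v\<close> is not in it.\<close>
  let ?N = "killed_by (e \<kappa>) ?J"
  have N: "left_ideal kG ?N" and "?J \<subseteq> ?N" using left_ideal_killed_by[OF J(1) e\<kappa>] by blast+
  moreover have "single \<one> \<notin> ?N"
  proof
    assume "single \<one> \<in> ?N"
    then have "?N = carrier kG" using A.left_ideal_one[OF N] by (simp add: kG_ops)
    then have "v \<in> ?N" using v by simp
    then have "single (e \<kappa> \<otimes> \<one>) \<star> v \<in> ?J" unfolding killed_by_def by blast
    then have "single (e \<kappa> \<otimes> \<one>) \<star> v - (single (e \<kappa> \<otimes> \<one>) \<star> v - scale (c \<kappa> * \<phi> \<kappa> \<one>) v) \<in> ?J"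
      using eig[OF one_closed] by (rule lJ(4))
    then have "scale (c \<kappa>) v \<in> ?J" by (simp add: one[OF \<kappa>])
    then have "scale (inverse (c \<kappa>)) (scale (c \<kappa>) v) \<in> ?J" by (rule lJ(3))
    then show False using v c[OF \<kappa>] by simp
  qed
  ultimately have NJ: "?N = ?J" using maxJ N unfolding maximal_left_ideal_def kG_ops by blast
  have vJ: "f \<star> v \<in> ?J" if f: "f \<in> vanishing (\<phi> \<kappa>)" for f
  proof -
    have "single (e \<kappa> \<otimes> x) \<star> (f \<star> v) \<in> ?J" if x: "x \<in> carrier G" for x
    proof -
      have "single (e \<kappa> \<otimes> x) \<star> (f \<star> v) - scale (pairing f (\<lambda>y. c \<kappa> * \<phi> \<kappa> (x \<otimes> y))) v \<in> ?J"
        using x e\<kappa> v(1) vk[OF f] eig by (intro eigenvector_linear[OF J(1)]) (auto simp only: m_assoc m_closed)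
      moreover have "pairing f (\<lambda>y. c \<kappa> * \<phi> \<kappa> (x \<otimes> y)) = 0"
        using f x by (simp add: pairing_mult_right vanishing_def)
      ultimately show ?thesis by simp
    qed
    then have "f \<star> v \<in> ?N" using vk[OF f] v(1) unfolding killed_by_def by simp
    then show ?thesis unfolding NJ .
  qed
  have "h f \<otimes>\<^bsub>B\<^esub> h v \<in> J'" if "f \<in> vanishing (\<phi> \<kappa>)" for f
    using vJ[OF that] h.hom_mult[OF vk[OF that] v(1)] by simp
  then show "\<exists>\<kappa>\<in>K. \<exists>a\<in>carrier B - J'. \<forall>x\<in>h ` vanishing (\<phi> \<kappa>). x \<otimes>\<^bsub>B\<^esub> a \<in> J'"
    using \<kappa> v by (intro bexI[of _ \<kappa>] bexI[of _ "h v"]) auto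
next
  interpret A: ring "kG :: ('a \<Rightarrow> 'k) ring" by (rule ring_kG)
  interpret B: ring B by (rule B)
  interpret h: ring_hom_ring kG B h by (intro ring_hom_ringI2 ring_kG B h(1))
  have mem: "h f \<in> h ` vanishing (\<phi> \<kappa>) \<longleftrightarrow> f \<in> vanishing (\<phi> \<kappa>)" if "\<kappa> \<in> K" "f \<in> carrier kG" for \<kappa> f
    by (intro mem_image_left_ideal[OF ring_kG B h(1) left_ideal_vanishing] ker that)
  have vk: "f \<in> vanishing (\<phi> \<kappa>) \<Longrightarrow> f \<in> carrier kG" for f \<kappa> by (simp add: vanishing_def)
  fix \<kappa> \<kappa>' b
  assume \<kappa>: "\<kappa> \<in> K" "\<kappa>' \<in> K" and b: "b \<in> carrier B - h ` vanishing (\<phi> \<kappa>')"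
    "\<forall>x\<in>h ` vanishing (\<phi> \<kappa>). x \<otimes>\<^bsub>B\<^esub> b \<in> h ` vanishing (\<phi> \<kappa>')"
  let ?J = "vanishing (\<phi> \<kappa>)" and ?J' = "vanishing (\<phi> \<kappa>')"
  obtain a where a: "a \<in> carrier kG" "b = h a" using b h(2) by blast
  have aJ: "a \<notin> ?J'" using b a by blast
  have Ja: "f \<star> a \<in> ?J'" if f: "f \<in> ?J" for f
  proof -
    have "h (f \<star> a) \<in> h ` ?J'" using b(2) f a vk[OF f] by simp
    then show ?thesis by (rule mem[OF \<kappa>(2) kG_mult[OF vk[OF f] a(1)], THEN iffD1])
  qed
  note l = left_ideal_kG[OF left_ideal_vanishing]
  have eiga: "single (e \<kappa> \<otimes> x) \<star> a - scale (c \<kappa> * \<phi> \<kappa> x) a \<in> ?J'" if x: "x \<in> carrier G" for x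
  proof -
    have "(single (e \<kappa> \<otimes> x) - scale (c \<kappa> * \<phi> \<kappa> x) (single \<one>)) \<star> a \<in> ?J'"
      using mult \<kappa> by (intro Ja single_eigen_vanishing e x) auto
    then show ?thesis
      using e[OF \<kappa>(1)] x a by (simp add: kG_mult_diff_left kG_mult_scale_left kG_mult_one)
  qed
  have scaleD: "k = 0 \<or> f \<in> ?J'" if "scale k f \<in> ?J'" for k f
  proof (cases "k = 0")
    case False
    then show ?thesis using l(3)[OF that, of "inverse k"] by simp
  qed simp
  have one': "single \<one> \<notin> ?J'" by (rule one_notin_vanishing) (simp add: one \<kappa>)
  show "\<kappa> = \<kappa>'"
  proof (rule ccontr)
    assume "\<kappa> \<noteq> \<kappa>'"
    from distinct[OF \<kappa> this] consider
        x where "e \<kappa> = e \<kappa>'" "x \<in> carrier G" "c \<kappa> * \<phi> \<kappa> x \<noteq> c \<kappa>' * \<phi> \<kappa>' x"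
      | "\<And>x y. x \<in> carrier G \<Longrightarrow> y \<in> carrier G \<Longrightarrow> \<phi> \<kappa>' (x \<otimes> e \<kappa> \<otimes> y) = 0"
      | "\<And>x y. x \<in> carrier G \<Longrightarrow> y \<in> carrier G \<Longrightarrow> \<phi> \<kappa> (x \<otimes> e \<kappa>' \<otimes> y) = 0"
      by blast
    then show False
    proof cases
      case 1
      \<comment> \<open>Both \<open>a\<close> and \<open>single \<one>\<close> lie on the line that \<open>e \<kappa>\<close> maps the module to, so they are
          proportional.\<close>
      define k where "k = pairing a (\<lambda>y. c \<kappa>' * \<phi> \<kappa>' y)"
      have eig1: "single (e \<kappa>' \<otimes> x) \<star> single \<one> - scale (c \<kappa>' * \<phi> \<kappa>' x) (single \<one>) \<in> ?J'"
        if x: "x \<in> carrier G" for x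
        using single_eigen_vanishing[OF e[OF \<kappa>(2)] x mult[OF \<kappa>(2)]] e[OF \<kappa>(2)] x
        by (simp add: kG_mult_one)
      have "single (e \<kappa>') \<star> (a \<star> single \<one>) - scale k (single \<one>) \<in> ?J'"
        unfolding k_def using a eig1 by (intro eigenvector_linear[OF left_ideal_vanishing] e \<kappa>) auto
      then have "single (e \<kappa>) \<star> a - scale k (single \<one>) \<in> ?J'"
        using a 1(1) by (simp add: kG_mult_one)
      moreover have "single (e \<kappa>) \<star> a - scale (c \<kappa>) a \<in> ?J'"
        using eiga[OF one_closed] e \<kappa> by (simp add: one)
      ultimately have "(single (e \<kappa>) \<star> a - scale k (single \<one>)) - (single (e \<kappa>) \<star> a - scale (c \<kappa>) a) \<in> ?J'"
        by (rule l(4))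
      then have ak: "scale (c \<kappa>) a - scale k (single \<one>) \<in> ?J'" by simp
      let ?E = "single (e \<kappa> \<otimes> x)" and ?s = "c \<kappa> * \<phi> \<kappa> x" and ?s' = "c \<kappa>' * \<phi> \<kappa>' x"
      have ex: "e \<kappa> \<otimes> x \<in> carrier G" using e \<kappa> 1 by simp
      have "?E \<star> (scale (c \<kappa>) a - scale k (single \<one>)) \<in> ?J'"
        using ak ex by (intro l(6))
      then have m1: "scale (c \<kappa>) (?E \<star> a) - scale k ?E \<in> ?J'"
        using a ex by (simp add: kG_mult_diff_right kG_mult_scale_right kG_mult_one)
      have m2: "scale (c \<kappa>) (?E \<star> a - scale ?s a) \<in> ?J'" using eiga 1 by (intro l(3)) auto
      have m3: "scale k (?E - scale ?s' (single \<one>)) \<in> ?J'"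
        using eig1[OF 1(2)] ex 1(1) by (intro l(3)) (simp add: kG_mult_one)
      have m4: "scale ?s (scale (c \<kappa>) a - scale k (single \<one>)) \<in> ?J'" using ak by (rule l(3))
      have "scale (c \<kappa>) (?E \<star> a) - scale k ?E - scale (c \<kappa>) (?E \<star> a - scale ?s a)
          + scale k (?E - scale ?s' (single \<one>)) - scale ?s (scale (c \<kappa>) a - scale k (single \<one>)) \<in> ?J'"
        by (rule l(4)[OF l(2)[OF l(4)[OF m1 m2] m3] m4])
      also have "scale (c \<kappa>) (?E \<star> a) - scale k ?E - scale (c \<kappa>) (?E \<star> a - scale ?s a)
          + scale k (?E - scale ?s' (single \<one>)) - scale ?s (scale (c \<kappa>) a - scale k (single \<one>))
          = scale (k * (?s - ?s')) (single \<one>)"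
        by (auto simp: scale_def algebra_simps)
      finally have "k * (?s - ?s') = 0" using scaleD one' by blast
      then have "k = 0" using 1 by simp
      then have "scale (c \<kappa>) a \<in> ?J'" using ak by simp
      then show False using scaleD aJ c \<kappa> by blast
    next
      case 2
      have "single (e \<kappa>) \<star> a \<in> ?J'"
        using a e[OF \<kappa>(1)] 2 unfolding vanishing_def
        by (auto simp: pairing_kG_mult m_assoc[symmetric] kG_support intro!: pairing_cong[THEN trans, OF _ pairing_zero_right])
      then have "single (e \<kappa>) \<star> a - (single (e \<kappa> \<otimes> \<one>) \<star> a - scale (c \<kappa> * \<phi> \<kappa> \<one>) a) \<in> ?J'"
        using eiga[OF one_closed] by (rule l(4))
      then have "scale (c \<kappa>) a \<in> ?J'" using e \<kappa> by (simp add: one)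
      then show False using scaleD aJ c \<kappa> by blast
    next
      case 3
      have ea: "single (e \<kappa>' \<otimes> y) \<star> a \<in> ?J'" if y: "y \<in> carrier G" for y
      proof (rule Ja)
        show "single (e \<kappa>' \<otimes> y) \<in> ?J"
          using e[OF \<kappa>(2)] y 3 by (simp add: vanishing_def m_assoc[symmetric])
      qed
      have "single (e \<kappa>' \<otimes> y) \<in> ?J'" if "y \<in> carrier G" for y
      proof -
        let ?N = "killed_by (e \<kappa>') ?J'"
        have "left_ideal kG ?N" "?J' \<subseteq> ?N"
          using left_ideal_killed_by[OF left_ideal_vanishing e[OF \<kappa>(2)]] by blast+
        moreover have "?N \<noteq> ?J'" using ea a aJ unfolding killed_by_def by blast
        moreover have "maximal_left_ideal kG ?J'"
          by (intro maximal_left_ideal_vanishing[OF e c one mult] \<kappa>)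
        ultimately have "single \<one> \<in> ?N" unfolding maximal_left_ideal_def kG_ops by blast
        then have "single (e \<kappa>' \<otimes> y) \<star> single \<one> \<in> ?J'"
          using that unfolding killed_by_def by blast
        then show ?thesis using kG_mult_one(2)[OF kG_single[OF m_closed[OF e[OF \<kappa>(2)] that]]] by metis
      qed
      then have "single (e \<kappa>' \<otimes> \<one>) \<in> ?J'" by blast
      then have "single (e \<kappa>' \<otimes> \<one>) - (single (e \<kappa>' \<otimes> \<one>) - scale (c \<kappa>' * \<phi> \<kappa>' \<one>) (single \<one>)) \<in> ?J'"
        using single_eigen_vanishing[OF e[OF \<kappa>(2)] one_closed mult[OF \<kappa>(2)]] by (rule l(4))
      then have "scale (c \<kappa>') (single \<one>) \<in> ?J'" by (simp add: one \<kappa>)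
      then show False using scaleD one' c \<kappa> by blast
    qed
  qed
qed

text \<open>
  The elements \<open>f\<close> with \<open>\<phi> (x f y) = 0\<close> for all \<open>x\<close> and \<open>y\<close> form a two-sided ideal.
\<close>

lemma genideal_subset_vanishing:
  fixes \<phi> :: "'a \<Rightarrow> 'k::field"
  assumes S: "S \<subseteq> carrier kG"
    and zero: "\<And>f x y. f \<in> S \<Longrightarrow> x \<in> carrier G \<Longrightarrow> y \<in> carrier G \<Longrightarrow> pairing f (\<lambda>z. \<phi> (x \<otimes> z \<otimes> y)) = 0"
  shows "Idl\<^bsub>kG\<^esub> S \<subseteq> vanishing \<phi>"
proof -
  interpret A: ring "kG :: ('a \<Rightarrow> 'k) ring" by (rule ring_kG)
  let ?P = "{f \<in> carrier kG. \<forall>x\<in>carrier G. \<forall>y\<in>carrier G. pairing f (\<lambda>z. \<phi> (x \<otimes> z \<otimes> y)) = 0}"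
  have left: "g \<star> f \<in> ?P" if f: "f \<in> ?P" and g: "g \<in> carrier kG" for f g
  proof -
    have "pairing (g \<star> f) (\<lambda>z. \<phi> (x \<otimes> z \<otimes> y)) = 0" if xy: "x \<in> carrier G" "y \<in> carrier G" for x y
    proof -
      have "pairing f (\<lambda>b. \<phi> (x \<otimes> (a \<otimes> b) \<otimes> y)) = 0" if a: "a \<in> carrier G" for a
      proof -
        have "pairing f (\<lambda>b. \<phi> (x \<otimes> (a \<otimes> b) \<otimes> y)) = pairing f (\<lambda>b. \<phi> ((x \<otimes> a) \<otimes> b \<otimes> y))"
          using kG_support[of f] f a xy by (intro pairing_cong) (simp add: m_assoc)
        then show ?thesis using f a xy by simp
      qed
      then have "pairing g (\<lambda>a. pairing f (\<lambda>b. \<phi> (x \<otimes> (a \<otimes> b) \<otimes> y))) = pairing g (\<lambda>a. 0)"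
        using g by (intro pairing_cong) (simp add: kG_support)
      then show ?thesis using f g by (simp add: pairing_kG_mult)
    qed
    then show ?thesis using f g by simp
  qed
  have right: "f \<star> g \<in> ?P" if f: "f \<in> ?P" and g: "g \<in> carrier kG" for f g
  proof -
    have "pairing (f \<star> g) (\<lambda>z. \<phi> (x \<otimes> z \<otimes> y)) = 0" if xy: "x \<in> carrier G" "y \<in> carrier G" for x y
    proof -
      have "pairing f (\<lambda>a. \<phi> (x \<otimes> (a \<otimes> b) \<otimes> y)) = 0" if b: "b \<in> carrier G" for b
      proof -
        have "pairing f (\<lambda>a. \<phi> (x \<otimes> (a \<otimes> b) \<otimes> y)) = pairing f (\<lambda>a. \<phi> (x \<otimes> a \<otimes> (b \<otimes> y)))"
          using kG_support[of f] f b xy by (intro pairing_cong) (simp add: m_assoc)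
        then show ?thesis using f b xy by simp
      qed
      then have "pairing g (\<lambda>b. pairing f (\<lambda>a. \<phi> (x \<otimes> (a \<otimes> b) \<otimes> y))) = pairing g (\<lambda>b. 0)"
        using g by (intro pairing_cong) (simp add: kG_support)
      moreover have "pairing f (\<lambda>a. pairing g (\<lambda>b. \<phi> (x \<otimes> (a \<otimes> b) \<otimes> y))) =
          pairing g (\<lambda>b. pairing f (\<lambda>a. \<phi> (x \<otimes> (a \<otimes> b) \<otimes> y)))"
        unfolding pairing_def sum_distrib_left by (subst sum.swap) (simp add: mult.left_commute)
      ultimately show ?thesis using f g by (simp add: pairing_kG_mult)
    qed
    then show ?thesis using f g by simp
  qed
  have "left_ideal kG ?P"
  proof (rule left_ideal_kGI)
    fix x f assume "x \<in> carrier G" "f \<in> ?P"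
    then show "single x \<star> f \<in> ?P" by (intro left) auto
  qed (auto simp: pairing_kG_add)
  then have "additive_subgroup ?P kG"
    using A.left_ideal_abelian_subgroup abelian_subgroup.axioms(1) by blast
  then have "ideal ?P kG"
    by (intro idealI ring_kG left right additive_subgroup.a_subgroup)
  moreover have "S \<subseteq> ?P" using S zero by blast
  ultimately have "Idl\<^bsub>kG\<^esub> S \<subseteq> ?P" by (rule A.genideal_minimal)
  also have "?P \<subseteq> vanishing \<phi>"
  proof
    fix f assume f: "f \<in> ?P"
    have "pairing f (\<lambda>z. \<phi> (x \<otimes> z)) = 0" if x: "x \<in> carrier G" for x
    proof -
      have "pairing f (\<lambda>z. \<phi> (x \<otimes> z)) = pairing f (\<lambda>z. \<phi> (x \<otimes> z \<otimes> \<one>))"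
        using kG_support[of f] f x by (intro pairing_cong) simp
      then show ?thesis using f x by simp
    qed
    then show "f \<in> vanishing \<phi>" using f by (simp add: vanishing_def)
  qed
  finally show ?thesis .
qed

end

section \<open>Eigenvectors of operators of finite order\<close>

text \<open>
  \<open>p(T) v\<close> by Horner's scheme.
\<close>

definition apply_poly :: "(('a \<Rightarrow> 'k::field) \<Rightarrow> 'a \<Rightarrow> 'k) \<Rightarrow> ('a \<Rightarrow> 'k) \<Rightarrow> 'k poly \<Rightarrow> 'a \<Rightarrow> 'k" where
  "apply_poly T v p = fold_coeffs (\<lambda>a f. scale a v + T f) p 0"

text \<open>
  The polynomial \<open>x\<^sup>m - 1\<close> is a product of linear factors, and it maps \<open>v\<close> into \<open>J\<close>. Applying the factors
  to \<open>v\<close> one after the other, one of them is the first to map a vector \<open>u \<notin> J\<close> into \<open>J\<close>. As \<open>u\<close> arises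
  from \<open>v\<close> by operators \<open>T - c\<close>, it inherits every property \<open>P\<close> that these operators preserve.
\<close>

lemma exists_eigenvector:
  fixes T :: "('a \<Rightarrow> 'k::alg_closed_field) \<Rightarrow> 'a \<Rightarrow> 'k"
  assumes V: "0 \<in> V" "\<And>f g. f \<in> V \<Longrightarrow> g \<in> V \<Longrightarrow> f + g \<in> V" "\<And>c f. f \<in> V \<Longrightarrow> scale c f \<in> V"
      "\<And>f. f \<in> V \<Longrightarrow> T f \<in> V"
    and T: "T 0 = 0" "\<And>f g. f \<in> V \<Longrightarrow> g \<in> V \<Longrightarrow> T (f + g) = T f + T g"
      "\<And>c f. f \<in> V \<Longrightarrow> T (scale c f) = scale c (T f)"
    and v: "v \<in> V" "v \<notin> J" and m: "m \<ge> 1" and order: "(T ^^ m) v - v \<in> J"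
    and P: "P v" "\<And>c f. f \<in> V \<Longrightarrow> P f \<Longrightarrow> P (T f - scale c f)"
  obtains \<zeta> u where "\<zeta> ^ m = 1" "u \<in> V" "u \<notin> J" "P u" "T u - scale \<zeta> u \<in> J"
proof -
  let ?ev = "apply_poly T v"
  have ev0: "?ev 0 = 0" by (simp add: apply_poly_def)
  have ev_pCons: "?ev (pCons a p) = scale a v + T (?ev p)" for a p
    by (cases "a = 0 \<and> p = 0") (auto simp: apply_poly_def T(1))
  have evV: "?ev p \<in> V" for p
  proof (induction p)
    case 0
    show ?case unfolding ev0 by (rule V(1))
  next
    case (pCons a p)
    show ?case unfolding ev_pCons by (intro V v(1) pCons.IH)
  qed
  have ev_add: "?ev (p + q) = ?ev p + ?ev q" for p q
    by (induction p q rule: poly_induct2)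
      (simp_all add: ev0 ev_pCons T evV algebra_simps del: plus_fun_apply zero_fun_apply)
  have ev_smult: "?ev (Polynomial.smult c p) = scale c (?ev p)" for c p
    by (induction p) (simp_all add: ev0 ev_pCons T evV del: plus_fun_apply zero_fun_apply)
  have ev_root: "?ev ([:- a, 1:] * p) = T (?ev p) - scale a (?ev p)" for a p
  proof -
    have "?ev ([:- a, 1:] * p) = scale (- a) (?ev p) + (scale 0 v + T (?ev p))"
      by (simp only: mult_pCons_left ev_add ev_smult ev_pCons mult_zero_left mult_1 smult_1_left add_0_right pCons_0_0 one_pCons[symmetric])
    then show ?thesis by (auto simp: scale_def)
  qed
  have ev_monom: "?ev (Polynomial.monom 1 k) = (T ^^ k) v" for k
    by (induction k) (simp_all add: monom_0 monom_Suc ev_pCons ev0 T(1))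
  let ?p = "Polynomial.monom 1 m - (1 :: 'k poly)"
  have deg: "Polynomial.degree ?p = m" "Polynomial.lead_coeff ?p = 1"
  proof -
    have "Polynomial.degree (Polynomial.monom (1 :: 'k) m + (- 1)) = Polynomial.degree (Polynomial.monom (1 :: 'k) m)"
      using m by (intro degree_add_eq_left) (simp add: degree_monom_eq)
    then show deg: "Polynomial.degree ?p = m" by (simp add: degree_monom_eq)
    show "Polynomial.lead_coeff ?p = 1" unfolding deg using m by (simp add: coeff_1)
  qed
  then have "?p \<noteq> 0" by auto
  then obtain A where A: "?p = (\<Prod>x\<in>#A. [:- x, 1:])"
    using alg_closed_imp_factorization[of ?p] deg by auto
  have root: "x ^ m = 1" if "x \<in># A" for x
  proof -
    have "[:- x, 1:] dvd ?p" unfolding A using that by (intro dvd_prod_mset) auto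
    then have "poly ?p x = 0" using poly_eq_0_iff_dvd by blast
    then show ?thesis by (simp add: Polynomial.poly_monom)
  qed
  have "?ev ?p = (T ^^ m) v - v"
  proof -
    have "?ev (Polynomial.monom 1 m) = ?ev ?p + ?ev 1" using ev_add[of ?p 1] by simp
    moreover have "?ev 1 = v" by (simp add: one_pCons ev_pCons ev0 T(1))
    ultimately show ?thesis by (simp add: ev_monom)
  qed
  then have "?ev (\<Prod>x\<in>#A. [:- x, 1:]) \<in> J" using order A by simp
  then have "\<exists>\<zeta> u. \<zeta> ^ m = 1 \<and> u \<in> V \<and> u \<notin> J \<and> P u \<and> T u - scale \<zeta> u \<in> J"
    using root
  proof (induction A)
    case empty
    then show ?case using v by (simp add: one_pCons ev_pCons ev0 T(1))
  next
    case (add x A)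
    let ?u = "?ev (\<Prod>x\<in>#A. [:- x, 1:])"
    have Pu: "P (?ev (\<Prod>x\<in>#A. [:- x, 1:]))" for A
    proof (induction A)
      case empty
      then show ?case using P(1) by (simp add: one_pCons ev_pCons ev0 T(1))
    next
      case (add x A)
      then show ?case using P(2)[OF evV add] by (simp only: image_mset_add_mset prod_mset.add_mset ev_root)
    qed
    show ?case
    proof (cases "?u \<in> J")
      case True
      then show ?thesis using add by simp
    next
      case False
      have "T ?u - scale x ?u \<in> J"
        using add.prems(1) by (simp only: image_mset_add_mset prod_mset.add_mset ev_root)
      moreover have "x ^ m = 1" by (rule add.prems(2)) simp
      ultimately show ?thesis using False Pu evV by blast
    qed
  qed
  then show thesis using that by blast
qed

section \<open>The group algebra of a cyclic group\<close>

text \<open>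
  Here all \<open>e\<close> are the neutral element, and the eigenvectors are those of a generator of the group.
\<close>

theorem simple_classes_cyclic_group_algebra:
  assumes m: "m \<ge> 1"
  shows "{\<zeta> :: 'k. \<zeta> ^ m = 1} \<approx> simple_classes (cyclic_group_algebra m :: (int \<Rightarrow> 'k::alg_closed_field) ring)"
proof -
  let ?G = "integer_mod_group m"
  interpret G: group ?G by simp
  have carr: "carrier ?G = {0..<int m}" using m by (simp add: carrier_integer_mod_group)
  have pow_mod: "\<zeta> ^ nat (x mod int m) = \<zeta> ^ nat x" if "\<zeta> ^ m = 1" "x \<ge> 0" for \<zeta> :: 'k and x
  proof -
    have "nat x = nat (x mod int m) + m * nat (x div int m)"
      using that(2) m by (simp add: nat_mod_distrib nat_div_distrib)
    then have "\<zeta> ^ nat x = \<zeta> ^ nat (x mod int m) * (\<zeta> ^ m) ^ nat (x div int m)"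
      by (metis power_add power_mult)
    then show ?thesis using that by simp
  qed
  have "{\<zeta> :: 'k. \<zeta> ^ m = 1} \<approx> simple_classes (monoid_algebra ?G :: (int \<Rightarrow> 'k) ring)"
  proof (rule G.simple_classes_of_functionals[where h = "id :: (int \<Rightarrow> 'k) \<Rightarrow> _"
        and B = "monoid_algebra ?G" and K = "{\<zeta>. \<zeta> ^ m = 1}" and e = "\<lambda>_. 0" and c = "\<lambda>_. 1"
        and \<phi> = "\<lambda>\<zeta> x. \<zeta> ^ nat x"])
    show "ring (monoid_algebra ?G :: (int \<Rightarrow> 'k) ring)" by (rule G.ring_kG)
    show "id \<in> ring_hom (monoid_algebra ?G :: (int \<Rightarrow> 'k) ring) (monoid_algebra ?G)"
      by (auto intro: ring_hom_memI)
    show "{f \<in> carrier (monoid_algebra ?G). id f = \<zero>\<^bsub>monoid_algebra ?G :: (int \<Rightarrow> 'k) ring\<^esub>} \<subseteq> G.vanishing (\<lambda>x. \<zeta> ^ nat x)" for \<zeta> :: 'k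
      using left_ideal_def G.left_ideal_vanishing by auto
  next
    fix \<zeta> :: 'k and x y assume "\<zeta> \<in> {\<zeta>. \<zeta> ^ m = 1}" "x \<in> carrier ?G" "y \<in> carrier ?G"
    then show "\<zeta> ^ nat (x \<otimes>\<^bsub>?G\<^esub> 0 \<otimes>\<^bsub>?G\<^esub> y) = 1 * \<zeta> ^ nat x * \<zeta> ^ nat y"
      by (simp add: carr pow_mod mod_add_left_eq nat_add_distrib power_add)
  next
    fix \<zeta> \<zeta>' :: 'k assume z: "\<zeta> \<in> {\<zeta>. \<zeta> ^ m = 1}" "\<zeta>' \<in> {\<zeta>. \<zeta> ^ m = 1}" "\<zeta> \<noteq> \<zeta>'"
    have "m \<noteq> 1" using z by auto
    then have "1 \<in> carrier ?G" using m by (simp add: carr)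
    then have "\<exists>x\<in>carrier ?G. 1 * \<zeta> ^ nat x \<noteq> 1 * \<zeta>' ^ nat x" using z by (intro bexI[of _ 1]) simp
    then show "0 = (0::int) \<and> (\<exists>x\<in>carrier ?G. 1 * \<zeta> ^ nat x \<noteq> 1 * \<zeta>' ^ nat x) \<or>
        (\<forall>x\<in>carrier ?G. \<forall>y\<in>carrier ?G. \<zeta>' ^ nat (x \<otimes>\<^bsub>?G\<^esub> 0 \<otimes>\<^bsub>?G\<^esub> y) = 0) \<or>
        (\<forall>x\<in>carrier ?G. \<forall>y\<in>carrier ?G. \<zeta> ^ nat (x \<otimes>\<^bsub>?G\<^esub> 0 \<otimes>\<^bsub>?G\<^esub> y) = 0)" by blast
  next
    fix J :: "(int \<Rightarrow> 'k) set"
    assume J: "left_ideal (monoid_algebra ?G) J" "single \<one>\<^bsub>?G\<^esub> \<notin> J"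
    note l = G.left_ideal_kG[OF J(1)]
    let ?V = "carrier (monoid_algebra ?G) :: (int \<Rightarrow> 'k) set"
    define g where "g = 1 mod int m"
    have g: "g \<in> carrier ?G" using m by (simp add: carr g_def)
    let ?T = "\<lambda>f. single g \<otimes>\<^bsub>monoid_algebra ?G\<^esub> f :: int \<Rightarrow> 'k"
    have Tk: "(?T ^^ k) u = single (int k mod int m) \<otimes>\<^bsub>monoid_algebra ?G\<^esub> u" if u: "u \<in> ?V" for k u
    proof (induction k)
      case 0
      then show ?case using G.kG_mult_one[OF u] by simp
    next
      case (Suc k)
      have "int k mod int m \<in> carrier ?G" using m by (simp add: carr)
      then have "?T (single (int k mod int m) \<otimes>\<^bsub>monoid_algebra ?G\<^esub> u) =
          single (g \<otimes>\<^bsub>?G\<^esub> (int k mod int m)) \<otimes>\<^bsub>monoid_algebra ?G\<^esub> u"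
        using g u by (simp add: G.kG_mult_assoc[symmetric] G.kG_mult_single del: mult_integer_mod_group)
      also have "g \<otimes>\<^bsub>?G\<^esub> (int k mod int m) = int (Suc k) mod int m"
        by (simp add: g_def mod_add_eq)
      finally show ?case using Suc by simp
    qed
    have V1: "single 0 \<in> ?V" using G.kG_single[OF G.one_closed] by simp
    have T0: "?T 0 = 0"
      using g by (intro G.kG_ext) (auto simp: G.pairing_kG_mult)
    obtain \<zeta> u where \<zeta>: "\<zeta> ^ m = 1" "u \<in> ?V" "u \<notin> J" "?T u - scale \<zeta> u \<in> J"
    proof (rule exists_eigenvector[where V = ?V and T = ?T and v = "single 0" and J = J and m = m
          and P = "\<lambda>_. True"])
      have eq: "(?T ^^ m) (single 0) = single 0"
        using Tk[OF V1, of m] G.kG_mult_one[OF V1] by simp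
      show "(?T ^^ m) (single 0) - single 0 \<in> J" unfolding eq diff_self by (rule l(1))
    qed (use J V1 m g T0 in \<open>simp_all add: G.kG_mult_add_right G.kG_mult_scale_right\<close>)
    have pow: "(?T ^^ k) u - scale (\<zeta> ^ k) u \<in> J" for k
    proof (induction k)
      case 0
      show ?case by (simp only: funpow_0 power_0 scale_simps diff_self l(1))
    next
      case (Suc k)
      have "?T ((?T ^^ k) u - scale (\<zeta> ^ k) u) + scale (\<zeta> ^ k) (?T u - scale \<zeta> u) \<in> J"
        by (intro l(2) l(6) g Suc l(3) \<zeta>(4))
      moreover have "(?T ^^ k) u \<in> ?V" using Tk[OF \<zeta>(2)] \<zeta>(2) m by (simp add: carr)
      then have "?T ((?T ^^ k) u - scale (\<zeta> ^ k) u) + scale (\<zeta> ^ k) (?T u - scale \<zeta> u) =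
          (?T ^^ Suc k) u - scale (\<zeta> ^ Suc k) u"
        using g \<zeta>(2) by (simp add: G.kG_mult_diff_right G.kG_mult_scale_right mult.commute)
      ultimately show ?case by metis
    qed
    have "single (0 \<otimes>\<^bsub>?G\<^esub> x) \<otimes>\<^bsub>monoid_algebra ?G\<^esub> u - scale (1 * \<zeta> ^ nat x) u \<in> J"
      if x: "x \<in> carrier ?G" for x
      using pow[of "nat x"] x Tk[OF \<zeta>(2), of "nat x"] by (simp add: carr)
    then show "\<exists>\<zeta>\<in>{\<zeta>. \<zeta> ^ m = 1}. \<exists>v\<in>?V - J. \<forall>x\<in>carrier ?G.
        single (0 \<otimes>\<^bsub>?G\<^esub> x) \<otimes>\<^bsub>monoid_algebra ?G\<^esub> v - scale (1 * \<zeta> ^ nat x) v \<in> J"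
      using \<zeta> by blast
  qed (use m in \<open>auto simp: carr\<close>)
  then show ?thesis by (simp add: cyclic_group_algebra_def)
qed

section \<open>The functionals of the contour algebra\<close>

text \<open>
  The last assumption makes room for \<open>j\<close> arrows on a loop of depth \<open>1\<close>.
\<close>

locale contour =
  fixes n m :: nat and d :: enat and \<delta> :: "nat \<Rightarrow> 'k::alg_closed_field" and j :: nat
  assumes m: "m \<ge> 1" and j: "j < m" "\<delta> j \<noteq> 0" and deep: "j = 0 \<or> 1 \<le> d"
begin

abbreviation G where "G \<equiv> diagram_monoid n d"

sublocale G: Group.monoid G
  by (rule diagram_monoid)

abbreviation A :: "(region \<Rightarrow> 'k) ring" where "A \<equiv> monoid_algebra G"

text \<open>
  The diagrams with \<open>a\<close> northern and \<open>b\<close> southern nodes, as morphisms of a category with composition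
  \<open>stack\<close>.
\<close>

definition hom :: "nat \<Rightarrow> nat \<Rightarrow> region \<Rightarrow> bool" where
  "hom a b R \<longleftrightarrow> 2 * num_arcs R = a + b \<and> decorated_to_depth d R"

lemma carrier_G: "x \<in> carrier G \<longleftrightarrow> hom n n x"
  by (auto simp: diagram_monoid_def diagrams_def hom_def)

lemma one_G: "\<one>\<^bsub>G\<^esub> = identity_diagram n"
  by (simp add: diagram_monoid_def)

lemma mult_G: "hom n n x \<Longrightarrow> x \<otimes>\<^bsub>G\<^esub> y = stack n x y"
  by (simp add: diagram_monoid_def hom_def concatenate_eq_stack)

lemma hom_stack: "hom a b R \<Longrightarrow> hom b c S \<Longrightarrow> hom a c (stack b R S)"
  by (auto simp: hom_def intro!: decorated_stack)

lemma hom_assoc: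
  "hom a b R \<Longrightarrow> hom b c S \<Longrightarrow> hom c e T \<Longrightarrow> stack c (stack b R S) T = stack b R (stack c S T)"
  by (intro stack_assoc) (auto simp: hom_def)

lemma hom_identity: "hom a a (identity_diagram a)"
  by (simp add: hom_def)

lemma stack_identity:
  "hom a b R \<Longrightarrow> stack a (identity_diagram a) R = R" "hom a b R \<Longrightarrow> stack b R (identity_diagram b) = R"
  by (auto simp: hom_def intro!: stack_identity_left stack_identity_right)

lemma hom_reduces: "reduces m \<delta> R x S \<Longrightarrow> hom a b R \<Longrightarrow> hom a b S"
  unfolding hom_def using reduces_num_arcs reduces_decorated by metis

lemma reduces_stack:
  assumes "reduces m \<delta> R x R'" "reduces m \<delta> S y S'" "hom a b R" "hom b c S"
  shows "reduces m \<delta> (stack b R S) (x * y) (stack b R' S')"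
proof (rule reduces_trans)
  show "reduces m \<delta> (stack b R S) x (stack b R' S)"
    using assms by (intro reduces_stack_left) (auto simp: hom_def)
  show "reduces m \<delta> (stack b R' S) y (stack b R' S')"
    using assms hom_reduces[OF assms(1,3)] by (intro reduces_stack_right) (auto simp: hom_def)
qed

definition index :: "nat \<Rightarrow> bool" where
  "index i \<longleftrightarrow> i \<le> n \<and> even (n - i)"

definition cap :: "nat \<Rightarrow> region" where
  "cap i = cap_diagram i ((n - i) div 2)"

definition cup :: "nat \<Rightarrow> region" where
  "cup i = cup_diagram i ((n - i) div 2) (replicate j Anticlockwise)"

definition weight :: "nat \<Rightarrow> 'k" where
  "weight i = \<delta> j ^ ((n - i) div 2)"

lemma weight_nonzero [simp]: "weight i \<noteq> 0"
  using j by (simp add: weight_def)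

lemma index_eq: "index i \<Longrightarrow> i + 2 * ((n - i) div 2) = n"
  by (auto simp: index_def)

lemma hom_cap: "index i \<Longrightarrow> hom i n (cap i)"
  using index_eq[of i] by (simp add: cap_def hom_def)

lemma hom_cup: "index i \<Longrightarrow> hom n i (cup i)"
  using index_eq[of i] deep by (auto simp: cup_def hom_def intro!: decorated_cup_diagram)

text \<open>
  The caps meet the cups in loops with \<open>j\<close> anticlockwise arrows, each of which has value \<open>\<delta> j\<close>.
\<close>

lemma stack_cap_cup_reduces:
  assumes "index i"
  shows "reduces m \<delta> (stack n (cap i) (cup i)) (weight i) (identity_diagram i)"
proof -
  let ?t = "(n - i) div 2" and ?u = "replicate j Anticlockwise"
  have "excess (cyc ?u) = int j" by (simp add: excess_cyc count_list_replicate)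
  then have "nat (excess (cyc ?u) mod int m) = j" using j by simp
  then have w: "loops_value m \<delta> (replicate_mset ?t (Loop (cyc ?u) {#})) = weight i"
    by (simp add: loops_value_replicate weight_def)
  obtain L as where I: "identity_diagram i = Region L as" by (cases "identity_diagram i")
  have "stack n (cap i) (cup i) = Region (replicate_mset ?t (Loop (cyc ?u) {#}) + L) as"
    using stack_cap_cup[of i ?t ?u] index_eq[OF assms] by (simp add: cap_def cup_def I)
  then show ?thesis
    using reduces_remove_loops[of m \<delta> "replicate_mset ?t (Loop (cyc ?u) {#})" L as] w I by simp
qed

text \<open>
  \<open>deflate i\<close> compresses a diagram on \<open>n\<close> nodes to one on \<open>i\<close> nodes, and \<open>inflate i\<close> goes back. Modulo the
  relations and up to powers of \<open>weight i\<close>, these are the mutually inverse isomorphisms between the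
  algebra on \<open>i\<close> nodes and the corner cut out by the idempotent \<open>idem i / weight i\<close>.
\<close>

definition inflate :: "nat \<Rightarrow> region \<Rightarrow> region" where
  "inflate i D = stack i (cup i) (stack i D (cap i))"

definition deflate :: "nat \<Rightarrow> region \<Rightarrow> region" where
  "deflate i x = stack n (cap i) (stack n x (cup i))"

abbreviation idem :: "nat \<Rightarrow> region" where
  "idem i \<equiv> stack i (cup i) (cap i)"

lemma hom_inflate: "index i \<Longrightarrow> hom i i D \<Longrightarrow> hom n n (inflate i D)"
  unfolding inflate_def by (intro hom_stack hom_cup hom_cap)

lemma hom_deflate: "index i \<Longrightarrow> hom n n x \<Longrightarrow> hom i i (deflate i x)"
  unfolding deflate_def by (intro hom_stack hom_cup hom_cap)

lemma hom_idem: "index i \<Longrightarrow> hom n n (idem i)"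
  by (intro hom_stack hom_cup hom_cap)

lemma inflate_identity: "index i \<Longrightarrow> inflate i (identity_diagram i) = idem i"
  by (simp add: inflate_def stack_identity[OF hom_cap])

lemma stack_idem:
  assumes i: "index i" and x: "hom n n x" and y: "hom n n y"
  shows "stack n (stack n x (idem i)) y = stack i (stack n x (cup i)) (stack n (cap i) y)"
proof -
  note h = hom_cap[OF i] hom_cup[OF i]
  have "stack n (stack n x (idem i)) y = stack n (stack i (stack n x (cup i)) (cap i)) y"
    using hom_assoc[OF x h(2,1)] by simp
  also have "\<dots> = stack i (stack n x (cup i)) (stack n (cap i) y)"
    by (rule hom_assoc[OF hom_stack[OF x h(2)] h(1) y])
  finally show ?thesis .
qed

lemma deflate_stack_idem:
  assumes i: "index i" and k: "index k" and x: "hom n n x" and y: "hom n n y"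
  shows "deflate k (stack n (stack n x (idem i)) y) =
    stack i (stack n (cap k) (stack n x (cup i))) (stack n (cap i) (stack n y (cup k)))"
proof -
  note h = hom_cap[OF i] hom_cup[OF i] hom_cap[OF k] hom_cup[OF k]
  have xi: "hom n i (stack n x (cup i))" and iy: "hom i n (stack n (cap i) y)"
    using hom_stack[OF x h(2)] hom_stack[OF h(1) y] .
  have "deflate k (stack n (stack n x (idem i)) y) =
      stack n (cap k) (stack i (stack n x (cup i)) (stack n (stack n (cap i) y) (cup k)))"
    unfolding deflate_def stack_idem[OF i x y] by (simp only: hom_assoc[OF xi iy h(4)])
  also have "\<dots> = stack i (stack n (cap k) (stack n x (cup i))) (stack n (stack n (cap i) y) (cup k))"
    by (rule hom_assoc[OF h(3) xi hom_stack[OF iy h(4)], symmetric])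
  also have "stack n (stack n (cap i) y) (cup k) = stack n (cap i) (stack n y (cup k))"
    by (rule hom_assoc[OF h(1) y h(4)])
  finally show ?thesis .
qed

lemma inflate_deflate:
  assumes i: "index i" and x: "hom n n x"
  shows "inflate i (deflate i x) = stack n (stack n (idem i) x) (idem i)"
proof -
  note h = hom_cap[OF i] hom_cup[OF i]
  have xq: "hom n i (stack n x (cup i))" by (rule hom_stack[OF x h(2)])
  have "stack n (stack n (idem i) x) (idem i) = stack n (idem i) (stack n x (idem i))"
    by (rule hom_assoc[OF hom_idem[OF i] x hom_idem[OF i]])
  also have "\<dots> = stack i (cup i) (stack n (cap i) (stack n x (idem i)))"
    by (rule hom_assoc[OF h(2,1) hom_stack[OF x hom_idem[OF i]]])
  also have "stack n x (idem i) = stack i (stack n x (cup i)) (cap i)"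
    by (rule hom_assoc[OF x h(2,1), symmetric])
  also have "stack n (cap i) (stack i (stack n x (cup i)) (cap i)) = stack i (deflate i x) (cap i)"
    unfolding deflate_def by (rule hom_assoc[OF h(1) xq h(1), symmetric])
  finally show ?thesis by (simp add: inflate_def)
qed

text \<open>
  Where the two factors meet, \<open>cap i\<close> is stacked on \<open>cup i\<close>, which gives \<open>weight i\<close> times the identity.
\<close>

lemma inflate_stack:
  assumes i: "index i" and D: "hom i i D" "hom i i E"
  shows "reduces m \<delta> (stack n (inflate i D) (inflate i E)) (weight i) (inflate i (stack i D E))"
proof -
  note h = hom_cap[OF i] hom_cup[OF i]
  have Dp: "hom i n (stack i D (cap i))" and Ep: "hom i n (stack i E (cap i))"
    and qE: "hom n n (inflate i E)"
    using hom_stack[OF D(1) h(1)] hom_stack[OF D(2) h(1)] hom_inflate[OF i D(2)] .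
  have "stack n (inflate i D) (inflate i E) = stack i (cup i) (stack n (stack i D (cap i)) (inflate i E))"
    unfolding inflate_def[of i D] by (rule hom_assoc[OF h(2) Dp qE])
  also have "stack n (stack i D (cap i)) (inflate i E) = stack i D (stack n (cap i) (inflate i E))"
    by (rule hom_assoc[OF D(1) h(1) qE])
  also have "stack n (cap i) (inflate i E) = stack i (stack n (cap i) (cup i)) (stack i E (cap i))"
    unfolding inflate_def by (rule hom_assoc[OF h(1,2) Ep, symmetric])
  finally have eq: "stack n (inflate i D) (inflate i E) =
      stack i (cup i) (stack i D (stack i (stack n (cap i) (cup i)) (stack i E (cap i))))" .
  have pq: "hom i i (stack n (cap i) (cup i))" by (rule hom_stack[OF h])
  have r1: "reduces m \<delta> (stack i (stack n (cap i) (cup i)) (stack i E (cap i))) (weight i * 1)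
      (stack i (identity_diagram i) (stack i E (cap i)))"
    by (rule reduces_stack[OF stack_cap_cup_reduces[OF i] reduces.refl pq Ep])
  have r2: "reduces m \<delta> (stack i D (stack i (stack n (cap i) (cup i)) (stack i E (cap i)))) (1 * (weight i * 1))
      (stack i D (stack i (identity_diagram i) (stack i E (cap i))))"
    by (rule reduces_stack[OF reduces.refl r1 D(1) hom_stack[OF pq Ep]])
  have r3: "reduces m \<delta> (stack n (inflate i D) (inflate i E)) (1 * (1 * (weight i * 1)))
      (stack i (cup i) (stack i D (stack i (identity_diagram i) (stack i E (cap i)))))"
    unfolding eq
    by (rule reduces_stack[OF reduces.refl r2 h(2) hom_stack[OF D(1) hom_stack[OF pq Ep]]])
  have "stack i D (stack i (identity_diagram i) (stack i E (cap i))) = stack i (stack i D E) (cap i)"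
    by (simp only: stack_identity(1)[OF Ep] hom_assoc[OF D h(1)])
  then show ?thesis using r3 by (simp add: inflate_def)
qed

lemma inflate_reduces:
  assumes i: "index i" and D: "hom i i D" and r: "reduces m \<delta> D x E"
  shows "reduces m \<delta> (inflate i D) x (inflate i E)"
proof -
  note h = hom_cap[OF i] hom_cup[OF i]
  have "reduces m \<delta> (stack i D (cap i)) (x * 1) (stack i E (cap i))"
    by (rule reduces_stack[OF r reduces.refl D h(1)])
  from reduces_stack[OF reduces.refl this h(2) hom_stack[OF D h(1)]]
  show ?thesis by (simp add: inflate_def)
qed

definition rank :: "nat \<Rightarrow> nat" where
  "rank i = the_enat (min (enat i) d)"

lemma less_rank: "l < rank i \<longleftrightarrow> l < i \<and> enat l < d"
  unfolding rank_def by (cases d) (auto simp: min_def)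

text \<open>
  Lines of depth greater than \<open>d\<close> carry no arrows, so the default value \<open>1\<close> is only ever raised to the
  power \<open>0\<close>.
\<close>

definition eigenvalues :: "nat \<Rightarrow> (nat \<Rightarrow> 'k) \<Rightarrow> nat \<Rightarrow> 'k" where
  "eigenvalues i \<zeta> l = (if l < rank i then \<zeta> l else 1)"

definition labels :: "nat \<Rightarrow> (nat \<Rightarrow> 'k) set" where
  "labels i = ({..<rank i} \<rightarrow>\<^sub>E {z. z ^ m = 1})"

lemma eigenvalues_power: "\<zeta> \<in> labels i \<Longrightarrow> eigenvalues i \<zeta> l ^ m = 1"
  by (auto simp: eigenvalues_def labels_def PiE_def Pi_def)

definition character :: "nat \<Rightarrow> (nat \<Rightarrow> 'k) \<Rightarrow> region \<Rightarrow> 'k" where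
  "character i \<zeta> D = through_value m \<delta> (eigenvalues i \<zeta>) D"

definition functional :: "nat \<times> (nat \<Rightarrow> 'k) \<Rightarrow> region \<Rightarrow> 'k" where
  "functional = (\<lambda>(i, \<zeta>) x. character i \<zeta> (deflate i x) / weight i)"

lemma character_reduces:
  "\<zeta> \<in> labels i \<Longrightarrow> reduces m \<delta> R x S \<Longrightarrow> character i \<zeta> R = x * character i \<zeta> S"
  unfolding character_def by (rule through_value_reduces[OF _ eigenvalues_power m])

lemma character_stack:
  "hom i i D \<Longrightarrow> hom i i E \<Longrightarrow> character i \<zeta> (stack i D E) = character i \<zeta> D * character i \<zeta> E"
  unfolding character_def by (intro through_value_stack) (auto simp: hom_def)

lemma character_strand:
  "character i \<zeta> (strand ws) = (\<Prod>l<length ws. word_value (eigenvalues i \<zeta> l) (ws ! l))"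
  unfolding character_def by (rule through_value_strand)

lemma character_identity: "character i \<zeta> (identity_diagram k) = 1"
  by (simp add: identity_strand character_strand)

lemma character_cap_cup:
  "\<zeta> \<in> labels i \<Longrightarrow> index i \<Longrightarrow> character i \<zeta> (stack n (cap i) (cup i)) = weight i"
  by (simp add: character_reduces[OF _ stack_cap_cup_reduces] character_identity)

definition single_arrow :: "nat \<Rightarrow> nat \<Rightarrow> arrow list \<Rightarrow> region" where
  "single_arrow i l w = strand ((replicate i [])[l := w])"

lemma hom_single_arrow: "l < rank i \<Longrightarrow> hom i i (single_arrow i l w)"
  by (auto simp: hom_def single_arrow_def decorated_strand nth_list_update less_rank)

lemma character_single_arrow:
  assumes "l < rank i"
  shows "character i \<zeta> (single_arrow i l w) = word_value (\<zeta> l) w"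
proof -
  have l: "l < i" using assms by (simp add: less_rank)
  have "character i \<zeta> (single_arrow i l w) =
      (\<Prod>k<i. if k = l then word_value (eigenvalues i \<zeta> l) w else 1)"
    unfolding single_arrow_def character_strand
    by (intro prod.cong) (auto simp: nth_list_update)
  then show ?thesis using l assms by (simp add: prod.delta eigenvalues_def)
qed

lemma map2_append_single:
  assumes "l < length ws"
  shows "map2 (@) ((replicate (length ws) [])[l := u]) ws = ws[l := u @ ws ! l]"
  using assms by (intro nth_equalityI) (auto simp: nth_list_update)

lemma stack_single_arrow:
  "l < length ws \<Longrightarrow> length ws = i \<Longrightarrow> stack i (single_arrow i l u) (strand ws) = strand (ws[l := u @ ws ! l])"
  unfolding single_arrow_def by (subst stack_strand) (auto simp: map2_append_single)

lemma single_arrow_Nil: "single_arrow i l [] = identity_diagram i"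
proof -
  have "(replicate i [])[l := []] = replicate i ([] :: arrow list)"
    using list_update_id[of "replicate i ([] :: arrow list)" l] by (cases "l < i") (simp_all add: list_update_beyond)
  then show ?thesis by (simp add: single_arrow_def identity_strand)
qed

lemma functional_one: "\<zeta> \<in> labels i \<Longrightarrow> index i \<Longrightarrow> functional (i, \<zeta>) \<one>\<^bsub>G\<^esub> = 1"
  by (simp add: functional_def one_G deflate_def stack_identity[OF hom_cup] character_cap_cup)

text \<open>
  Deflation is multiplicative across \<open>idem i\<close>, and \<open>character\<close> is multiplicative on \<open>i\<close> nodes.
\<close>

lemma functional_mult:
  assumes "\<zeta> \<in> labels i" "index i" "hom n n x" "hom n n y"
  shows "functional (i, \<zeta>) (stack n (stack n x (idem i)) y) =
    weight i * functional (i, \<zeta>) x * functional (i, \<zeta>) y"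
proof -
  have "deflate i (stack n (stack n x (idem i)) y) = stack i (deflate i x) (deflate i y)"
    using deflate_stack_idem[OF assms(2,2,3,4)] by (simp add: deflate_def)
  then show ?thesis
    using assms by (simp add: functional_def character_stack hom_deflate)
qed

text \<open>
  The deflation of \<open>x (idem i) y\<close> to \<open>k\<close> nodes factors through \<open>i < k\<close> nodes.
\<close>

lemma functional_fewer:
  assumes "index i" "index k" "i < k" "hom n n x" "hom n n y"
  shows "functional (k, \<zeta>) (stack n (stack n x (idem i)) y) = 0"
proof -
  note h = hom_cap hom_cup
  have a: "hom k i (stack n (cap k) (stack n x (cup i)))"
    by (rule hom_stack[OF h(1)[OF assms(2)] hom_stack[OF assms(4) h(2)[OF assms(1)]]])
  have b: "hom i k (stack n (cap i) (stack n y (cup k)))"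
    by (rule hom_stack[OF h(1)[OF assms(1)] hom_stack[OF assms(5) h(2)[OF assms(2)]]])
  have "character k \<zeta> (deflate k (stack n (stack n x (idem i)) y)) = 0"
    unfolding deflate_stack_idem[OF assms(1,2,4,5)] character_def
    using a b assms(3) by (intro through_value_fewer[of _ k i]) (auto simp: hom_def)
  then show ?thesis by (simp add: functional_def)
qed

lemma functional_reduces:
  assumes "\<zeta> \<in> labels i" "index i" "hom n n x" "hom n n y" "hom n n D" "reduces m \<delta> D c E"
  shows "functional (i, \<zeta>) (stack n (stack n x D) y) = c * functional (i, \<zeta>) (stack n (stack n x E) y)"
proof -
  note h = hom_cap[OF assms(2)] hom_cup[OF assms(2)]
  have r1: "reduces m \<delta> (stack n x D) (1 * c) (stack n x E)"
    by (rule reduces_stack[OF reduces.refl assms(6) assms(3,5)])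
  have xD: "hom n n (stack n x D)" by (rule hom_stack[OF assms(3,5)])
  have r2: "reduces m \<delta> (stack n (stack n x D) y) (1 * c * 1) (stack n (stack n x E) y)"
    by (rule reduces_stack[OF r1 reduces.refl xD assms(4)])
  have xDy: "hom n n (stack n (stack n x D) y)" by (rule hom_stack[OF xD assms(4)])
  have r3: "reduces m \<delta> (stack n (stack n (stack n x D) y) (cup i)) (1 * c * 1 * 1)
      (stack n (stack n (stack n x E) y) (cup i))"
    by (rule reduces_stack[OF r2 reduces.refl xDy h(2)])
  have "reduces m \<delta> (deflate i (stack n (stack n x D) y)) (1 * (1 * c * 1 * 1)) (deflate i (stack n (stack n x E) y))"
    unfolding deflate_def by (rule reduces_stack[OF reduces.refl r3 h(1) hom_stack[OF xDy h(2)]])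
  then show ?thesis using assms(1) by (simp add: functional_def character_reduces)
qed

lemma functional_arrow:
  assumes "\<zeta> \<in> labels i" "index i" "l < rank i"
  shows "weight i * functional (i, \<zeta>) (inflate i (single_arrow i l [Anticlockwise])) = weight i ^ 2 * \<zeta> l"
proof -
  note h = hom_cap[OF assms(2)] hom_cup[OF assms(2)]
  let ?g = "single_arrow i l [Anticlockwise]" and ?pq = "stack n (cap i) (cup i)"
  have g: "hom i i ?g" by (rule hom_single_arrow[OF assms(3)])
  have pq: "hom i i ?pq" by (rule hom_stack[OF h])
  have gp: "hom i n (stack i ?g (cap i))" by (rule hom_stack[OF g h(1)])
  have "deflate i (inflate i ?g) = stack n (cap i) (stack i (cup i) (stack n (stack i ?g (cap i)) (cup i)))"
    unfolding deflate_def inflate_def by (simp only: hom_assoc[OF h(2) gp h(2)])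
  also have "\<dots> = stack i ?pq (stack n (stack i ?g (cap i)) (cup i))"
    by (rule hom_assoc[OF h hom_stack[OF gp h(2)], symmetric])
  also have "stack n (stack i ?g (cap i)) (cup i) = stack i ?g ?pq"
    by (rule hom_assoc[OF g h])
  finally have "character i \<zeta> (deflate i (inflate i ?g)) = weight i * (\<zeta> l * weight i)"
    using assms g pq hom_stack[OF g pq]
    by (simp add: character_stack character_cap_cup character_single_arrow)
  then show ?thesis by (simp add: functional_def power2_eq_square)
qed

end

section \<open>Highest weight vectors\<close>

lemma identified_strand:
  "l < length ws \<Longrightarrow> omit_arrows m w v \<Longrightarrow> identified m \<delta> (strand (ws[l := w])) 1 (strand (ws[l := v]))"
proof (induction ws arbitrary: l)
  case (Cons u ws)
  show ?case
  proof (cases l)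
    case 0
    then show ?thesis using Cons.prems by (auto intro: identified_single_arrows)
  next
    case (Suc k)
    then show ?thesis using Cons by (auto intro: identified_single_beyond)
  qed
qed simp

context contour
begin

lemma relator_eq:
  "(\<lambda>E. (if E = D then 1 else 0) - (if E = D' then c else 0)) = single D - scale c (single D')"
  by (auto simp: single_def scale_def)

lemma relators_carrier: "relators n m d \<delta> \<subseteq> carrier A"
proof
  fix f assume "f \<in> relators n m d \<delta>"
  then obtain D c D' where f: "f = single D - scale c (single D')"
    and D: "D \<in> diagrams n d" "identified m \<delta> D c D'"
    unfolding relators_def relator_eq by blast
  have "D' \<in> diagrams n d" "D \<in> diagrams n d"
    using D identified_num_arcs[OF D(2)] identified_decorated[OF D(2)] by (auto simp: diagrams_def)
  then have "D \<in> carrier G" "D' \<in> carrier G" by (auto simp: diagram_monoid_def)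
  then show "f \<in> carrier A" unfolding f by (intro G.kG_diff G.kG_scale G.kG_single)
qed

definition relations :: "(region \<Rightarrow> 'k) set" where
  "relations = Idl\<^bsub>A\<^esub> (relators n m d \<delta>)"

lemma relations_ideal: "ideal relations A"
  unfolding relations_def by (intro ring.genideal_ideal G.ring_kG relators_carrier)

text \<open>
  The relations are compatible with stacking, hence with deflation, and with the character.
\<close>

lemma relations_subset_vanishing:
  assumes "\<zeta> \<in> labels i" "index i"
  shows "relations \<subseteq> G.vanishing (functional (i, \<zeta>))"
  unfolding relations_def
proof (rule G.genideal_subset_vanishing[OF relators_carrier])
  fix f x y assume f: "f \<in> relators n m d \<delta>" and xy: "x \<in> carrier G" "y \<in> carrier G"
  then obtain D c D' where f: "f = single D - scale c (single D')"
    and D: "D \<in> diagrams n d" "identified m \<delta> D c D'"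
    unfolding relators_def relator_eq by blast
  have h: "hom n n D" "hom n n x" "hom n n y"
    using D xy by (auto simp: carrier_G diagrams_def hom_def)
  have D': "hom n n D'" by (rule hom_reduces[OF reduces_identified[OF D(2)] h(1)])
  have G: "single D \<in> carrier A" "scale c (single D') \<in> carrier A"
    using h D' by (auto simp: carrier_G)
  have "functional (i, \<zeta>) (x \<otimes>\<^bsub>G\<^esub> D \<otimes>\<^bsub>G\<^esub> y) = c * functional (i, \<zeta>) (x \<otimes>\<^bsub>G\<^esub> D' \<otimes>\<^bsub>G\<^esub> y)"
    using functional_reduces[OF assms h(2,3,1) reduces_identified[OF D(2)]] h D'
    by (simp add: mult_G hom_stack[OF h(2)])
  then show "pairing f (\<lambda>z. functional (i, \<zeta>) (x \<otimes>\<^bsub>G\<^esub> z \<otimes>\<^bsub>G\<^esub> y)) = 0"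
    unfolding f G.pairing_kG_diff[OF G] by simp
qed

end

text \<open>
  Such a left ideal \<open>J\<close> stands for the cyclic module \<open>A / J\<close> of the contour algebra; \<open>cong\<close> is equality in
  this module.
\<close>

locale contour_left_ideal = contour n m d \<delta> j
  for n m :: nat and d :: enat and \<delta> :: "nat \<Rightarrow> 'k::alg_closed_field" and j :: nat +
  fixes J :: "(region \<Rightarrow> 'k) set"
  assumes J: "left_ideal A J" and proper: "single \<one>\<^bsub>G\<^esub> \<notin> J" and relations: "relations \<subseteq> J"
begin

lemmas J_closed = G.left_ideal_kG[OF J]

definition act :: "region \<Rightarrow> (region \<Rightarrow> 'k) \<Rightarrow> region \<Rightarrow> 'k" where
  "act D f = single D \<otimes>\<^bsub>A\<^esub> f"

definition cong :: "(region \<Rightarrow> 'k) \<Rightarrow> (region \<Rightarrow> 'k) \<Rightarrow> bool" (infix "\<doteq>" 50) where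
  "f \<doteq> g \<longleftrightarrow> f \<in> carrier A \<and> g \<in> carrier A \<and> f - g \<in> J"

lemma cong_carrier: "f \<doteq> g \<Longrightarrow> f \<in> carrier A" "f \<doteq> g \<Longrightarrow> g \<in> carrier A"
  by (auto simp: cong_def)

lemma cong_refl: "f \<in> carrier A \<Longrightarrow> f \<doteq> f"
  unfolding cong_def diff_self using J_closed(1) by blast

lemma cong_sym: assumes "f \<doteq> g" shows "g \<doteq> f"
proof -
  have "f - g \<in> J" using assms unfolding cong_def by blast
  then have "0 - (f - g) \<in> J" by (rule J_closed(4)[OF J_closed(1)])
  moreover have "0 - (f - g) = g - f" by (simp only: diff_0 minus_diff_eq)
  ultimately show ?thesis using assms unfolding cong_def by metis
qed

lemma cong_trans [trans]: assumes "f \<doteq> g" "g \<doteq> h" shows "f \<doteq> h"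
proof -
  have "(f - g) + (g - h) \<in> J" using assms unfolding cong_def by (intro J_closed(2)) blast+
  moreover have "(f - g) + (g - h) = f - h" by (simp only: diff_add_cancel add_diff_eq)
  ultimately show ?thesis using assms unfolding cong_def by metis
qed

lemma cong_eq_trans [trans]: "f \<doteq> g \<Longrightarrow> g = h \<Longrightarrow> f \<doteq> h" "f = g \<Longrightarrow> g \<doteq> h \<Longrightarrow> f \<doteq> h"
  by simp_all

lemma cong_scale: assumes "f \<doteq> g" shows "scale c f \<doteq> scale c g"
  using assms J_closed(3)[of "f - g" c] unfolding cong_def scale_simps by (intro conjI G.kG_scale) blast+

lemma cong_diff: assumes "f \<doteq> g" "f' \<doteq> g'" shows "f - f' \<doteq> g - g'"
proof -
  have "f - g \<in> J" "f' - g' \<in> J" using assms unfolding cong_def by blast+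
  then have "(f - g) - (f' - g') \<in> J" by (rule J_closed(4))
  moreover have "(f - g) - (f' - g') = (f - f') - (g - g')"
    by (rule ext) (simp add: algebra_simps)
  ultimately show ?thesis using assms G.kG_diff unfolding cong_def by metis
qed

lemma cong_0_iff: "f \<doteq> 0 \<longleftrightarrow> f \<in> J"
  unfolding cong_def diff_0_right using J_closed(5) G.kG_zero by blast

lemma act_closed: "hom n n D \<Longrightarrow> f \<in> carrier A \<Longrightarrow> act D f \<in> carrier A"
  by (simp add: act_def carrier_G)

lemma cong_act:
  assumes D: "hom n n D" and fg: "f \<doteq> g" shows "act D f \<doteq> act D g"
proof -
  note c = cong_carrier[OF fg]
  have "single D \<otimes>\<^bsub>A\<^esub> (f - g) \<in> J"
    using D fg unfolding cong_def by (intro J_closed(6)) (simp_all only: carrier_G)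
  also have "single D \<otimes>\<^bsub>A\<^esub> (f - g) = act D f - act D g"
    unfolding act_def using D c by (intro G.kG_mult_diff_right) (auto simp: carrier_G)
  finally show ?thesis unfolding cong_def using c D act_closed by blast
qed

lemma act_scale: "hom n n D \<Longrightarrow> f \<in> carrier A \<Longrightarrow> act D (scale c f) = scale c (act D f)"
  by (simp add: act_def carrier_G G.kG_mult_scale_right)

lemma act_diff: "hom n n D \<Longrightarrow> f \<in> carrier A \<Longrightarrow> g \<in> carrier A \<Longrightarrow> act D (f - g) = act D f - act D g"
  unfolding act_def by (intro G.kG_mult_diff_right) (auto simp: carrier_G)

lemma act_add: "hom n n D \<Longrightarrow> f \<in> carrier A \<Longrightarrow> g \<in> carrier A \<Longrightarrow> act D (f + g) = act D f + act D g"
  unfolding act_def by (intro G.kG_mult_add_right) (auto simp: carrier_G)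

lemma act_stack:
  "hom n n D \<Longrightarrow> hom n n E \<Longrightarrow> f \<in> carrier A \<Longrightarrow> act (stack n D E) f = act D (act E f)"
  by (simp add: act_def carrier_G G.kG_mult_assoc[symmetric] G.kG_mult_single mult_G)

lemma cong_reduces:
  assumes "reduces m \<delta> D c E" "hom n n D" "f \<in> carrier A"
  shows "act D f \<doteq> scale c (act E f)"
  using assms
proof (induction rule: reduces.induct)
  case (refl D)
  then show ?case using cong_refl act_closed by simp
next
  case (step D x D' y E)
  have D': "hom n n D'" by (rule hom_reduces[OF reduces_identified[OF step.hyps(1)] step.prems(1)])
  interpret ideal relations A by (rule relations_ideal)
  have "D \<in> diagrams n d" using step.prems by (auto simp: hom_def diagrams_def)
  then have "single D - scale x (single D') \<in> relators n m d \<delta>"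
    unfolding relators_def relator_eq using step.hyps(1) by blast
  then have "single D - scale x (single D') \<in> relations"
    unfolding relations_def using ring.genideal_self[OF G.ring_kG relators_carrier] by blast
  then have "(single D - scale x (single D')) \<otimes>\<^bsub>A\<^esub> f \<in> relations"
    using step.prems(2) by (rule I_r_closed)
  also have "(single D - scale x (single D')) \<otimes>\<^bsub>A\<^esub> f = act D f - scale x (act D' f)"
    unfolding act_def using step.prems D'
    by (subst G.kG_mult_diff_left) (simp_all add: carrier_G G.kG_mult_scale_left)
  finally have "act D f - scale x (act D' f) \<in> J" using relations by blast
  then have "act D f \<doteq> scale x (act D' f)"
    unfolding cong_def using act_closed G.kG_scale step.prems D' by blast
  also have "\<dots> \<doteq> scale x (scale y (act E f))"
    by (intro cong_scale step.IH D' step.prems)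
  finally show ?case by simp
qed

lemma act_inflate_inflate:
  assumes "index i" "hom i i D" "hom i i E" "f \<in> carrier A"
  shows "act (inflate i D) (act (inflate i E) f) \<doteq> scale (weight i) (act (inflate i (stack i D E)) f)"
proof -
  note h = hom_inflate[OF assms(1,2)] hom_inflate[OF assms(1,3)]
  have "act (stack n (inflate i D) (inflate i E)) f \<doteq> scale (weight i) (act (inflate i (stack i D E)) f)"
    by (rule cong_reduces[OF inflate_stack[OF assms(1-3)] hom_stack[OF h] assms(4)])
  then show ?thesis by (simp add: act_stack h assms)
qed

lemma cong_scaleD: "scale c f \<doteq> scale c g \<Longrightarrow> c \<noteq> 0 \<Longrightarrow> f \<doteq> g"
  using cong_scale[of "scale c f" "scale c g" "inverse c"] by simp

text \<open>
  If \<open>D\<close> has fewer than \<open>i\<close> through lines, it factors through \<open>k = i - 2\<close> nodes. Inserting \<open>cap k\<close> stacked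
  on \<open>cup k\<close> twice at this place, which only costs nonzero scalars, makes \<open>idem k\<close> appear in the
  middle.
\<close>

lemma act_inflate_few_through_lines:
  assumes i: "index i" and below: "\<And>k f. index k \<Longrightarrow> k < i \<Longrightarrow> f \<in> carrier A \<Longrightarrow> act (idem k) f \<in> J"
    and D: "hom i i D" "lead D < i" and f: "f \<in> carrier A"
  shows "act (inflate i D) f \<in> J"
proof -
  have N: "num_arcs D = i" using D by (simp add: hom_def)
  have "i \<ge> 2"
  proof (rule ccontr)
    assume "\<not> i \<ge> 2"
    then have "i = 1" "lead D = 0" using D(2) by linarith+
    then show False using N by simp
  qed
  define k where "k = i - 2"
  have ik: "i = k + 2" using \<open>i \<ge> 2\<close> by (simp add: k_def)
  have k: "index k" using i ik by (auto simp: index_def)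
  let ?D1 = "cup_part k D" and ?D2 = "uncup D"
  have D1: "hom i k ?D1" and D2: "hom k i ?D2"
    using D N ik by (auto simp: hom_def num_arcs_cup_part decorated_cup_part decorated_uncup)
  have fac: "stack k ?D1 ?D2 = D"
    using D N ik by (intro stack_cup_part) auto
  note h = hom_cap[OF i] hom_cup[OF i] and hk = hom_cap[OF k] hom_cup[OF k]
  let ?a = "stack i (cup i) ?D1" and ?b = "stack i ?D2 (cap i)"
  have a: "hom n k ?a" and b: "hom k n ?b" using hom_stack[OF h(2) D1] hom_stack[OF D2 h(1)] .
  let ?x = "stack k ?a (cap k)" and ?y = "stack k (cup k) ?b"
  have x: "hom n n ?x" and y: "hom n n ?y" using hom_stack[OF a hk(1)] hom_stack[OF hk(2) b] .
  have eq: "stack n (stack n ?x (idem k)) ?y =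
      stack k (stack k ?a (stack n (cap k) (cup k))) (stack k (stack n (cap k) (cup k)) ?b)"
    using stack_idem[OF k x y] hom_assoc[OF a hk] hom_assoc[OF hk b] by simp
  have pq: "hom k k (stack n (cap k) (cup k))" by (rule hom_stack[OF hk])
  have "reduces m \<delta> (stack n (stack n ?x (idem k)) ?y) ((1 * weight k) * (weight k * 1))
      (stack k (stack k ?a (identity_diagram k)) (stack k (identity_diagram k) ?b))"
    unfolding eq
    by (rule reduces_stack[OF reduces_stack[OF reduces.refl stack_cap_cup_reduces[OF k] a pq]
          reduces_stack[OF stack_cap_cup_reduces[OF k] reduces.refl pq b] hom_stack[OF a pq] hom_stack[OF pq b]])
  also have "stack k (stack k ?a (identity_diagram k)) (stack k (identity_diagram k) ?b) = stack k ?a ?b"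
    using a b stack_identity by simp
  also have "stack k ?a ?b = stack i (cup i) (stack k ?D1 ?b)"
    by (rule hom_assoc[OF h(2) D1 b])
  also have "stack k ?D1 ?b = stack i D (cap i)"
    using hom_assoc[OF D1 D2 h(1)] fac by simp
  finally have "reduces m \<delta> (stack n (stack n ?x (idem k)) ?y) (weight k * weight k) (inflate i D)"
    by (simp add: inflate_def)
  from cong_reduces[OF this hom_stack[OF hom_stack[OF x hom_idem[OF k]] y] f]
  have c: "act (stack n (stack n ?x (idem k)) ?y) f \<doteq> scale (weight k * weight k) (act (inflate i D) f)" .
  have "act (stack n (stack n ?x (idem k)) ?y) f = act ?x (act (idem k) (act ?y f))"
    using x y f k by (simp add: act_stack hom_idem hom_stack[OF x] act_closed)
  also have "\<dots> \<in> J"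
    unfolding act_def[of ?x] using x k ik y f by (intro J_closed(6) below) (auto simp: carrier_G act_closed)
  finally have "0 \<doteq> act (stack n (stack n ?x (idem k)) ?y) f" by (rule cong_sym[OF cong_0_iff[THEN iffD2]])
  then have "0 \<doteq> scale (weight k * weight k) (act (inflate i D) f)" using c by (rule cong_trans)
  then have "scale (weight k * weight k) 0 \<doteq> scale (weight k * weight k) (act (inflate i D) f)"
    by (simp only: scale_simps)
  then have "0 \<doteq> act (inflate i D) f" by (rule cong_scaleD) simp
  then show ?thesis using cong_sym cong_0_iff by blast
qed

lemma stack_single_arrows:
  assumes "k < i" "l < i"
  shows "stack i (single_arrow i k u) (single_arrow i l v) =
    (if k = l then single_arrow i k (u @ v) else strand ((replicate i [])[l := v, k := u]))"
proof -
  have "stack i (single_arrow i k u) (single_arrow i l v) =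
      strand (((replicate i [])[l := v])[k := u @ (replicate i [])[l := v] ! k])"
    unfolding single_arrow_def[of i l] using assms by (intro stack_single_arrow) auto
  then show ?thesis using assms by (auto simp: single_arrow_def nth_list_update)
qed

lemma stack_single_arrows_commute:
  assumes "k < i" "l < i" "k \<noteq> l"
  shows "stack i (single_arrow i k u) (single_arrow i l v) = stack i (single_arrow i l v) (single_arrow i k u)"
  using assms by (simp add: stack_single_arrows list_update_swap)

text \<open>
  The operators that put one arrow on a line of depth at most \<open>d\<close> commute and have order \<open>m\<close>, up to the
  scalar \<open>weight i\<close>. So common eigenvectors can be found by treating one line after the other.
\<close>

lemma exists_common_eigenvector:
  assumes i: "index i" and w: "w \<in> carrier A" "w \<notin> J" "act (idem i) w \<doteq> scale (weight i) w"
    and s: "s \<le> rank i"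
  shows "\<exists>\<zeta> v. v \<in> carrier A \<and> v \<notin> J \<and> act (idem i) v \<doteq> scale (weight i) v \<and>
    (\<forall>l<s. \<zeta> l ^ m = 1 \<and> act (inflate i (single_arrow i l [Anticlockwise])) v \<doteq> scale (weight i * \<zeta> l) v)"
  using s
proof (induction s)
  case 0
  then show ?case using w by (intro exI[of _ undefined] exI[of _ w]) simp
next
  case (Suc s)
  then obtain \<zeta> v where v: "v \<in> carrier A" "v \<notin> J" "act (idem i) v \<doteq> scale (weight i) v"
    and \<zeta>: "\<And>l. l < s \<Longrightarrow> \<zeta> l ^ m = 1"
      "\<And>l. l < s \<Longrightarrow> act (inflate i (single_arrow i l [Anticlockwise])) v \<doteq> scale (weight i * \<zeta> l) v"
    by auto
  let ?c = "weight i" and ?g = "\<lambda>l w. single_arrow i l w"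
  have sr: "s < rank i" using Suc.prems by simp
  have rank: "l < i" if "l < rank i" for l using that by (simp add: less_rank)
  have hg: "hom i i (?g l w)" if "l < rank i" for l w using hom_single_arrow[OF that] .
  have hI: "hom n n (inflate i (?g l w))" if "l < rank i" for l w using hom_inflate[OF i hg[OF that]] .
  define T where "T = (\<lambda>f. scale (inverse ?c) (act (inflate i (?g s [Anticlockwise])) f))"
  have TV: "T f \<in> carrier A" if "f \<in> carrier A" for f
    unfolding T_def using act_closed[OF hI[OF sr] that] by (rule G.kG_scale)
  have Tcong: "T f \<doteq> T f'" if "f \<doteq> f'" for f f'
    unfolding T_def using that by (intro cong_scale cong_act hI sr)
  have Tpow: "(T ^^ k) v \<doteq> scale (inverse ?c) (act (inflate i (?g s (replicate k Anticlockwise))) v)" for k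
  proof (induction k)
    case 0
    have "scale (inverse ?c) (act (idem i) v) \<doteq> scale (inverse ?c) (scale ?c v)"
      using v(3) by (rule cong_scale)
    then have "scale (inverse ?c) (act (idem i) v) \<doteq> v" by simp
    then show ?case using cong_sym i by (simp add: single_arrow_Nil inflate_identity)
  next
    case (Suc k)
    let ?S = "?g s (replicate k Anticlockwise)"
    have "(T ^^ Suc k) v \<doteq> T (scale (inverse ?c) (act (inflate i ?S) v))"
      using Tcong[OF Suc] by simp
    also have "\<dots> = scale (inverse ?c * inverse ?c) (act (inflate i (?g s [Anticlockwise])) (act (inflate i ?S) v))"
      using v(1) by (simp add: T_def act_scale hI[OF sr] act_closed)
    also have "\<dots> \<doteq> scale (inverse ?c * inverse ?c) (scale ?c (act (inflate i (stack i (?g s [Anticlockwise]) ?S)) v))"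
      by (intro cong_scale act_inflate_inflate i hg sr v)
    also have "stack i (?g s [Anticlockwise]) ?S = ?g s (replicate (Suc k) Anticlockwise)"
      using rank[OF sr] by (simp add: stack_single_arrows)
    also have "scale (inverse ?c * inverse ?c) (scale ?c (act (inflate i (?g s (replicate (Suc k) Anticlockwise))) v)) =
        scale (inverse ?c) (act (inflate i (?g s (replicate (Suc k) Anticlockwise))) v)"
    proof -
      have "inverse ?c * inverse ?c * ?c = inverse ?c" by (simp only: mult.assoc left_inverse[OF weight_nonzero] mult_1_right)
      then show ?thesis by (simp only: scale_simps)
    qed
    finally show ?case .
  qed
  have "(T ^^ m) v \<doteq> v"
  proof -
    have "identified m \<delta> (?g s (replicate m Anticlockwise)) 1 (?g s [])"
      unfolding single_arrow_def using rank[OF sr]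
      by (intro identified_strand omit_arrows.non_opposing[of _ _ Anticlockwise]) auto
    then have "reduces m \<delta> (inflate i (?g s (replicate m Anticlockwise))) 1 (inflate i (?g s []))"
      by (intro inflate_reduces i hg sr reduces_identified)
    from cong_reduces[OF this hI[OF sr] v(1)]
    have "act (inflate i (?g s (replicate m Anticlockwise))) v \<doteq> act (idem i) v"
      using i by (simp add: single_arrow_Nil inflate_identity)
    also have "act (idem i) v \<doteq> scale ?c v" by (rule v(3))
    finally have "scale (inverse ?c) (act (inflate i (?g s (replicate m Anticlockwise))) v) \<doteq> scale (inverse ?c) (scale ?c v)"
      by (rule cong_scale)
    with Tpow[of m] have "(T ^^ m) v \<doteq> scale (inverse ?c) (scale ?c v)" by (rule cong_trans)
    then show ?thesis by simp
  qed
  then have order: "(T ^^ m) v - v \<in> J" by (simp only: cong_def)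
  define P where "P f \<longleftrightarrow> act (idem i) f \<doteq> scale ?c f \<and>
    (\<forall>l<s. act (inflate i (?g l [Anticlockwise])) f \<doteq> scale (?c * \<zeta> l) f)" for f
  have commute: "act (inflate i D) (T f - scale a f) \<doteq> scale x (T f - scale a f)"
    if D: "hom i i D" and f: "f \<in> carrier A" and eig: "act (inflate i D) f \<doteq> scale x f"
      and comm: "stack i D (?g s [Anticlockwise]) = stack i (?g s [Anticlockwise]) D" for D f x a
  proof -
    note hD = hom_inflate[OF i D] and hS = hI[OF sr, of "[Anticlockwise]"]
    let ?S = "inflate i (?g s [Anticlockwise])"
    have "act (inflate i D) (act ?S f) \<doteq> scale ?c (act (inflate i (stack i (?g s [Anticlockwise]) D)) f)"
      using act_inflate_inflate[OF i D hg[OF sr, of "[Anticlockwise]"] f] unfolding comm .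
    also have "\<dots> \<doteq> act ?S (act (inflate i D) f)"
      by (intro cong_sym[OF act_inflate_inflate] i D hg sr f)
    also have "\<dots> \<doteq> act ?S (scale x f)" by (rule cong_act[OF hS eig])
    finally have "act (inflate i D) (act ?S f) \<doteq> scale x (act ?S f)" by (simp only: act_scale hS f)
    then have "scale (inverse ?c) (act (inflate i D) (act ?S f)) \<doteq> scale (inverse ?c) (scale x (act ?S f))"
      by (rule cong_scale)
    then have DT: "act (inflate i D) (T f) \<doteq> scale x (T f)"
      unfolding T_def using act_closed[OF hS f] by (simp only: act_scale hD scale_simps mult.commute)
    have "act (inflate i D) (T f - scale a f) = act (inflate i D) (T f) - scale a (act (inflate i D) f)"
      using TV[OF f] f by (simp only: act_diff hD G.kG_scale act_scale)
    also have "\<dots> \<doteq> scale x (T f) - scale a (scale x f)"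
      by (intro cong_diff DT cong_scale eig)
    also have "\<dots> = scale x (T f - scale a f)" by (simp only: scale_simps mult.commute)
    finally show ?thesis .
  qed
  obtain z u where u: "z ^ m = 1" "u \<in> carrier A" "u \<notin> J" "P u" "T u - scale z u \<in> J"
  proof (rule exists_eigenvector[where V = "carrier A" and T = T and v = v and J = J and m = m and P = P])
    have h: "hom n n (inflate i (?g s [Anticlockwise]))" by (rule hI[OF sr])
    have "act (inflate i (?g s [Anticlockwise])) 0 = act (inflate i (?g s [Anticlockwise])) (scale 0 0)"
      by (simp only: scale_simps)
    also have "\<dots> = scale 0 (act (inflate i (?g s [Anticlockwise])) 0)"
      by (rule act_scale[OF h G.kG_zero])
    finally have "act (inflate i (?g s [Anticlockwise])) 0 = 0" by (simp only: scale_simps)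
    then show "T 0 = 0" by (simp only: T_def scale_simps)
    show "T (f + g) = T f + T g" if "f \<in> carrier A" "g \<in> carrier A" for f g
      using that by (simp only: T_def act_add[OF h] scale_simps)
    show "T (scale a f) = scale a (T f)" if "f \<in> carrier A" for a f
      using that by (simp only: T_def act_scale[OF h] scale_simps mult.commute)
    show "P v" using v \<zeta> by (simp add: P_def)
    show "P (T f - scale a f)" if f: "f \<in> carrier A" and P: "P f" for a f
    proof -
      have "act (inflate i (identity_diagram i)) (T f - scale a f) \<doteq> scale ?c (T f - scale a f)"
        using P i hg[OF sr]
        by (intro commute hom_identity f) (simp_all add: P_def inflate_identity stack_identity[OF hg[OF sr]])
      moreover have "act (inflate i (?g l [Anticlockwise])) (T f - scale a f) \<doteq> scale (?c * \<zeta> l) (T f - scale a f)"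
        if "l < s" for l
        using that sr P rank by (intro commute hg f stack_single_arrows_commute) (auto simp: P_def)
      ultimately show ?thesis unfolding P_def inflate_identity[OF i] by blast
    qed
  qed (use v m order TV in auto)
  have "T u \<doteq> scale z u"
    unfolding cong_def using u TV G.kG_scale by blast
  then have "scale ?c (T u) \<doteq> scale ?c (scale z u)" by (rule cong_scale)
  then have "act (inflate i (?g s [Anticlockwise])) u \<doteq> scale (?c * z) u"
    by (simp add: T_def)
  then show ?case using u \<zeta> unfolding P_def
    by (intro exI[of _ "\<zeta>(s := z)"] exI[of _ u]) (auto simp: less_Suc_eq)
qed

text \<open>
  Every arrow of a strand can be split off as a factor.
\<close>

lemma act_inflate_strand:
  assumes i: "index i" and v: "v \<in> carrier A" "act (idem i) v \<doteq> scale (weight i) v"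
    and \<zeta>: "\<zeta> \<in> labels i"
    and eig: "\<And>l. l < rank i \<Longrightarrow> act (inflate i (single_arrow i l [Anticlockwise])) v \<doteq> scale (weight i * \<zeta> l) v"
    and D: "hom i i (strand ws)"
  shows "act (inflate i (strand ws)) v \<doteq> scale (weight i * character i \<zeta> (strand ws)) v"
  using D
proof (induction "sum_list (map length ws)" arbitrary: ws rule: less_induct)
  case less
  let ?c = "weight i"
  have len: "length ws = i" using less.prems by (simp add: hom_def)
  show ?case
  proof (cases "\<exists>l<i. ws ! l \<noteq> []")
    case False
    then have "ws = replicate i []" using len by (intro nth_equalityI) auto
    then have "strand ws = identity_diagram i" by (simp add: identity_strand)
    then show ?thesis using v i by (simp add: inflate_identity character_identity)
  next
    case True
    then obtain l where l: "l < i" "ws ! l \<noteq> []" by blast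
    then obtain a w where aw: "ws ! l = a # w" by (cases "ws ! l") auto
    have lr: "l < rank i"
      using less.prems l len by (auto simp: less_rank hom_def decorated_strand)
    let ?ws = "ws[l := w]" and ?g = "single_arrow i l"
    note hg = hom_single_arrow[OF lr] and hI = hom_inflate[OF i hom_single_arrow[OF lr]]
    have ws: "hom i i (strand ?ws)"
      using less.prems l len aw by (auto simp: hom_def decorated_strand nth_list_update)
    have eq: "stack i (?g [a]) (strand ?ws) = strand ws"
    proof -
      have "ws[l := a # w] = ws" using aw by (metis list_update_id)
      then show ?thesis using l len by (simp add: stack_single_arrow)
    qed
    have "sum_list (map length ?ws) < sum_list (map length ws)"
      using l len aw elem_le_sum_list[of l "map length ws"] by (simp add: map_update sum_list_update)
    then have IH: "act (inflate i (strand ?ws)) v \<doteq> scale (?c * character i \<zeta> (strand ?ws)) v"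
      using ws by (intro less.hyps)
    \<comment> \<open>A clockwise arrow acts as the inverse of an anticlockwise one.\<close>
    have act_a: "act (inflate i (?g [a])) v \<doteq> scale (?c * arrow_value (\<zeta> l) a) v"
    proof (cases a)
      case Anticlockwise
      then show ?thesis using eig[OF lr] by simp
    next
      case Clockwise
      have "\<zeta> l ^ m = 1" using eigenvalues_power[OF \<zeta>, of l] lr by (simp add: eigenvalues_def)
      then have z: "\<zeta> l \<noteq> 0" using m by (cases m) auto
      have "act (inflate i (?g [Clockwise])) (act (inflate i (?g [Anticlockwise])) v) \<doteq>
          scale ?c (act (inflate i (stack i (?g [Clockwise]) (?g [Anticlockwise]))) v)"
        by (rule act_inflate_inflate[OF i hg hg v(1)])
      also have "stack i (?g [Clockwise]) (?g [Anticlockwise]) = ?g [Clockwise, Anticlockwise]"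
        using l by (simp add: stack_single_arrows)
      also have "scale ?c (act (inflate i (?g [Clockwise, Anticlockwise])) v) \<doteq> scale ?c (scale 1 (act (inflate i (?g [])) v))"
      proof -
        have "omit_arrows m [Clockwise, Anticlockwise] []"
          by (rule omit_arrows.opposing[of _ Clockwise]) simp
        then have "identified m \<delta> (?g [Clockwise, Anticlockwise]) 1 (?g [])"
          unfolding single_arrow_def using l by (intro identified_strand) auto
        then have "reduces m \<delta> (inflate i (?g [Clockwise, Anticlockwise])) 1 (inflate i (?g []))"
          by (intro inflate_reduces i hg reduces_identified)
        from cong_scale[OF cong_reduces[OF this hI v(1)]] show ?thesis .
      qed
      also have "scale ?c (scale 1 (act (inflate i (?g [])) v)) = scale ?c (act (idem i) v)"
        using i by (simp add: single_arrow_Nil inflate_identity)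
      also have "\<dots> \<doteq> scale ?c (scale ?c v)" by (rule cong_scale[OF v(2)])
      finally have 1: "act (inflate i (?g [Clockwise])) (act (inflate i (?g [Anticlockwise])) v) \<doteq> scale ?c (scale ?c v)" .
      have "scale (?c * \<zeta> l) (act (inflate i (?g [Clockwise])) v) =
          act (inflate i (?g [Clockwise])) (scale (?c * \<zeta> l) v)"
        by (rule act_scale[OF hI v(1), symmetric])
      also have "\<dots> \<doteq> act (inflate i (?g [Clockwise])) (act (inflate i (?g [Anticlockwise])) v)"
        by (rule cong_act[OF hI cong_sym[OF eig[OF lr]]])
      also note 1
      also have "scale ?c (scale ?c v) = scale (?c * \<zeta> l) (scale (?c * inverse (\<zeta> l)) v)"
      proof -
        have "?c * ?c = ?c * \<zeta> l * (?c * inverse (\<zeta> l))" using z by (simp add: field_simps)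
        then show ?thesis by (simp only: scale_simps)
      qed
      finally show ?thesis using cong_scaleD z Clockwise by simp
    qed
    have "scale ?c (act (inflate i (strand ws)) v) \<doteq> act (inflate i (?g [a])) (act (inflate i (strand ?ws)) v)"
      using cong_sym[OF act_inflate_inflate[OF i hg[of "[a]"] ws v(1)]] unfolding eq .
    also have "\<dots> \<doteq> act (inflate i (?g [a])) (scale (?c * character i \<zeta> (strand ?ws)) v)"
      by (rule cong_act[OF hI IH])
    also have "\<dots> = scale (?c * character i \<zeta> (strand ?ws)) (act (inflate i (?g [a])) v)"
      by (rule act_scale[OF hI v(1)])
    also have "\<dots> \<doteq> scale (?c * character i \<zeta> (strand ?ws)) (scale (?c * arrow_value (\<zeta> l) a) v)"
      by (rule cong_scale[OF act_a])
    also have "\<dots> = scale ?c (scale (?c * (arrow_value (\<zeta> l) a * character i \<zeta> (strand ?ws))) v)"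
      by (simp add: mult_ac)
    also have "arrow_value (\<zeta> l) a * character i \<zeta> (strand ?ws) = character i \<zeta> (strand ws)"
      using character_stack[OF hg ws, of \<zeta> "[a]"] lr unfolding eq by (simp add: character_single_arrow)
    finally show ?thesis by (rule cong_scaleD) simp
  qed
qed

text \<open>
  Let \<open>i\<close> be least such that \<open>idem i\<close> does not annihilate the module. On the image of \<open>idem i\<close> the
  diagrams on \<open>i\<close> nodes act through those with \<open>i\<close> through lines, and these act on a common eigenvector
  of the single arrows through a character.
\<close>

theorem exists_highest_weight_vector:
  "\<exists>\<kappa>\<in>Sigma {i. index i} labels. \<exists>v\<in>carrier A - J. \<forall>x\<in>carrier G.
    single (idem (fst \<kappa>) \<otimes>\<^bsub>G\<^esub> x) \<otimes>\<^bsub>A\<^esub> v - scale (weight (fst \<kappa>) * functional \<kappa> x) v \<in> J"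
proof -
  let ?P = "\<lambda>i. index i \<and> (\<exists>f\<in>carrier A. act (idem i) f \<notin> J)"
  have "?P n"
  proof -
    have "idem n = identity_diagram n"
      using stack_identity[OF hom_identity]
      by (simp add: cup_def cap_def cup_diagram_def cap_diagram_def cups_def)
    then have "act (idem n) (single \<one>\<^bsub>G\<^esub>) = single \<one>\<^bsub>G\<^esub>"
      unfolding act_def by (simp only: one_G[symmetric] G.kG_mult_one G.kG_single G.one_closed)
    then have "act (idem n) (single \<one>\<^bsub>G\<^esub>) \<notin> J" using proper by (simp only:) simp
    moreover have "index n" by (simp add: index_def)
    ultimately show ?thesis using G.kG_single[OF G.one_closed] by blast
  qed
  define i where "i = (LEAST i. ?P i)"
  have Pi: "?P i" unfolding i_def by (rule LeastI) fact
  then have i: "index i" by blast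
  let ?c = "weight i"
  have below: "act (idem k) f \<in> J" if "index k" "k < i" "f \<in> carrier A" for k f
    using not_less_Least[of k ?P] that unfolding i_def by blast
  obtain f where f: "f \<in> carrier A" "act (idem i) f \<notin> J" using Pi by blast
  let ?w = "act (idem i) f"
  have w: "?w \<in> carrier A" using act_closed[OF hom_idem[OF i] f(1)] .
  have "act (inflate i (identity_diagram i)) (act (inflate i (identity_diagram i)) f) \<doteq>
      scale ?c (act (inflate i (stack i (identity_diagram i) (identity_diagram i))) f)"
    by (rule act_inflate_inflate[OF i hom_identity hom_identity f(1)])
  then have "act (idem i) ?w \<doteq> scale ?c ?w"
    using i by (simp add: inflate_identity stack_identity[OF hom_identity])
  then obtain \<xi> v where v: "v \<in> carrier A" "v \<notin> J" "act (idem i) v \<doteq> scale ?c v"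
    and \<xi>: "\<forall>l<rank i. \<xi> l ^ m = 1 \<and> act (inflate i (single_arrow i l [Anticlockwise])) v \<doteq> scale (?c * \<xi> l) v"
    using exists_common_eigenvector[OF i w f(2), of "rank i"] by blast
  define \<zeta> where "\<zeta> = restrict \<xi> {..<rank i}"
  have \<zeta>: "\<zeta> \<in> labels i" using \<xi> by (auto simp: \<zeta>_def labels_def)
  have eig: "act (inflate i (single_arrow i l [Anticlockwise])) v \<doteq> scale (?c * \<zeta> l) v" if "l < rank i" for l
    using \<xi> that by (simp add: \<zeta>_def)
  have char: "act (inflate i D) v \<doteq> scale (?c * character i \<zeta> D) v" if D: "hom i i D" for D
  proof (cases "lead D < i")
    case True
    then have "character i \<zeta> D = 0"
      unfolding character_def using D by (intro through_value_lead) (simp add: hom_def)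
    moreover have "act (inflate i D) v \<doteq> 0"
      unfolding cong_0_iff by (rule act_inflate_few_through_lines[OF i below D True v(1)])
    ultimately show ?thesis by (simp only: mult_zero_right scale_simps)
  next
    case False
    then have "lead D = num_arcs D" using D lead_le_num_arcs[of D] by (simp add: hom_def)
    then obtain x ws where r: "reduces m \<delta> D x (strand ws)" using reduces_strand by blast
    have ws: "hom i i (strand ws)" by (rule hom_reduces[OF r D])
    have "act (inflate i D) v \<doteq> scale x (act (inflate i (strand ws)) v)"
      by (rule cong_reduces[OF inflate_reduces[OF i D r] hom_inflate[OF i D] v(1)])
    also have "\<dots> \<doteq> scale x (scale (?c * character i \<zeta> (strand ws)) v)"
      by (intro cong_scale act_inflate_strand i v \<zeta> eig ws)
    also have "\<dots> = scale (?c * character i \<zeta> D) v"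
      by (simp add: character_reduces[OF \<zeta> r] mult_ac)
    finally show ?thesis .
  qed
  have "single (idem i \<otimes>\<^bsub>G\<^esub> x) \<otimes>\<^bsub>A\<^esub> v - scale (?c * functional (i, \<zeta>) x) v \<in> J" if "x \<in> carrier G" for x
  proof -
    have x: "hom n n x" using that by (simp add: carrier_G)
    note ex = hom_stack[OF hom_idem[OF i] x]
    have "scale ?c (act (stack n (idem i) x) v) = act (stack n (idem i) x) (scale ?c v)"
      by (rule act_scale[OF ex v(1), symmetric])
    also have "\<dots> \<doteq> act (stack n (idem i) x) (act (idem i) v)"
      by (rule cong_act[OF ex cong_sym[OF v(3)]])
    also have "\<dots> = act (inflate i (deflate i x)) v"
      by (simp add: inflate_deflate[OF i x] act_stack[OF ex hom_idem[OF i] v(1)])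
    also have "\<dots> \<doteq> scale (?c * character i \<zeta> (deflate i x)) v"
      by (rule char[OF hom_deflate[OF i x]])
    also have "\<dots> = scale ?c (scale (?c * functional (i, \<zeta>) x) v)"
      by (simp add: functional_def)
    finally have "act (stack n (idem i) x) v \<doteq> scale (?c * functional (i, \<zeta>) x) v"
      by (rule cong_scaleD) simp
    then show ?thesis using mult_G[OF hom_idem[OF i]] by (simp only: cong_def act_def)
  qed
  then show ?thesis using i \<zeta> v
    by (intro bexI[of _ "(i, \<zeta>)"] bexI[of _ v]) simp_all
qed

end

section \<open>Counting simple modules\<close>

context contour
begin

text \<open>
  The pairs \<open>(i, \<zeta>)\<close> index the functionals. For equal \<open>i\<close> they are told apart by a single arrow on a
  line where the labels differ, for different \<open>i\<close> by the idempotent that belongs to the smaller one.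
\<close>

theorem simple_classes_contour_algebra:
  "Sigma {i. index i} labels \<approx> simple_classes (contour_algebra n m d \<delta>)"
proof -
  interpret I: ideal relations A by (rule relations_ideal)
  let ?B = "A Quot relations"
  let ?h = "a_r_coset A relations"
  have zero: "\<zero>\<^bsub>?B\<^esub> = relations" by (simp add: FactRing_def)
  have ker: "{f \<in> carrier A. ?h f = \<zero>\<^bsub>?B\<^esub>} = relations"
  proof (intro equalityI subsetI)
    fix f assume "f \<in> {f \<in> carrier A. ?h f = \<zero>\<^bsub>?B\<^esub>}"
    then show "f \<in> relations" using I.a_rcos_self[of f] by (simp only: zero mem_Collect_eq)
  next
    fix f assume f: "f \<in> relations"
    then have "?h f = relations" by (rule I.a_rcos_const)
    then show "f \<in> {f \<in> carrier A. ?h f = \<zero>\<^bsub>?B\<^esub>}" using I.a_Hcarr[OF f] by (simp only: zero mem_Collect_eq)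
  qed
  have G: "x \<otimes>\<^bsub>G\<^esub> idem i \<otimes>\<^bsub>G\<^esub> y = stack n (stack n x (idem i)) y"
    if "index i" "x \<in> carrier G" for x y i
    using that hom_stack[OF _ hom_idem, of n x i] by (simp add: mult_G carrier_G)
  have "Sigma {i. index i} labels \<approx> simple_classes ?B"
  proof (rule G.simple_classes_of_functionals[where h = ?h and e = "\<lambda>\<kappa>. idem (fst \<kappa>)"
        and c = "\<lambda>\<kappa>. weight (fst \<kappa>)" and \<phi> = functional])
    show "ring ?B" by (rule I.quotient_is_ring)
    show "?h \<in> ring_hom A ?B" by (rule I.rcos_ring_hom)
    show "?h ` carrier A = carrier ?B" by (auto simp: FactRing_def A_RCOSETS_def')
  next
    fix \<kappa> assume \<kappa>: "\<kappa> \<in> Sigma {i. index i} labels"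
    then show "idem (fst \<kappa>) \<in> carrier G" using hom_idem by (auto simp: carrier_G)
    show "weight (fst \<kappa>) \<noteq> 0" by simp
    show "functional \<kappa> \<one>\<^bsub>G\<^esub> = 1" using \<kappa> functional_one by auto
    show "{f \<in> carrier A. ?h f = \<zero>\<^bsub>?B\<^esub>} \<subseteq> G.vanishing (functional \<kappa>)"
      unfolding ker using \<kappa> relations_subset_vanishing by auto
    fix x y assume "x \<in> carrier G" "y \<in> carrier G"
    then show "functional \<kappa> (x \<otimes>\<^bsub>G\<^esub> idem (fst \<kappa>) \<otimes>\<^bsub>G\<^esub> y) =
        weight (fst \<kappa>) * functional \<kappa> x * functional \<kappa> y"
      using \<kappa> G functional_mult by (auto simp: carrier_G)
  next
    fix J :: "(region \<Rightarrow> 'k) set"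
    assume "left_ideal A J" "single \<one>\<^bsub>G\<^esub> \<notin> J" "{f \<in> carrier A. ?h f = \<zero>\<^bsub>?B\<^esub>} \<subseteq> J"
    then interpret contour_left_ideal n m d \<delta> j J
      unfolding ker by unfold_locales
    show "\<exists>\<kappa>\<in>Sigma {i. index i} labels. \<exists>v\<in>carrier A - J. \<forall>x\<in>carrier G.
        single (idem (fst \<kappa>) \<otimes>\<^bsub>G\<^esub> x) \<otimes>\<^bsub>A\<^esub> v - scale (weight (fst \<kappa>) * functional \<kappa> x) v \<in> J"
      by (rule exists_highest_weight_vector)
  next
    fix \<kappa> \<kappa>' assume \<kappa>: "\<kappa> \<in> Sigma {i. index i} labels" "\<kappa>' \<in> Sigma {i. index i} labels" "\<kappa> \<noteq> \<kappa>'"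
    obtain i \<zeta> where i: "\<kappa> = (i, \<zeta>)" "index i" "\<zeta> \<in> labels i" using \<kappa>(1) by auto
    obtain k \<xi> where k: "\<kappa>' = (k, \<xi>)" "index k" "\<xi> \<in> labels k" using \<kappa>(2) by auto
    consider "i < k" | "k < i" | "i = k" "\<zeta> \<noteq> \<xi>" using \<kappa>(3) i(1) k(1) by (cases i k rule: linorder_cases) auto
    then show "(idem (fst \<kappa>) = idem (fst \<kappa>') \<and>
          (\<exists>x\<in>carrier G. weight (fst \<kappa>) * functional \<kappa> x \<noteq> weight (fst \<kappa>') * functional \<kappa>' x)) \<or>
        (\<forall>x\<in>carrier G. \<forall>y\<in>carrier G. functional \<kappa>' (x \<otimes>\<^bsub>G\<^esub> idem (fst \<kappa>) \<otimes>\<^bsub>G\<^esub> y) = 0) \<or>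
        (\<forall>x\<in>carrier G. \<forall>y\<in>carrier G. functional \<kappa> (x \<otimes>\<^bsub>G\<^esub> idem (fst \<kappa>') \<otimes>\<^bsub>G\<^esub> y) = 0)"
    proof cases
      case 1
      then have "\<forall>x\<in>carrier G. \<forall>y\<in>carrier G. functional \<kappa>' (x \<otimes>\<^bsub>G\<^esub> idem (fst \<kappa>) \<otimes>\<^bsub>G\<^esub> y) = 0"
        using i k G functional_fewer[OF i(2) k(2)] by (simp add: carrier_G)
      then show ?thesis by blast
    next
      case 2
      then have "\<forall>x\<in>carrier G. \<forall>y\<in>carrier G. functional \<kappa> (x \<otimes>\<^bsub>G\<^esub> idem (fst \<kappa>') \<otimes>\<^bsub>G\<^esub> y) = 0"
        using i k G functional_fewer[OF k(2) i(2)] by (simp add: carrier_G)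
      then show ?thesis by blast
    next
      case 3
      then obtain l where l: "l < rank i" "\<zeta> l \<noteq> \<xi> l"
        using i(3) k(3) unfolding labels_def by (metis PiE_ext lessThan_iff)
      let ?x = "inflate i (single_arrow i l [Anticlockwise])"
      have "?x \<in> carrier G"
        using hom_inflate[OF i(2) hom_single_arrow[OF l(1)]] by (simp add: carrier_G)
      moreover have "weight i * functional \<kappa> ?x \<noteq> weight i * functional \<kappa>' ?x"
        using functional_arrow[OF i(3,2) l(1)] functional_arrow[of \<xi> i l] i k l 3 by simp
      ultimately show ?thesis using i k 3 by auto
    qed
  qed
  then show ?thesis by (simp add: contour_algebra_def relations_def Let_def)
qed

end

lemma finite_roots_of_unity:
  assumes "m \<ge> 1" shows "finite {z :: 'k::field. z ^ m = 1}"
proof -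
  have "Polynomial.coeff (Polynomial.monom (1 :: 'k) m - 1) m = 1"
    using assms by (simp add: coeff_1)
  then have "Polynomial.monom (1 :: 'k) m - 1 \<noteq> 0" by (metis coeff_0 zero_neq_one)
  then have "finite {z. poly (Polynomial.monom (1 :: 'k) m - 1) z = 0}" by (rule poly_roots_finite)
  then show ?thesis by (simp add: Polynomial.poly_monom)
qed

theorem corollary2p8:
  fixes \<delta> :: "nat \<Rightarrow> 'k::alg_closed_field" and m n :: nat and d :: enat
  assumes "m \<ge> 1"
    and "\<exists>j<m. \<delta> j \<noteq> 0"
    and "d = 0 \<Longrightarrow> \<delta> 0 \<noteq> 0"
  defines "A \<equiv> \<lambda>i. contour_algebra i m d \<delta>"
    and "C \<equiv> simple_classes (cyclic_group_algebra m :: (int \<Rightarrow> 'k) ring)"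
    and "r \<equiv> \<lambda>i. the_enat (min (enat i) d)"
  shows "indexes_simples
           (Sum_Type.Plus (if n < 2 then {} else simple_classes (A (n - 2))) (cartesian_power C (r n))) (A n)
         \<and> indexes_simples
           (SIGMA i:{i. i \<le> n \<and> even (n - i)}. cartesian_power C (r i)) (A n)"
proof -
  \<comment> \<open>For \<open>d = 0\<close> there are no arrows, so only \<open>\<delta> 0\<close> can be the value of a loop.\<close>
  obtain j where j: "j < m" "\<delta> j \<noteq> 0" "j = 0 \<or> 1 \<le> d"
  proof (cases "d = 0")
    case True
    then show thesis using that[of 0] assms(1,3) by simp
  next
    case False
    then show thesis using that assms(2) by (metis ileI1 one_eSuc not_gr_zero)
  qed
  let ?\<mu> = "{z :: 'k. z ^ m = 1}"
  have \<mu>: "finite ?\<mu>" using assms(1) by (rule finite_roots_of_unity)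
  have "?\<mu> \<approx> C" unfolding C_def using assms(1) by (rule simple_classes_cyclic_group_algebra)
  then have C: "finite C" "card C = card ?\<mu>"
    using \<mu> eqpoll_finite_iff eqpoll_iff_card by (metis, metis eqpoll_finite_iff)
  let ?s = "\<lambda>i. card ?\<mu> ^ r i"
  have power: "finite (cartesian_power C (r i))" "card (cartesian_power C (r i)) = ?s i" for i
    using C by (auto simp: cartesian_power_def card_PiE intro: finite_PiE)
  \<comment> \<open>All sets involved are finite, so it suffices to count.\<close>
  have A: "finite (simple_classes (A k)) \<and> card (simple_classes (A k)) = (\<Sum>i\<in>{i. i \<le> k \<and> even (k - i)}. ?s i)" for k
  proof -
    interpret contour k m d \<delta> j using assms(1) j by unfold_locales
    have labels: "finite (labels i)" "card (labels i) = ?s i" for i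
      using \<mu> by (auto simp: labels_def r_def rank_def card_PiE intro: finite_PiE)
    have I: "{i. index i} = {i. i \<le> k \<and> even (k - i)}" by (auto simp: index_def)
    have fin: "finite (Sigma {i. index i} labels)"
      unfolding I using labels by (intro finite_SigmaI) auto
    have "Sigma {i. index i} labels \<approx> simple_classes (A k)"
      unfolding A_def by (rule simple_classes_contour_algebra)
    then have "finite (simple_classes (A k))" "card (simple_classes (A k)) = card (Sigma {i. index i} labels)"
      using fin eqpoll_finite_iff eqpoll_iff_card by (metis, metis eqpoll_finite_iff)
    then show ?thesis using labels by (simp add: I card_SigmaI)
  qed
  have "Sum_Type.Plus (if n < 2 then {} else simple_classes (A (n - 2))) (cartesian_power C (r n)) \<approx> simple_classes (A n)"
  proof (subst eqpoll_iff_card)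
    show "finite (Sum_Type.Plus (if n < 2 then {} else simple_classes (A (n - 2))) (cartesian_power C (r n)))"
      using A power by simp
    show "finite (simple_classes (A n))" using A by blast
    show "card (Sum_Type.Plus (if n < 2 then {} else simple_classes (A (n - 2))) (cartesian_power C (r n))) =
        card (simple_classes (A n))"
    proof (cases "n < 2")
      case True
      then have "{i. i \<le> n \<and> even (n - i)} = {n}" by (auto simp: less_2_cases_iff le_Suc_eq)
      then show ?thesis using True A[of n] power by (simp add: card_Plus)
    next
      case False
      then have "{i. i \<le> n \<and> even (n - i)} = insert n {i. i \<le> n - 2 \<and> even (n - 2 - i)}"
        by (auto, presburger+)
      moreover have "n \<notin> {i. i \<le> n - 2 \<and> even (n - 2 - i)}" using False by auto
      ultimately show ?thesis using False A[of n] A[of "n - 2"] power by (simp add: card_Plus)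
    qed
  qed
  moreover have "(SIGMA i:{i. i \<le> n \<and> even (n - i)}. cartesian_power C (r i)) \<approx> simple_classes (A n)"
  proof (subst eqpoll_iff_card)
    show "finite (SIGMA i:{i. i \<le> n \<and> even (n - i)}. cartesian_power C (r i))"
      using power by (intro finite_SigmaI) auto
    show "finite (simple_classes (A n))" using A by blast
    show "card (SIGMA i:{i. i \<le> n \<and> even (n - i)}. cartesian_power C (r i)) = card (simple_classes (A n))"
      using A[of n] power by (simp add: card_SigmaI)
  qed
  ultimately show ?thesis by (simp add: indexes_simples_def)
qed

end
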